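(* If $A$ is an abelian group, then $\mathrm{IAut}(A)$ is metabelian-by-(locally finite). However, $\mathrm{IAut}(\mathbb{Z}(p^\infty)\oplus\mathbb{Z})$ (with $p$ a prime) is not nilpotent-by-(locally finite).
   Context: Abelian groups $A$ are written additively; endomorphisms act on the right. An automorphism $\gamma$ of an abelian group $A$ is called inertial if $(H+H\gamma)/H$ is finite for each subgroup $H\le A$. $\mathrm{IAut}(A)$ denotes the subgroup of $\mathrm{Aut}(A)$ generated by all inertial automorphisms of $A$. $\mathbb{Z}(p^\infty)$ is the Prüfer $p$-group. A group $G$ is X-by-Y if it has a normal subgroup $N$ with property X such that $G/N$ has property Y. *)

theory Defs
  imports
    Complex_Main
    "HOL-Computational_Algebra.Primes"
    "HOL-Algebra.Bij"
    "HOL-Algebra.Generated_Groups"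
    "HOL-Algebra.Elementary_Groups"
begin

text \<open>
  \<open>AutoGroup A\<close> multiplies automorphisms by \<open>(g \<otimes> f) x = g (f x)\<close>. With endomorphisms acting on
  the right one obtains the opposite group, which is isomorphic to it by inversion, and the
  generated subgroup is the same set; the group properties below are therefore unaffected.
\<close>

definition inertial :: "('a, 'b) monoid_scheme \<Rightarrow> ('a \<Rightarrow> 'a) \<Rightarrow> bool" where
  "inertial A \<gamma> \<longleftrightarrow> \<gamma> \<in> auto A \<and>
     (\<forall>H. subgroup H A \<longrightarrow>
        finite (carrier (A\<lparr>carrier := H <#>\<^bsub>A\<^esub> (\<gamma> ` H)\<rparr> Mod H)))"

definition IAut :: "('a, 'b) monoid_scheme \<Rightarrow> ('a \<Rightarrow> 'a) monoid" where
  "IAut A = (AutoGroup A)\<lparr>carrier := generate (AutoGroup A) {\<gamma>. inertial A \<gamma>}\<rparr>"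

definition metabelian :: "'a monoid \<Rightarrow> bool" where
  "metabelian G \<longleftrightarrow> group G \<and> comm_group (G\<lparr>carrier := derived G (carrier G)\<rparr>)"

definition commutator_subgroup :: "'a monoid \<Rightarrow> 'a set \<Rightarrow> 'a set \<Rightarrow> 'a set" where
  "commutator_subgroup G H K =
     generate G (\<Union>h\<in>H. \<Union>k\<in>K. {h \<otimes>\<^bsub>G\<^esub> k \<otimes>\<^bsub>G\<^esub> inv\<^bsub>G\<^esub> h \<otimes>\<^bsub>G\<^esub> inv\<^bsub>G\<^esub> k})"

primrec lower_central :: "'a monoid \<Rightarrow> nat \<Rightarrow> 'a set" where
  "lower_central G 0 = carrier G"
| "lower_central G (Suc n) = commutator_subgroup G (lower_central G n) (carrier G)"

definition nilpotent :: "'a monoid \<Rightarrow> bool" where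
  "nilpotent G \<longleftrightarrow> group G \<and> (\<exists>n. lower_central G n = {\<one>\<^bsub>G\<^esub>})"

definition locally_finite :: "'a monoid \<Rightarrow> bool" where
  "locally_finite G \<longleftrightarrow> group G \<and> (\<forall>S. finite S \<and> S \<subseteq> carrier G \<longrightarrow> finite (generate G S))"

definition is_X_by_Y :: "('a monoid \<Rightarrow> bool) \<Rightarrow> ('a set monoid \<Rightarrow> bool) \<Rightarrow> 'a monoid \<Rightarrow> bool" where
  "is_X_by_Y X Y G \<longleftrightarrow> (\<exists>N. N \<lhd> G \<and> X (G\<lparr>carrier := N\<rparr>) \<and> Y (G Mod N))"

text \<open>\<open>\<int>(p\<^sup>\<infinity>)\<close>, realised as the multiplicative group of complex roots of unity of \<open>p\<close>-power order.\<close>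

definition prufer_group :: "nat \<Rightarrow> complex monoid" where
  "prufer_group p = \<lparr>carrier = {z. \<exists>n. z ^ (p ^ n) = 1}, mult = (*), one = 1\<rparr>"

lemma comm_group_prufer_group:
  assumes "p > 0"
  shows "comm_group (prufer_group p)"
proof (rule comm_groupI)
  fix x y assume "x \<in> carrier (prufer_group p)" "y \<in> carrier (prufer_group p)"
  then obtain m n where m: "x ^ (p ^ m) = 1" and n: "y ^ (p ^ n) = 1"
    by (auto simp: prufer_group_def)
  have "x ^ (p ^ (m + n)) = 1"
    using m by (simp add: power_add power_mult)
  moreover have "y ^ (p ^ (m + n)) = 1"
    using n by (simp add: add.commute[of m n] power_add power_mult)
  ultimately show "x \<otimes>\<^bsub>prufer_group p\<^esub> y \<in> carrier (prufer_group p)"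
    by (auto simp: prufer_group_def power_mult_distrib intro!: exI[of _ "m + n"])
next
  fix x assume "x \<in> carrier (prufer_group p)"
  then obtain m where m: "x ^ (p ^ m) = 1"
    by (auto simp: prufer_group_def)
  then have "x \<noteq> 0"
    using assms by (metis power_0_left power_eq_0_iff zero_neq_one not_gr_zero)
  then show "\<exists>y\<in>carrier (prufer_group p). y \<otimes>\<^bsub>prufer_group p\<^esub> x = \<one>\<^bsub>prufer_group p\<^esub>"
    using m by (intro bexI[of _ "inverse x"]) (auto simp: prufer_group_def power_inverse)
qed (auto simp: prufer_group_def)

lemma group_IAut:
  assumes "group A"
  shows "group (IAut A)"
proof -
  interpret Aut: group "AutoGroup A"
    using assms by (rule group.AutoGroup)
  have "{\<gamma>. inertial A \<gamma>} \<subseteq> carrier (AutoGroup A)"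
    by (auto simp: inertial_def AutoGroup_def)
  then show ?thesis
    unfolding IAut_def by (rule Aut.subgroup_imp_group[OF Aut.generate_is_subgroup])
qed

end

theory Submission
  imports Defs "HOL-Library.Function_Algebras"
begin

text \<open>
  \<^bold>\<open>Metabelian-by-(locally finite).\<close> Let \<open>T\<close> be the torsion subgroup of \<open>A\<close> and let \<open>N\<close> consist of the
  \<open>\<gamma> \<in> IAut A\<close> that map every \<open>x \<in> T\<close> into \<open>\<langle>x\<rangle>\<close>. Clearly \<open>N\<close> is normal. Two elements of \<open>N\<close> commute on
  \<open>T\<close>. Any two elements of \<open>IAut A\<close> commute on \<open>A/T\<close>, because each of them sends every \<open>u\<close> to a rational
  multiple of \<open>u\<close> modulo \<open>T\<close> (\<open>IAut_rational\<close>). So the derived subgroup of \<open>N\<close> acts trivially on \<open>T\<close> and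
  on \<open>A/T\<close>, and such automorphisms commute with each other. Hence \<open>N\<close> is metabelian.

  The quotient by \<open>N\<close> is locally finite because a group generated by finitely many inertial
  automorphisms induces only finitely many permutations of the set of cyclic subgroups of \<open>T\<close>
  (\<open>torsion_finite_action\<close>). The main tool is \<open>inert_torsion_escape\<close>: for an inertial \<open>g\<close> of a torsion
  group there is a finite subgroup \<open>F\<close> such that \<open>\<langle>x, g x\<rangle> \<inter> F = 0\<close> implies \<open>g x \<in> \<langle>x\<rangle>\<close>; otherwise one
  could choose a sequence \<open>x\<^sub>0, x\<^sub>1, \<dots>\<close> for which the subgroup \<open>H\<close> generated by the \<open>x\<^sub>i\<close> has infinite index
  in \<open>H + g H\<close>. It follows that \<open>g\<close> preserves all cyclic subgroups of the \<open>p\<close>-component for almost all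
  \<open>p\<close>, and it remains to treat one \<open>p\<close>-component \<open>P\<close> at a time (\<open>primary_finite_action\<close>).
  Here \<open>g\<close> preserves all cyclic subgroups of some \<open>C \<le> P\<close> such that \<open>P/C\<close> has finite socle
  (\<open>inert_power_socle\<close>), and all cyclic subgroups of the largest divisible subgroup \<open>D\<close>
  (\<open>inert_power_max_div\<close>). If \<open>P\<close> is bounded then \<open>C\<close> has finite index, and finitely many inertial
  automorphisms generate a finite group on \<open>P\<close> (\<open>bounded_finite_action\<close>). If \<open>P/D\<close> is unbounded then
  one may again take \<open>C\<close> of finite index (\<open>inert_power_finite_index\<close>). So if \<open>P\<close> is unbounded, then it is
  the sum of an unbounded subgroup, namely \<open>D\<close> or \<open>C\<close>, whose cyclic subgroups are preserved, and the
  bounded subgroup \<open>P[p\<^sup>k]\<close>, on which only finitely many maps are induced. Two elements of the group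
  that agree on \<open>P[p\<^sup>k]\<close> permute the cyclic subgroups of \<open>P\<close> in the same way (\<open>gen_agree_power\<close>).

  \<^bold>\<open>The example.\<close> On \<open>\<int>(p\<^sup>\<infinity>) \<oplus> \<int>\<close> the shears \<open>(z, n) \<mapsto> (z + n a, n)\<close> and the map that multiplies the
  first coordinate by \<open>1 + p\<close> are inertial. A normal subgroup with locally finite quotient contains
  a power of the latter, multiplication by \<open>r \<noteq> 1\<close> on the first coordinate. Because \<open>\<int>(p\<^sup>\<infinity>)\<close> is
  divisible, every shear is a commutator of a shear with that power (\<open>shear_commutator\<close>). So the normal
  subgroup contains all shears, and so does each term of its lower central series.
\<close>

section \<open>Abelian groups as modules over the integers\<close>

text \<open>
  Integer multiples in an additive abelian group. They make the type a module over \<open>int\<close>, so that the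
  subgroups are its submodules \<open>Z.subspace\<close> and \<open>Z.span {x}\<close> is the cyclic subgroup generated by \<open>x\<close>.
\<close>

definition zmul :: "int \<Rightarrow> 'u::ab_group_add \<Rightarrow> 'u" (infixr \<open>*\<^sub>Z\<close> 75) where
  "k *\<^sub>Z x = (if k \<ge> 0 then ((+) x ^^ nat k) 0 else - ((+) x ^^ nat (- k)) 0)"

lemma zmul_0: "0 *\<^sub>Z x = 0"
  by (simp add: zmul_def)

lemma zmul_succ: "(k + 1) *\<^sub>Z x = k *\<^sub>Z x + x"
proof (cases "k \<ge> 0")
  case True
  then have "nat (k + 1) = Suc (nat k)" by simp
  with True show ?thesis by (simp add: zmul_def add.commute)
next
  case False
  then have "nat (- k) = Suc (nat (- (k + 1)))" by simp
  with False show ?thesis by (cases "k = -1") (auto simp add: zmul_def)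
qed

lemma zmul_add: "(k + l) *\<^sub>Z x = k *\<^sub>Z x + l *\<^sub>Z x"
proof (induction l rule: int_induct[where k = 0])
  case (step1 i)
  then show ?case using zmul_succ[of "k + i" x] zmul_succ[of i x] by (simp add: algebra_simps)
next
  case (step2 i)
  then show ?case using zmul_succ[of "k + i - 1" x] zmul_succ[of "i - 1" x] by (simp add: algebra_simps)
qed (simp add: zmul_0)

lemma zmul_1: "1 *\<^sub>Z x = x"
  using zmul_succ[of 0 x] by (simp add: zmul_0)

interpretation Z: Modules.module zmul
proof
  fix a b :: int and x y :: 'a
  show "a *\<^sub>Z (x + y) = a *\<^sub>Z x + a *\<^sub>Z y"
  proof (induction a rule: int_induct[where k = 0])
    case (step1 i)
    then show ?case using zmul_succ[of i x] zmul_succ[of i y] zmul_succ[of i "x + y"]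
      by (simp add: algebra_simps)
  next
    case (step2 i)
    then show ?case using zmul_succ[of "i - 1" x] zmul_succ[of "i - 1" y] zmul_succ[of "i - 1" "x + y"]
      by (simp add: algebra_simps)
  qed (simp add: zmul_0)
  show "(a + b) *\<^sub>Z x = a *\<^sub>Z x + b *\<^sub>Z x" by (rule zmul_add)
  show "a *\<^sub>Z b *\<^sub>Z x = (a * b) *\<^sub>Z x"
  proof (induction a rule: int_induct[where k = 0])
    case (step1 i)
    then show ?case by (simp add: zmul_add zmul_1 distrib_right)
  next
    case (step2 i)
    then have "(i - 1) *\<^sub>Z b *\<^sub>Z x = (i * b) *\<^sub>Z x - b *\<^sub>Z x"
      using zmul_succ[of "i - 1" "b *\<^sub>Z x"] by simp
    also have "\<dots> = ((i - 1) * b) *\<^sub>Z x"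
      using zmul_add[of "(i - 1) * b" b x] by (simp add: algebra_simps)
    finally show ?case .
  qed (simp add: zmul_0)
  show "1 *\<^sub>Z x = x" by (rule zmul_1)
qed


lemma in_span1: "y \<in> Z.span {x} \<longleftrightarrow> (\<exists>k. y = k *\<^sub>Z x)"
  by (auto simp: Z.span_singleton)

section \<open>Finitely many classes\<close>

text \<open>
  The set \<open>X\<close> splits into finitely many pieces such that any two elements of one piece are related by
  \<open>R\<close>. The pieces are the fibres of a function, here with values in \<open>nat\<close>, so no property of \<open>R\<close> is needed.
\<close>

definition fin_many :: "'b set \<Rightarrow> ('b \<Rightarrow> 'b \<Rightarrow> bool) \<Rightarrow> bool" where
  "fin_many X R \<longleftrightarrow> (\<exists>f :: 'b \<Rightarrow> nat. finite (f ` X) \<and> (\<forall>x\<in>X. \<forall>y\<in>X. f x = f y \<longrightarrow> R x y))"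

lemma fin_manyI:
  assumes "finite (f ` X)" "\<And>x y. x \<in> X \<Longrightarrow> y \<in> X \<Longrightarrow> f x = f y \<Longrightarrow> R x y"
  shows "fin_many X R"
proof -
  obtain e :: "_ \<Rightarrow> nat" where e: "inj_on e (f ` X)"
    using finite_imp_inj_to_nat_seg[OF assms(1)] by blast
  show ?thesis
    unfolding fin_many_def
  proof (rule exI[of _ "\<lambda>x. e (f x)"], intro conjI ballI impI)
    have "(\<lambda>x. e (f x)) ` X = e ` (f ` X)" by auto
    then show "finite ((\<lambda>x. e (f x)) ` X)" using assms(1) by simp
  next
    fix x y assume "x \<in> X" "y \<in> X" "e (f x) = e (f y)"
    then show "R x y" using inj_onD[OF e] assms(2) by blast
  qed
qed

lemma fin_manyE:
  assumes "fin_many X R"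
  obtains f :: "'b \<Rightarrow> nat" where "finite (f ` X)" "\<And>x y. x \<in> X \<Longrightarrow> y \<in> X \<Longrightarrow> f x = f y \<Longrightarrow> R x y"
  using assms unfolding fin_many_def by blast

lemma fin_many_mono:
  assumes "fin_many X R" "Y \<subseteq> X" "\<And>x y. x \<in> Y \<Longrightarrow> y \<in> Y \<Longrightarrow> R x y \<Longrightarrow> Q x y"
  shows "fin_many Y Q"
proof -
  obtain f :: "_ \<Rightarrow> nat" where f: "finite (f ` X)" "\<And>x y. x \<in> X \<Longrightarrow> y \<in> X \<Longrightarrow> f x = f y \<Longrightarrow> R x y"
    using assms(1) by (rule fin_manyE) blast
  show ?thesis
  proof (rule fin_manyI[of f])
    show "finite (f ` Y)" using f(1) assms(2) by (meson finite_subset image_mono)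
  qed (use f(2) assms(2,3) in blast)
qed

lemma fin_many_conj:
  assumes "fin_many X R" "fin_many X Q"
  shows "fin_many X (\<lambda>x y. R x y \<and> Q x y)"
proof -
  obtain f :: "_ \<Rightarrow> nat" where f: "finite (f ` X)" "\<And>x y. x \<in> X \<Longrightarrow> y \<in> X \<Longrightarrow> f x = f y \<Longrightarrow> R x y"
    using assms(1) by (rule fin_manyE) blast
  obtain g :: "_ \<Rightarrow> nat" where g: "finite (g ` X)" "\<And>x y. x \<in> X \<Longrightarrow> y \<in> X \<Longrightarrow> g x = g y \<Longrightarrow> Q x y"
    using assms(2) by (rule fin_manyE) blast
  have "finite ((\<lambda>x. (f x, g x)) ` X)"
    by (rule finite_subset[of _ "f ` X \<times> g ` X"]) (use f g in auto)
  then show ?thesis by (rule fin_manyI) (use f g in auto)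
qed

lemma fin_many_Ball:
  assumes "finite I" "\<And>i. i \<in> I \<Longrightarrow> fin_many X (R i)"
  shows "fin_many X (\<lambda>x y. \<forall>i\<in>I. R i x y)"
  using assms
proof (induction I rule: finite_induct)
  case empty
  show ?case by (rule fin_manyI[of "\<lambda>_. ()"]) auto
next
  case (insert i I)
  then have "fin_many X (\<lambda>x y. R i x y \<and> (\<forall>i\<in>I. R i x y))"
    by (intro fin_many_conj) auto
  then show ?case by (rule fin_many_mono) auto
qed

lemma fin_many_comp:
  assumes "fin_many X R" "f ` Y \<subseteq> X"
  shows "fin_many Y (\<lambda>x y. R (f x) (f y))"
proof -
  obtain g :: "_ \<Rightarrow> nat" where g: "finite (g ` X)" "\<And>x y. x \<in> X \<Longrightarrow> y \<in> X \<Longrightarrow> g x = g y \<Longrightarrow> R x y"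
    using assms(1) by (rule fin_manyE) blast
  have "finite ((\<lambda>x. g (f x)) ` Y)"
    by (rule finite_subset[of _ "g ` X"]) (use g assms in auto)
  then show ?thesis by (rule fin_manyI) (use g assms in auto)
qed

lemma fin_many_finite: "finite X \<Longrightarrow> (\<And>x. R x x) \<Longrightarrow> fin_many X R"
  by (rule fin_manyI[of "\<lambda>x. x"]) auto

lemma fin_many_reps:
  assumes "fin_many X R"
  obtains D where "finite D" "D \<subseteq> X" "\<And>x. x \<in> X \<Longrightarrow> \<exists>d\<in>D. R d x"
proof -
  obtain f :: "_ \<Rightarrow> nat" where f: "finite (f ` X)" "\<And>x y. x \<in> X \<Longrightarrow> y \<in> X \<Longrightarrow> f x = f y \<Longrightarrow> R x y"
    using assms(1) by (rule fin_manyE) blast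
  let ?D = "inv_into X f ` (f ` X)"
  have "finite ?D" using f by blast
  moreover have "?D \<subseteq> X" by (auto intro: inv_into_into)
  moreover have "\<exists>d\<in>?D. R d x" if "x \<in> X" for x
  proof (rule bexI[of _ "inv_into X f (f x)"])
    show "R (inv_into X f (f x)) x"
      using that by (intro f(2)) (auto intro: inv_into_into f_inv_into_f)
  qed (use that in auto)
  ultimately show ?thesis by (rule that)
qed

lemma fin_many_pigeonhole:
  assumes "fin_many X R" "\<And>i :: nat. s i \<in> X"
  obtains i j where "i < j" "R (s i) (s j)" "R (s j) (s i)"
proof -
  obtain f :: "_ \<Rightarrow> nat" where f: "finite (f ` X)" "\<And>x y. x \<in> X \<Longrightarrow> y \<in> X \<Longrightarrow> f x = f y \<Longrightarrow> R x y"
    using assms(1) by (rule fin_manyE) blast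
  have "finite (range (\<lambda>i. f (s i)))"
    by (rule finite_subset[OF _ f(1)]) (use assms(2) in auto)
  then have "\<not> inj (\<lambda>i. f (s i))" using finite_imageD infinite_UNIV_nat by blast
  then obtain i j where "i \<noteq> j" "f (s i) = f (s j)" unfolding inj_def by blast
  then obtain i j where "i < j" "f (s i) = f (s j)"
    by (metis linorder_neqE_nat)
  then show ?thesis using that[of i j] f(2) assms(2) by metis
qed

text \<open>
  The image of \<open>X\<close> modulo the subgroup \<open>K\<close> is finite; \<open>X\<close> need not contain \<open>K\<close>.
\<close>

abbreviation fin_mod :: "'u::ab_group_add set \<Rightarrow> 'u set \<Rightarrow> bool" where
  "fin_mod X K \<equiv> fin_many X (\<lambda>x y. x - y \<in> K)"

section \<open>Additive maps and orders of elements\<close>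

text \<open>
  Additivity on a subset. All maps are total functions, and only their values on the subgroup at
  hand matter.
\<close>

definition add_on :: "'u::ab_group_add set \<Rightarrow> ('u \<Rightarrow> 'u) \<Rightarrow> bool" where
  "add_on S g \<longleftrightarrow> (\<forall>x\<in>S. \<forall>y\<in>S. g (x + y) = g x + g y)"

context
  fixes S :: "'u::ab_group_add set" and g
  assumes S: "Z.subspace S" and g: "add_on S g"
begin

lemma add_on_0: "g 0 = 0"
  using g Z.subspace_0[OF S] unfolding add_on_def by (metis add_cancel_left_left)

lemma add_on_add: "x \<in> S \<Longrightarrow> y \<in> S \<Longrightarrow> g (x + y) = g x + g y"
  using g unfolding add_on_def by blast

lemma add_on_minus: "x \<in> S \<Longrightarrow> g (- x) = - g x"
  using add_on_0 add_on_add[of x "- x"] Z.subspace_neg[OF S]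
  by (simp add: eq_neg_iff_add_eq_0 add.commute)

lemma add_on_diff: "x \<in> S \<Longrightarrow> y \<in> S \<Longrightarrow> g (x - y) = g x - g y"
  using add_on_minus[of y] add_on_add[of x "- y"] Z.subspace_neg[OF S] by simp

lemma add_on_zmul: "x \<in> S \<Longrightarrow> g (k *\<^sub>Z x) = k *\<^sub>Z g x"
proof (induction k rule: int_induct[where k = 0])
  case (step1 i)
  then show ?case by (simp add: Z.scale_left_distrib add_on_add Z.subspace_scale[OF S])
next
  case (step2 i)
  then show ?case by (simp add: Z.scale_left_diff_distrib add_on_diff Z.subspace_scale[OF S])
qed (simp add: add_on_0)

lemma add_on_subspace_vimage:
  assumes H: "Z.subspace H"
  shows "Z.subspace {x \<in> S. g x \<in> H}"
  by (rule Z.subspaceI)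
    (auto simp: add_on_0 add_on_add add_on_zmul Z.subspace_0 Z.subspace_add Z.subspace_scale S H)

end

lemma add_on_mono: "add_on S g \<Longrightarrow> H \<subseteq> S \<Longrightarrow> add_on H g"
  unfolding add_on_def by blast

lemma fin_modI_reps:
  assumes "Z.subspace K" "finite D" "\<And>x. x \<in> X \<Longrightarrow> \<exists>d\<in>D. x - d \<in> K"
  shows "fin_mod X K"
proof -
  obtain f where f: "\<And>x. x \<in> X \<Longrightarrow> f x \<in> D \<and> x - f x \<in> K"
    using assms(3) by metis
  show ?thesis
  proof (rule fin_manyI[of f])
    show "finite (f ` X)" by (rule finite_subset[OF _ assms(2)]) (use f in auto)
  next
    fix x y assume "x \<in> X" "y \<in> X" "f x = f y"
    then have "(x - f x) - (y - f x) \<in> K" using f assms(1) Z.subspace_diff by metis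
    then show "x - y \<in> K" by simp
  qed
qed

lemma fin_mod_trans:
  assumes "fin_mod X K" "fin_mod K L" "Z.subspace K" "Z.subspace L"
  shows "fin_mod X L"
proof -
  obtain D where D: "finite D" "\<And>x. x \<in> X \<Longrightarrow> \<exists>d\<in>D. d - x \<in> K"
    using assms(1) by (rule fin_many_reps) blast
  obtain E where E: "finite E" "\<And>x. x \<in> K \<Longrightarrow> \<exists>e\<in>E. e - x \<in> L"
    using assms(2) by (rule fin_many_reps) blast
  show ?thesis
  proof (rule fin_modI_reps[OF assms(4)])
    show "finite ((\<lambda>(d, e). d + e) ` (D \<times> E))" using D(1) E(1) by simp
  next
    fix x assume "x \<in> X"
    then obtain d where d: "d \<in> D" "x - d \<in> K" using D(2) Z.subspace_neg[OF assms(3)] by fastforce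
    then obtain e where e: "e \<in> E" "(x - d) - e \<in> L" using E(2) Z.subspace_neg[OF assms(4)] by fastforce
    then show "\<exists>z \<in> (\<lambda>(d, e). d + e) ` (D \<times> E). x - z \<in> L"
      using d by (intro bexI[of _ "d + e"]) (auto simp: algebra_simps)
  qed
qed

text \<open>The additive order of \<open>x\<close> is \<open>n\<close>, where \<open>n = 0\<close> stands for infinite order.\<close>

definition has_order :: "int \<Rightarrow> 'u::ab_group_add \<Rightarrow> bool" where
  "has_order n x \<longleftrightarrow> (\<forall>a. a *\<^sub>Z x = 0 \<longleftrightarrow> n dvd a)"

lemma gcd_zmul_mem:
  assumes "Z.subspace K" "m *\<^sub>Z x \<in> K" "n *\<^sub>Z x \<in> K"
  shows "gcd m n *\<^sub>Z x \<in> K"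
proof -
  obtain u v where "u * m + v * n = gcd m n" using bezout_int by blast
  then have "gcd m n *\<^sub>Z x = u *\<^sub>Z m *\<^sub>Z x + v *\<^sub>Z n *\<^sub>Z x"
    by (metis Z.scale_left_distrib Z.scale_scale)
  then show ?thesis using assms by (metis Z.subspace_add Z.subspace_scale)
qed

lemma coprime_zmul_mem:
  assumes "Z.subspace K" "m *\<^sub>Z x \<in> K" "n *\<^sub>Z x \<in> K" "coprime m n"
  shows "x \<in> K"
  using gcd_zmul_mem[OF assms(1-3)] assms(4) by simp

lemma prime_power_coprime: "prime (p::int) \<Longrightarrow> \<not> p dvd a \<Longrightarrow> coprime a (p ^ n)"
  using prime_imp_coprime[of p a] by (simp add: coprime_commute)

lemma zmul_dvd_mem:
  assumes "Z.subspace K" "m *\<^sub>Z x \<in> K" "m dvd n"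
  shows "n *\<^sub>Z x \<in> K"
proof -
  obtain c where "n = c * m" using assms(3) by (metis dvd_def mult.commute)
  then show ?thesis using assms by (metis Z.scale_scale Z.subspace_scale)
qed

lemma power_zmul_mem_le:
  assumes "Z.subspace K" "p ^ m *\<^sub>Z x \<in> K" "m \<le> n"
  shows "p ^ n *\<^sub>Z x \<in> K"
  using zmul_dvd_mem[OF assms(1,2)] assms(3) by (simp add: le_imp_power_dvd)

lemma power_zmul_eq_0_le: "p ^ m *\<^sub>Z x = 0 \<Longrightarrow> m \<le> n \<Longrightarrow> p ^ n *\<^sub>Z x = 0"
  using power_zmul_mem_le[of "{0}" p m x n] by simp

lemma order_mod:
  assumes "prime (p::int)" "Z.subspace K" "p ^ k *\<^sub>Z x \<in> K"
  obtains n where "n \<le> k" "\<And>a. a *\<^sub>Z x \<in> K \<longleftrightarrow> p ^ n dvd a"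
proof -
  define n where "n = (LEAST n. p ^ n *\<^sub>Z x \<in> K)"
  have n: "p ^ n *\<^sub>Z x \<in> K" unfolding n_def using assms(3) by (rule LeastI)
  have "n \<le> k" unfolding n_def using assms(3) by (rule Least_le)
  moreover have "a *\<^sub>Z x \<in> K \<longleftrightarrow> p ^ n dvd a" for a
  proof
    assume "a *\<^sub>Z x \<in> K"
    then have g: "gcd a (p ^ n) *\<^sub>Z x \<in> K" using gcd_zmul_mem[OF assms(2)] n by blast
    obtain j where j: "j \<le> n" "gcd a (p ^ n) = p ^ j"
      using divides_primepow[OF assms(1), of "gcd a (p ^ n)" n] prime_ge_0_int[OF assms(1)] by auto
    have "n \<le> j" unfolding n_def using g j(2) by (intro Least_le) simp
    with j show "p ^ n dvd a" by (metis gcd_dvd1 le_antisym)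
  next
    assume "p ^ n dvd a"
    then show "a *\<^sub>Z x \<in> K" using zmul_dvd_mem[OF assms(2) n] by blast
  qed
  ultimately show ?thesis by (rule that)
qed

lemma has_order_exists:
  assumes "prime (p::int)" "p ^ k *\<^sub>Z x = 0"
  obtains n where "n \<le> k" "has_order (p ^ n) x"
  using order_mod[OF assms(1), of "{0}" k x] assms(2) that unfolding has_order_def
  by (metis Z.subspace_single_0 singleton_iff)

lemma finite_span1:
  assumes "n *\<^sub>Z x = 0" "n \<noteq> 0"
  shows "finite (Z.span {x})"
proof -
  have "Z.span {x} \<subseteq> (\<lambda>k. k *\<^sub>Z x) ` {0..<\<bar>n\<bar>}"
  proof
    fix y assume "y \<in> Z.span {x}"
    then obtain k where k: "y = k *\<^sub>Z x" by (auto simp: in_span1)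
    have "k mod \<bar>n\<bar> = k - (k div \<bar>n\<bar>) * \<bar>n\<bar>" by (simp add: minus_div_mult_eq_mod)
    moreover have "\<bar>n\<bar> *\<^sub>Z x = 0" using assms by (cases "n \<ge> 0") auto
    ultimately have "y = (k mod \<bar>n\<bar>) *\<^sub>Z x" using k
      by (simp add: Z.scale_left_diff_distrib flip: Z.scale_scale)
    then show "y \<in> (\<lambda>k. k *\<^sub>Z x) ` {0..<\<bar>n\<bar>}" using assms(2) by auto
  qed
  then show ?thesis by (rule finite_subset) auto
qed

lemma finite_span_Un:
  assumes "finite (Z.span A)" "finite (Z.span B)"
  shows "finite (Z.span (A \<union> B))"
proof -
  have "Z.span (A \<union> B) = (\<lambda>(x, y). x + y) ` (Z.span A \<times> Z.span B)"
    by (auto simp: Z.span_Un)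
  then show ?thesis using assms by simp
qed

lemma finite_span_finite:
  assumes "finite X" "\<And>x. x \<in> X \<Longrightarrow> \<exists>n. n \<noteq> 0 \<and> n *\<^sub>Z x = 0"
  shows "finite (Z.span X)"
  using assms
proof (induction X rule: finite_induct)
  case (insert x X)
  then have "finite (Z.span {x})" using finite_span1 by blast
  then have "finite (Z.span ({x} \<union> X))" using insert by (intro finite_span_Un) auto
  then show ?case by simp
qed simp

section \<open>Inertial and power automorphisms\<close>

text \<open>The restriction of \<open>g\<close> to the subgroup \<open>S\<close> is an automorphism of \<open>S\<close>.\<close>

definition aut_on :: "'u::ab_group_add set \<Rightarrow> ('u \<Rightarrow> 'u) \<Rightarrow> bool" where
  "aut_on S g \<longleftrightarrow> Z.subspace S \<and> add_on S g \<and> bij_betw g S S"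

text \<open>
  The restriction of \<open>g\<close> to \<open>S\<close> is an inertial automorphism. As \<open>(H + g H)/H\<close> is the image of \<open>g H\<close>
  modulo \<open>H\<close>, its finiteness is expressed without forming the sum.
\<close>

definition inert :: "'u::ab_group_add set \<Rightarrow> ('u \<Rightarrow> 'u) \<Rightarrow> bool" where
  "inert S g \<longleftrightarrow> aut_on S g \<and> (\<forall>H. Z.subspace H \<longrightarrow> H \<subseteq> S \<longrightarrow> fin_mod (g ` H) H)"

text \<open>
  The map \<open>g\<close> sends every element of \<open>C\<close> to a multiple of itself; the multiplier may vary with the
  element.
\<close>

definition power_on :: "'u::ab_group_add set \<Rightarrow> ('u \<Rightarrow> 'u) \<Rightarrow> bool" where
  "power_on C g \<longleftrightarrow> (\<forall>c\<in>C. g c \<in> Z.span {c})"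

lemma aut_onD:
  assumes "aut_on S g"
  shows "Z.subspace S" "add_on S g" "g ` S = S" "inj_on g S"
  using assms unfolding aut_on_def bij_betw_def by auto

lemma inertD: "inert S g \<Longrightarrow> aut_on S g"
  "inert S g \<Longrightarrow> Z.subspace H \<Longrightarrow> H \<subseteq> S \<Longrightarrow> fin_mod (g ` H) H"
  unfolding inert_def by auto

lemma aut_on_sub:
  assumes "aut_on S g" "Z.subspace P" "P \<subseteq> S" "g ` P = P"
  shows "aut_on P g"
  using assms unfolding aut_on_def bij_betw_def by (auto intro: add_on_mono inj_on_subset)

lemma inert_sub:
  assumes "inert S g" "Z.subspace P" "P \<subseteq> S" "g ` P = P"
  shows "inert P g"
  using assms aut_on_sub[of S g P] unfolding inert_def by blast

lemma power_on_subspace: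
  assumes "power_on C g" "Z.subspace H" "H \<subseteq> C"
  shows "g ` H \<subseteq> H"
proof
  fix y assume "y \<in> g ` H"
  then obtain x where "x \<in> H" "y = g x" by blast
  then show "y \<in> H" using assms unfolding power_on_def
    by (metis Z.subspace_scale in_mono in_span1)
qed

lemma inj_on_finite_eq:
  assumes "inj_on g F" "finite F" "g ` F \<subseteq> F"
  shows "g ` F = F"
  using assms by (simp add: endo_inj_surj)

text \<open>
  If no such \<open>F\<close> existed, then starting from \<open>F\<^sub>0 = 0\<close> one could repeatedly choose \<open>x\<^sub>n\<close> such that
  \<open>\<langle>x\<^sub>n, g x\<^sub>n\<rangle>\<close> is independent of the finite subgroup \<open>F\<^sub>n\<close> generated by all earlier \<open>x\<^sub>i\<close> and \<open>g x\<^sub>i\<close>, and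
  \<open>g x\<^sub>n \<notin> \<langle>x\<^sub>n\<rangle>\<close>. The subgroup generated by all \<open>x\<^sub>n\<close> would then contradict inertness.
\<close>

lemma inert_torsion_escape:
  assumes g: "inert S g" and tors: "\<And>x. x \<in> S \<Longrightarrow> \<exists>n. n \<noteq> 0 \<and> n *\<^sub>Z x = 0"
  obtains F where "finite F" "Z.subspace F" "F \<subseteq> S"
    "\<And>x. x \<in> S \<Longrightarrow> Z.span {x, g x} \<inter> F \<subseteq> {0} \<Longrightarrow> g x \<in> Z.span {x}"
proof (rule ccontr)
  assume "\<not> thesis"
  with that have ex: "\<exists>x. x \<in> S \<and> Z.span {x, g x} \<inter> F \<subseteq> {0} \<and> g x \<notin> Z.span {x}"
    if "finite F" "Z.subspace F" "F \<subseteq> S" for F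
    using that by blast
  have S: "Z.subspace S" and gS: "g ` S = S" using aut_onD[OF inertD(1)[OF g]] by auto
  define nxt where "nxt F = (SOME x. x \<in> S \<and> Z.span {x, g x} \<inter> F \<subseteq> {0} \<and> g x \<notin> Z.span {x})" for F
  define Fs where "Fs = rec_nat {0} (\<lambda>_ F. Z.span (F \<union> {nxt F, g (nxt F)}))"
  define x where "x n = nxt (Fs n)" for n
  have Fs_0: "Fs 0 = {0}" and Fs_Suc: "Fs (Suc n) = Z.span (Fs n \<union> {x n, g (x n)})" for n
    by (simp_all add: Fs_def x_def)
  have nxt: "nxt F \<in> S \<and> Z.span {nxt F, g (nxt F)} \<inter> F \<subseteq> {0} \<and> g (nxt F) \<notin> Z.span {nxt F}"
    if "finite F" "Z.subspace F" "F \<subseteq> S" for F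
    unfolding nxt_def using someI_ex[OF ex[OF that]] .
  have Fs: "finite (Fs n) \<and> Z.subspace (Fs n) \<and> Fs n \<subseteq> S" for n
  proof (induction n)
    case 0
    show ?case using Z.subspace_0[OF S] by (simp add: Fs_0)
  next
    case (Suc n)
    then have xn: "x n \<in> S" "g (x n) \<in> S" using nxt[of "Fs n"] gS by (auto simp: x_def)
    then have sub: "Fs n \<union> {x n, g (x n)} \<subseteq> S" using Suc by blast
    have "finite (Fs (Suc n))" unfolding Fs_Suc
      by (rule finite_span_finite) (use Suc sub tors in \<open>blast+\<close>)
    with Z.span_minimal[OF sub S] show ?case by (simp add: Fs_Suc)
  qed
  have x: "x n \<in> S" "Z.span {x n, g (x n)} \<inter> Fs n \<subseteq> {0}" "g (x n) \<notin> Z.span {x n}" for n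
    using nxt[of "Fs n"] Fs[of n] by (auto simp: x_def)
  have xF: "x n \<in> Fs (Suc n)" "g (x n) \<in> Fs (Suc n)" "Fs n \<subseteq> Fs (Suc n)" for n
    unfolding Fs_Suc by (auto intro: Z.span_base)
  have mono: "Fs m \<subseteq> Fs n" if "m \<le> n" for m n
    using lift_Suc_mono_le[of Fs, OF xF(3) that] .
  define H where "H n = Z.span (x ` {..<n})" for n
  have HF: "H n \<subseteq> Fs n" for n unfolding H_def
  proof (rule Z.span_minimal)
    show "x ` {..<n} \<subseteq> Fs n"
    proof (rule image_subsetI)
      fix m assume "m \<in> {..<n}"
      then show "x m \<in> Fs n" using xF(1)[of m] mono[of "Suc m" n] by auto
    qed
  qed (use Fs in auto)
  have H_Suc: "\<exists>k. y - k *\<^sub>Z x n \<in> H n" if "y \<in> H (Suc n)" for y n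
    using that Z.span_breakdown_eq[of y "x n" "x ` {..<n}"] by (simp add: H_def lessThan_Suc)
  have Hmono: "H m \<subseteq> H n" if "m \<le> n" for m n
    unfolding H_def by (rule Z.span_mono) (use that in auto)
  define Hall where "Hall = Z.span (range x)"
  have Hall: "\<exists>n. y \<in> H n" if "y \<in> Hall" for y
    using that unfolding Hall_def
  proof (induction rule: Z.span_induct_alt)
    case base
    show ?case by (auto simp: H_def Z.span_zero)
  next
    case (step c u y)
    then obtain n m where n: "y \<in> H n" and m: "u = x m" by auto
    have "u \<in> H (Suc (max n m))" unfolding H_def m by (rule Z.span_base) auto
    moreover have "y \<in> H (Suc (max n m))" using n Hmono[of n "Suc (max n m)"] by (simp add: subset_iff)
    ultimately show ?case unfolding H_def using Z.span_add Z.span_scale by blast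
  qed
  have "fin_mod (g ` Hall) Hall"
    by (rule inertD(2)[OF g]) (use Z.span_minimal[OF _ S, of "range x"] x(1) in \<open>auto simp: Hall_def\<close>)
  moreover have "g (x i) \<in> g ` Hall" for i
    unfolding Hall_def by (intro imageI Z.span_base) simp
  ultimately obtain i j where ij: "i < j" "g (x j) - g (x i) \<in> Hall"
    by (rule fin_many_pigeonhole[where s = "\<lambda>i. g (x i)"]) blast
  \<comment> \<open>\<open>y\<close> lies in \<open>F\<^sub>j\<^sub>+\<^sub>1\<close>, so its expression by the \<open>x\<^sub>n\<close> involves none beyond \<open>x\<^sub>j\<close>\<close>
  define y where "y = g (x j) - g (x i)"
  have gi: "g (x i) \<in> Fs j" using xF(2)[of i] mono[of "Suc i" j] ij(1) by auto
  have yF: "y \<in> Fs (Suc j)" unfolding y_def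
    using Z.subspace_diff[of "Fs (Suc j)"] Fs[of "Suc j"] xF(2,3)[of j] gi by blast
  obtain n where "y \<in> H n" using Hall ij(2) y_def by blast
  then have "y \<in> H (Suc j)"
  proof (induction n)
    case (Suc n)
    show ?case
    proof (cases "n \<le> j")
      case True
      then show ?thesis using Suc.prems Hmono[of "Suc n" "Suc j"] by auto
    next
      case False
      obtain k where k: "y - k *\<^sub>Z x n \<in> H n" using H_Suc[OF Suc.prems] by blast
      have "y \<in> Fs n" using yF mono[of "Suc j" n] False by auto
      then have "y - (y - k *\<^sub>Z x n) \<in> Fs n" using k HF[of n] Fs[of n] Z.subspace_diff by blast
      moreover have "k *\<^sub>Z x n \<in> Z.span {x n, g (x n)}"
        by (intro Z.span_scale Z.span_base) simp
      ultimately have "k *\<^sub>Z x n = 0" using x(2)[of n] by auto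
      then show ?thesis using k Suc.IH by simp
    qed
  qed (auto simp: H_def Z.span_zero)
  then obtain k where "y - k *\<^sub>Z x j \<in> H j" using H_Suc by blast
  then have "(y - k *\<^sub>Z x j) + g (x i) \<in> Fs j" using HF Fs gi Z.subspace_add by blast
  moreover have "(y - k *\<^sub>Z x j) + g (x i) = g (x j) - k *\<^sub>Z x j" by (simp add: y_def)
  moreover have "g (x j) - k *\<^sub>Z x j \<in> Z.span {x j, g (x j)}"
    by (intro Z.span_diff Z.span_scale Z.span_base) auto
  ultimately have "g (x j) - k *\<^sub>Z x j = 0" using x(2)[of j] by auto
  then show False using x(3)[of j] by (auto simp: in_span1)
qed

section \<open>Primary groups\<close>

text \<open>
  Zorn's lemma gives a subgroup maximal among those that meet \<open>F\<close> at most in \<open>0\<close>. The last claim is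
  its maximality, stated for the subgroups generated by \<open>C\<close> and one further element.
\<close>

lemma maximal_avoiding:
  assumes P: "Z.subspace P"
  obtains C where "Z.subspace C" "C \<subseteq> P" "C \<inter> F \<subseteq> {0}"
    "\<And>x. x \<in> P \<Longrightarrow> x \<notin> C \<Longrightarrow> \<exists>f k. f \<in> F \<and> f \<noteq> 0 \<and> f - k *\<^sub>Z x \<in> C"
proof -
  define A where "A = {C. Z.subspace C \<and> C \<subseteq> P \<and> C \<inter> F \<subseteq> {0}}"
  have "{0} \<in> A" using Z.subspace_0[OF P] by (auto simp: A_def)
  then have ne: "A \<noteq> {}" by blast
  have ch: "\<Union>\<C> \<in> A" if \<C>: "\<C> \<noteq> {}" "subset.chain A \<C>" for \<C>
  proof -
    have sub: "Z.subspace C" if "C \<in> \<C>" for C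
      using \<C>(2) that by (auto simp: subset.chain_def A_def)
    have "Z.subspace (\<Union>\<C>)"
    proof (rule Z.subspaceI)
      show "0 \<in> \<Union>\<C>" using \<C>(1) sub Z.subspace_0 by blast
    next
      fix x y assume "x \<in> \<Union>\<C>" "y \<in> \<Union>\<C>"
      then obtain X Y where "X \<in> \<C>" "x \<in> X" "Y \<in> \<C>" "y \<in> Y" by blast
      moreover have "X \<subseteq> Y \<or> Y \<subseteq> X" using \<C>(2) calculation by (auto simp: subset.chain_def)
      ultimately show "x + y \<in> \<Union>\<C>" using Z.subspace_add[OF sub] by blast
    next
      fix k x assume "x \<in> \<Union>\<C>"
      then show "k *\<^sub>Z x \<in> \<Union>\<C>" using Z.subspace_scale[OF sub] by blast
    qed
    then show ?thesis using \<C>(2) by (auto simp: A_def subset.chain_def)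
  qed
  obtain C where C: "C \<in> A" "\<And>X. X \<in> A \<Longrightarrow> C \<subseteq> X \<Longrightarrow> X = C"
    using subset_Zorn_nonempty[OF ne ch] by blast
  have *: "\<exists>f k. f \<in> F \<and> f \<noteq> 0 \<and> f - k *\<^sub>Z x \<in> C" if x: "x \<in> P" "x \<notin> C" for x
  proof -
    let ?X = "Z.span (insert x C)"
    have "C \<subseteq> ?X" "x \<in> ?X" by (auto intro: Z.span_base)
    then have "?X \<notin> A" using C(2) x(2) by blast
    moreover have "?X \<subseteq> P" by (rule Z.span_minimal) (use C(1) x(1) P in \<open>auto simp: A_def\<close>)
    ultimately obtain f where f: "f \<in> ?X" "f \<in> F" "f \<noteq> 0" by (auto simp: A_def)
    have "Z.span C = C" using C(1) by (simp add: A_def)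
    then obtain k where "f - k *\<^sub>Z x \<in> C" using f(1) Z.span_breakdown_eq[of f x C] by metis
    then show ?thesis using f by blast
  qed
  show ?thesis by (rule that[OF _ _ _ *]) (use C(1) in \<open>auto simp: A_def\<close>)
qed

text \<open>A \<open>p\<close>-subgroup \<open>P\<close> of the ambient group. The prime is an integer, because the scalars are.\<close>

locale p_primary =
  fixes p :: int and P :: "'u::ab_group_add set"
  assumes p: "prime p" and subP: "Z.subspace P"
    and tors: "x \<in> P \<Longrightarrow> \<exists>n. p ^ n *\<^sub>Z x = 0"
begin

lemma p_pos: "p > 0" using prime_gt_0_int[OF p] .

lemma tors_nonzero: "x \<in> P \<Longrightarrow> \<exists>n. n \<noteq> 0 \<and> n *\<^sub>Z x = 0"
  using tors[of x] p_pos by (metis less_irrefl power_not_zero)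

text \<open>
  A divisible \<open>p\<close>-group has no nontrivial finite quotient. The set \<open>L\<close> need not be a subgroup: along a
  sequence of \<open>p\<close>-th parts two members \<open>s\<^sub>i = p\<^sup>d s\<^sub>j\<close> and \<open>s\<^sub>j\<close> agree modulo \<open>K\<close>, and \<open>p\<^sup>d - 1\<close> is prime to \<open>p\<close>.
\<close>

lemma divisible_fin_mod:
  assumes K: "Z.subspace K" and L: "L \<subseteq> P" "\<And>y. y \<in> L \<Longrightarrow> \<exists>z\<in>L. y = p *\<^sub>Z z" and fin: "fin_mod L K"
  shows "L \<subseteq> K"
proof
  fix y assume y: "y \<in> L"
  obtain h where h: "\<And>y. y \<in> L \<Longrightarrow> h y \<in> L \<and> y = p *\<^sub>Z h y" using L(2) by metis
  define s where "s n = (h ^^ n) y" for n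
  have s: "s n \<in> L" "s n = p *\<^sub>Z s (Suc n)" for n
  proof -
    show "s n \<in> L" by (induction n) (use y h in \<open>auto simp: s_def\<close>)
    then show "s n = p *\<^sub>Z s (Suc n)" using h by (simp add: s_def)
  qed
  have sp: "s i = p ^ d *\<^sub>Z s (i + d)" for i d
  proof (induction d)
    case (Suc d)
    then show ?case using s(2)[of "i + d"] by (simp add: mult.commute)
  qed simp
  obtain i j where ij: "i < j" "s i - s j \<in> K"
    using fin_many_pigeonhole[OF fin, of s] s(1) by blast
  have "s i - s j = (p ^ (j - i) - 1) *\<^sub>Z s j"
    using sp[of i "j - i"] ij(1) by (simp add: Z.scale_left_diff_distrib)
  then have 1: "(p ^ (j - i) - 1) *\<^sub>Z s j \<in> K" using ij(2) by simp
  obtain n where "p ^ n *\<^sub>Z s j = 0" using tors s(1) L(1) by blast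
  then have 2: "p ^ n *\<^sub>Z s j \<in> K" using Z.subspace_0[OF K] by simp
  have "\<not> p dvd (p ^ (j - i) - 1)"
  proof
    assume "p dvd p ^ (j - i) - 1"
    moreover have "p dvd p ^ (j - i)" using ij(1) by simp
    ultimately have "p dvd 1" by (simp add: dvd_diff_right_iff)
    then show False using p by (simp add: prime_int_iff)
  qed
  then have "s j \<in> K" using coprime_zmul_mem[OF K 1 2] prime_power_coprime[OF p] by blast
  then have "p ^ j *\<^sub>Z s j \<in> K" using Z.subspace_scale[OF K] by blast
  then show "y \<in> K" using sp[of 0 j] by (simp add: s_def)
qed

text \<open>
  Choose \<open>C\<^sub>0\<close> maximal with \<open>C\<^sub>0 \<inter> F = 0\<close> for the finite subgroup \<open>F\<close> of \<open>inert_torsion_escape\<close>. By maximality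
  the socle of \<open>P/C\<^sub>0\<close> lies in the image of \<open>F\<close>. The subgroup \<open>C = C\<^sub>0 \<inter> g\<^sup>-\<^sup>1 C\<^sub>0\<close> has the required properties.
\<close>

lemma inert_power_socle:
  assumes g: "inert P g"
  obtains C where "Z.subspace C" "C \<subseteq> P" "power_on C g" "fin_mod {x \<in> P. p *\<^sub>Z x \<in> C} C"
proof -
  have add: "add_on P g" and gP: "g ` P = P" using aut_onD[OF inertD(1)[OF g]] by auto
  obtain F where F: "finite F" "Z.subspace F" "F \<subseteq> P"
    "\<And>x. x \<in> P \<Longrightarrow> Z.span {x, g x} \<inter> F \<subseteq> {0} \<Longrightarrow> g x \<in> Z.span {x}"
    using inert_torsion_escape[OF g tors_nonzero] by blast
  obtain C0 where C0: "Z.subspace C0" "C0 \<subseteq> P" "C0 \<inter> F \<subseteq> {0}"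
    "\<And>x. x \<in> P \<Longrightarrow> x \<notin> C0 \<Longrightarrow> \<exists>f k. f \<in> F \<and> f \<noteq> 0 \<and> f - k *\<^sub>Z x \<in> C0"
    using maximal_avoiding[OF subP, of F] by blast
  define C where "C = C0 \<inter> {x \<in> P. g x \<in> C0}"
  have C: "Z.subspace C" unfolding C_def
    by (intro Z.subspace_inter add_on_subspace_vimage subP add C0(1))
  have pow: "power_on C g" unfolding power_on_def
  proof
    fix x assume "x \<in> C"
    then have x: "x \<in> P" "x \<in> C0" "g x \<in> C0" by (auto simp: C_def)
    have "Z.span {x, g x} \<subseteq> C0" by (rule Z.span_minimal) (use x C0 in auto)
    then show "g x \<in> Z.span {x}" using F(4)[OF x(1)] C0(3) by blast
  qed
  have soc: "\<exists>f\<in>F. x - f \<in> C0" if x: "x \<in> P" "p *\<^sub>Z x \<in> C0" for x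
  proof (cases "x \<in> C0")
    case True
    then show ?thesis using Z.subspace_0[OF F(2)] by (intro bexI[of _ 0]) auto
  next
    case False
    then obtain f k where f: "f \<in> F" "f \<noteq> 0" "f - k *\<^sub>Z x \<in> C0" using C0(4) x by blast
    have "\<not> p dvd k"
    proof
      assume "p dvd k"
      then have "k *\<^sub>Z x \<in> C0" using zmul_dvd_mem[OF C0(1) x(2)] by blast
      then have "(f - k *\<^sub>Z x) + k *\<^sub>Z x \<in> C0" using f(3) Z.subspace_add[OF C0(1)] by blast
      then have "f \<in> C0" by simp
      then show False using f C0(3) by blast
    qed
    then have "coprime k p" using prime_power_coprime[OF p, of k 1] by simp
    then obtain u v where uv: "u * k + v * p = 1" using bezout_int[of k p] by auto
    have "x = (u * k + v * p) *\<^sub>Z x" by (simp add: uv)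
    then have "x - u *\<^sub>Z f = v *\<^sub>Z p *\<^sub>Z x - u *\<^sub>Z (f - k *\<^sub>Z x)"
      by (simp add: Z.scale_left_distrib Z.scale_right_diff_distrib add.commute)
    then have "x - u *\<^sub>Z f \<in> C0"
      using x(2) f(3) C0(1) Z.subspace_scale Z.subspace_diff by metis
    then show ?thesis using f(1) Z.subspace_scale[OF F(2)] by blast
  qed
  obtain \<phi> where \<phi>: "\<And>x. x \<in> P \<Longrightarrow> p *\<^sub>Z x \<in> C0 \<Longrightarrow> \<phi> x \<in> F \<and> x - \<phi> x \<in> C0"
    using soc by metis
  have "fin_mod {x \<in> P. p *\<^sub>Z x \<in> C} C"
  proof (rule fin_manyI[of "\<lambda>x. (\<phi> x, \<phi> (g x))"])
    have gx: "p *\<^sub>Z g x \<in> C0" "g x \<in> P" if "x \<in> P" "p *\<^sub>Z x \<in> C" for x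
      using that add_on_zmul[OF subP add] gP by (auto simp: C_def)
    show "finite ((\<lambda>x. (\<phi> x, \<phi> (g x))) ` {x \<in> P. p *\<^sub>Z x \<in> C})"
      by (rule finite_subset[of _ "F \<times> F"]) (use F \<phi> gx in \<open>auto simp: C_def\<close>)
    fix x y assume x: "x \<in> {x \<in> P. p *\<^sub>Z x \<in> C}" and y: "y \<in> {x \<in> P. p *\<^sub>Z x \<in> C}"
      and eq: "(\<phi> x, \<phi> (g x)) = (\<phi> y, \<phi> (g y))"
    have "x - \<phi> x \<in> C0" "y - \<phi> y \<in> C0" using \<phi> x y by (auto simp: C_def)
    from Z.subspace_diff[OF C0(1) this] have 1: "x - y \<in> C0" using eq by simp
    have "g x - \<phi> (g x) \<in> C0" "g y - \<phi> (g y) \<in> C0" using \<phi> gx x y by blast+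
    from Z.subspace_diff[OF C0(1) this] have "g (x - y) \<in> C0"
      using eq x y add_on_diff[OF subP add] by simp
    with 1 show "x - y \<in> C" using C0(2) by (auto simp: C_def)
  qed
  moreover have "C \<subseteq> P" by (auto simp: C_def)
  ultimately show ?thesis using that C pow by blast
qed

text \<open>If the socle of \<open>P/C\<close> is finite then so is each \<open>(P/C)[p\<^sup>n]\<close>.\<close>

lemma fin_mod_socle_power:
  assumes C: "Z.subspace C" and soc: "fin_mod {x \<in> P. p *\<^sub>Z x \<in> C} C"
  shows "fin_mod {x \<in> P. p ^ n *\<^sub>Z x \<in> C} C"
proof (induction n)
  case 0
  show ?case by (rule fin_manyI[of "\<lambda>_. ()"]) (use C Z.subspace_diff in auto)
next
  case (Suc n)
  let ?S = "\<lambda>n. {x \<in> P. p ^ n *\<^sub>Z x \<in> C}"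
  have "add_on P (\<lambda>x. p ^ n *\<^sub>Z x)" by (simp add: add_on_def Z.scale_right_distrib)
  then have sub: "Z.subspace (?S n)"
    using add_on_subspace_vimage[OF subP _ C] by simp
  have "fin_many (?S (Suc n)) (\<lambda>x y. p ^ n *\<^sub>Z x - p ^ n *\<^sub>Z y \<in> C)"
    by (rule fin_many_comp[OF soc]) (use Z.subspace_scale[OF subP] in auto)
  then have "fin_mod (?S (Suc n)) (?S n)"
    by (rule fin_many_mono) (use Z.subspace_diff[OF subP] in \<open>auto simp: Z.scale_right_diff_distrib\<close>)
  then show ?case by (rule fin_mod_trans[OF _ Suc sub C])
qed

text \<open>
  A \<open>p\<close>-group \<open>Q\<close> with finite socle is an extension of a divisible group by a finite one. Applied to
  \<open>Q = P/C\<close>, this gives \<open>C\<^sub>1 = p\<^sup>m P + C\<close> of finite index in \<open>P\<close> with \<open>C\<^sub>1/C\<close> divisible.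
\<close>

lemma stable_image:
  assumes C: "Z.subspace C" "C \<subseteq> P" and soc: "fin_mod {x \<in> P. p *\<^sub>Z x \<in> C} C"
  obtains C1 m where "Z.subspace C1" "C \<subseteq> C1" "C1 \<subseteq> P"
    "\<And>x. x \<in> P \<Longrightarrow> p ^ m *\<^sub>Z x \<in> C1" "\<And>x. x \<in> C1 \<Longrightarrow> \<exists>y\<in>C1. x - p *\<^sub>Z y \<in> C" "fin_mod P C1"
proof -
  \<comment> \<open>\<open>W n = p\<^sup>n P + C\<close>\<close>
  define W where "W n = {x \<in> P. \<exists>y\<in>P. x - p ^ n *\<^sub>Z y \<in> C}" for n
  have W: "Z.subspace (W n)" "C \<subseteq> W n" "W n \<subseteq> P" "\<And>x. x \<in> P \<Longrightarrow> p ^ n *\<^sub>Z x \<in> W n" for n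
  proof -
    show "Z.subspace (W n)"
    proof (rule Z.subspaceI)
      show "0 \<in> W n" using Z.subspace_0[OF subP] Z.subspace_0[OF C(1)]
        unfolding W_def by (auto intro!: bexI[of _ 0])
    next
      fix x x' assume "x \<in> W n" "x' \<in> W n"
      then obtain y y' where y: "x \<in> P" "x' \<in> P" "y \<in> P" "y' \<in> P"
        "x - p ^ n *\<^sub>Z y \<in> C" "x' - p ^ n *\<^sub>Z y' \<in> C" by (auto simp: W_def)
      have "(x + x') - p ^ n *\<^sub>Z (y + y') = (x - p ^ n *\<^sub>Z y) + (x' - p ^ n *\<^sub>Z y')"
        by (simp add: Z.scale_right_distrib)
      then have "(x + x') - p ^ n *\<^sub>Z (y + y') \<in> C" using y Z.subspace_add[OF C(1)] by metis
      then show "x + x' \<in> W n" using y Z.subspace_add[OF subP] by (auto simp: W_def)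
    next
      fix k x assume "x \<in> W n"
      then obtain y where y: "x \<in> P" "y \<in> P" "x - p ^ n *\<^sub>Z y \<in> C" by (auto simp: W_def)
      have "k *\<^sub>Z x - p ^ n *\<^sub>Z k *\<^sub>Z y = k *\<^sub>Z (x - p ^ n *\<^sub>Z y)"
        by (simp add: Z.scale_right_diff_distrib mult.commute)
      then have "k *\<^sub>Z x - p ^ n *\<^sub>Z k *\<^sub>Z y \<in> C" using y Z.subspace_scale[OF C(1)] by metis
      then show "k *\<^sub>Z x \<in> W n" using y Z.subspace_scale[OF subP] unfolding W_def by blast
    qed
    show "C \<subseteq> W n" "W n \<subseteq> P"
      using C(2) Z.subspace_0[OF subP] unfolding W_def by (auto intro!: bexI[of _ 0])
    show "p ^ n *\<^sub>Z x \<in> W n" if "x \<in> P" for x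
      using that Z.subspace_0[OF C(1)] Z.subspace_scale[OF subP] by (auto simp: W_def intro!: bexI[of _ x])
  qed
  have W_Suc: "W (n + d) \<subseteq> W n" for n d
  proof
    fix x assume "x \<in> W (n + d)"
    then obtain y where y: "x \<in> P" "y \<in> P" "x - p ^ n *\<^sub>Z p ^ d *\<^sub>Z y \<in> C"
      unfolding W_def by (auto simp: power_add)
    then show "x \<in> W n" using Z.subspace_scale[OF subP] unfolding W_def by blast
  qed
  obtain D where D: "finite D" "\<And>x. x \<in> P \<Longrightarrow> p *\<^sub>Z x \<in> C \<Longrightarrow> \<exists>d\<in>D. d - x \<in> C"
    using soc by (rule fin_many_reps) blast
  \<comment> \<open>the traces of the decreasing subgroups \<open>W n\<close> on the finite socle of \<open>P/C\<close> become constant at \<open>m\<close>\<close>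
  obtain m where m: "\<And>n. card (D \<inter> W m) \<le> card (D \<inter> W n)"
    using ex_has_least_nat[of "\<lambda>_. True" 0 "\<lambda>n. card (D \<inter> W n)"] by auto
  have stab: "x \<in> W (m + n)" if x: "x \<in> W m" "p *\<^sub>Z x \<in> C" for x n
  proof -
    have "D \<inter> W (m + n) = D \<inter> W m"
      by (rule card_subset_eq) (use D(1) W_Suc[of m n] m[of "m + n"] card_mono[of "D \<inter> W m" "D \<inter> W (m + n)"] in \<open>auto intro: antisym\<close>)
    moreover obtain d where d: "d \<in> D" "d - x \<in> C" using D(2) x W(3) by blast
    then have "(d - x) + x \<in> W m" using x(1) W(1,2)[of m] Z.subspace_add by blast
    ultimately have "d \<in> W (m + n)" using d by auto
    then have "d - (d - x) \<in> W (m + n)" using d(2) W(1,2)[of "m + n"] Z.subspace_diff by blast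
    then show ?thesis by simp
  qed
  have div: "\<exists>y\<in>W m. x - p *\<^sub>Z y \<in> C" if "x \<in> W m" for x
  proof -
    obtain s where "p ^ s *\<^sub>Z x = 0" using tors W(3) \<open>x \<in> W m\<close> by blast
    then have "p ^ s *\<^sub>Z x \<in> C" using Z.subspace_0[OF C(1)] by simp
    then show ?thesis using \<open>x \<in> W m\<close>
    proof (induction s arbitrary: x)
      case 0
      then show ?case using Z.subspace_0[OF W(1)] by (intro bexI[of _ 0]) auto
    next
      case (Suc s)
      have "p ^ s *\<^sub>Z x \<in> W (m + Suc s)"
        by (rule stab) (use Suc.prems Z.subspace_scale[OF W(1)] in auto)
      then obtain y where y: "y \<in> P" "p ^ s *\<^sub>Z x - p ^ (m + Suc s) *\<^sub>Z y \<in> C" by (auto simp: W_def)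
      define x' where "x' = x - p *\<^sub>Z p ^ m *\<^sub>Z y"
      have "p ^ s *\<^sub>Z x' \<in> C" using y(2)
        by (simp add: x'_def Z.scale_right_diff_distrib power_add mult_ac)
      moreover have "x' \<in> W m" unfolding x'_def
        using Z.subspace_diff[OF W(1) Suc.prems(2) Z.subspace_scale[OF W(1) W(4)[OF y(1)]]] .
      ultimately obtain z where z: "z \<in> W m" "x' - p *\<^sub>Z z \<in> C" using Suc.IH by blast
      have "x - p *\<^sub>Z (z + p ^ m *\<^sub>Z y) = x' - p *\<^sub>Z z"
        by (simp add: x'_def Z.scale_right_distrib)
      then show ?case using z W(4)[OF y(1)] Z.subspace_add[OF W(1)] by metis
    qed
  qed
  have iter: "\<exists>y\<in>W m. x - p ^ n *\<^sub>Z y \<in> C" if "x \<in> W m" for x n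
  proof (induction n)
    case 0
    show ?case using that Z.subspace_0[OF C(1)] by (intro bexI[of _ x]) auto
  next
    case (Suc n)
    then obtain y where y: "y \<in> W m" "x - p ^ n *\<^sub>Z y \<in> C" by blast
    obtain z where z: "z \<in> W m" "y - p *\<^sub>Z z \<in> C" using div[OF y(1)] by blast
    have "x - p ^ Suc n *\<^sub>Z z = (x - p ^ n *\<^sub>Z y) + p ^ n *\<^sub>Z (y - p *\<^sub>Z z)"
      by (simp add: Z.scale_right_diff_distrib mult.commute)
    then have "x - p ^ Suc n *\<^sub>Z z \<in> C" using y z C(1) Z.subspace_add Z.subspace_scale by metis
    then show ?case using z by blast
  qed
  have "fin_mod P (W m)"
  proof -
    obtain E where E: "finite E" "\<And>x. x \<in> P \<Longrightarrow> p ^ m *\<^sub>Z x \<in> C \<Longrightarrow> \<exists>e\<in>E. e - x \<in> C"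
      using fin_mod_socle_power[OF C(1) soc, of m] by (rule fin_many_reps) blast
    show ?thesis
    proof (rule fin_modI_reps[OF W(1) E(1)])
      fix x assume x: "x \<in> P"
      obtain y where y: "y \<in> W m" "p ^ m *\<^sub>Z x - p ^ m *\<^sub>Z y \<in> C" using iter[OF W(4)[OF x]] by blast
      have "x - y \<in> P" using x y(1) W(3) Z.subspace_diff[OF subP] by blast
      then obtain e where e: "e \<in> E" "e - (x - y) \<in> C"
        using E(2)[of "x - y"] y(2) by (auto simp: Z.scale_right_diff_distrib)
      then have "y - (e - (x - y)) \<in> W m" using y(1) W(1,2)[of m] Z.subspace_diff by blast
      then show "\<exists>e\<in>E. x - e \<in> W m" using e(1) by (auto simp: algebra_simps)
    qed
  qed
  then show ?thesis using that[of "W m" m] W div by blast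
qed

end

context p_primary
begin

text \<open>
  A power automorphism of a \<open>p\<close>-group acts on all elements of order at most \<open>p\<^sup>n\<close> by the same multiplier
  as on one element \<open>c\<^sub>0\<close> of order \<open>p\<^sup>n\<close>. If \<open>c\<close> is independent of \<open>c\<^sub>0\<close> this is seen on \<open>c + c\<^sub>0\<close>; otherwise
  subtracting a multiple of \<open>c\<^sub>0\<close> lowers the order of \<open>c\<close>.
\<close>

lemma power_on_common:
  assumes C: "Z.subspace C" and add: "add_on C g" and pow: "power_on C g"
    and c0: "c0 \<in> C" "has_order (p ^ n) c0" "g c0 = a *\<^sub>Z c0"
  shows "c \<in> C \<Longrightarrow> s \<le> n \<Longrightarrow> p ^ s *\<^sub>Z c = 0 \<Longrightarrow> g c = a *\<^sub>Z c"
proof (induction s arbitrary: c)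
  case 0
  then show ?case using add_on_0[OF C add] by simp
next
  case (Suc s)
  show ?case
  proof (cases "\<exists>u. p ^ s *\<^sub>Z c = u *\<^sub>Z c0")
    case True
    then obtain u where u: "p ^ s *\<^sub>Z c = u *\<^sub>Z c0" by blast
    have "(p * u) *\<^sub>Z c0 = p ^ Suc s *\<^sub>Z c" using u by (simp flip: Z.scale_scale)
    then have "p ^ n dvd p * u" using Suc.prems(3) c0(2) by (simp add: has_order_def)
    moreover have n: "n = Suc (s + (n - Suc s))" using Suc.prems(2) by simp
    ultimately have "p * p ^ (s + (n - Suc s)) dvd p * u" by (metis power_Suc)
    then have "p ^ (s + (n - Suc s)) dvd u" using p_pos by simp
    then obtain w where "u = p ^ (s + (n - Suc s)) * w" by (rule dvdE)
    then have w: "u = p ^ s * (p ^ (n - Suc s) * w)" by (simp add: power_add)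
    define c' where "c' = c - (p ^ (n - Suc s) * w) *\<^sub>Z c0"
    have c': "c' \<in> C" unfolding c'_def by (intro Z.subspace_diff Z.subspace_scale C Suc.prems c0)
    moreover have "p ^ s *\<^sub>Z c' = 0" using u w by (simp add: c'_def Z.scale_right_diff_distrib)
    ultimately have IH: "g c' = a *\<^sub>Z c'" using Suc.IH Suc.prems(2) by simp
    have "c = c' + (p ^ (n - Suc s) * w) *\<^sub>Z c0" by (simp add: c'_def)
    moreover have "g (c' + (p ^ (n - Suc s) * w) *\<^sub>Z c0) = a *\<^sub>Z c' + (p ^ (n - Suc s) * w) *\<^sub>Z a *\<^sub>Z c0"
      using add_on_add[OF C add] add_on_zmul[OF C add] c' c0 IH Z.subspace_scale[OF C] by metis
    ultimately show ?thesis by (simp add: Z.scale_right_distrib mult_ac)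
  next
    case False
    have indep: "p ^ Suc s dvd i" if "i *\<^sub>Z c \<in> Z.span {c0}" for i
    proof -
      have "p ^ Suc s *\<^sub>Z c \<in> Z.span {c0}" using Suc.prems(3) Z.span_zero by metis
      then obtain t where t: "t \<le> Suc s" "\<And>a. a *\<^sub>Z c \<in> Z.span {c0} \<longleftrightarrow> p ^ t dvd a"
        using order_mod[OF p, of "Z.span {c0}" "Suc s" c] by blast
      have "\<not> p ^ t dvd p ^ s" using False t(2)[of "p ^ s"] by (simp add: in_span1)
      then have "\<not> t \<le> s" using le_imp_power_dvd by blast
      then show ?thesis using t that by (metis le_antisym not_less_eq_eq)
    qed
    obtain e where e: "g c = e *\<^sub>Z c" using pow Suc.prems(1) by (auto simp: power_on_def in_span1)
    have "c + c0 \<in> C" using Z.subspace_add C Suc.prems(1) c0(1) by blast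
    then obtain b where b: "g (c + c0) = b *\<^sub>Z (c + c0)" using pow by (auto simp: power_on_def in_span1)
    have "e *\<^sub>Z c + a *\<^sub>Z c0 = b *\<^sub>Z c + b *\<^sub>Z c0"
      using b e c0 add_on_add[OF C add Suc.prems(1) c0(1)] by (simp add: Z.scale_right_distrib)
    then have eq: "(e - b) *\<^sub>Z c = (b - a) *\<^sub>Z c0" by (simp add: Z.scale_left_diff_distrib algebra_simps)
    then have "p ^ Suc s dvd e - b" using indep[of "e - b"] by (auto simp: in_span1)
    then have "(e - b) *\<^sub>Z c = 0" using Suc.prems(3) by (metis Z.subspace_single_0 singleton_iff zmul_dvd_mem)
    moreover from this have "p ^ n dvd b - a" using eq c0(2) by (simp add: has_order_def)
    then have "p ^ Suc s dvd b - a" using Suc.prems(2) le_imp_power_dvd dvd_trans by blast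
    then have "(b - a) *\<^sub>Z c = 0" using Suc.prems(3) by (metis Z.subspace_single_0 singleton_iff zmul_dvd_mem)
    ultimately show ?thesis using e by (simp add: Z.scale_left_diff_distrib)
  qed
qed

text \<open>The largest divisible subgroup of \<open>P\<close>: the first terms of infinite sequences of \<open>p\<close>-th parts.\<close>

definition max_div :: "'u set" where
  "max_div = {x. \<exists>s. s 0 = x \<and> (\<forall>n. s n \<in> P \<and> p *\<^sub>Z s (Suc n) = s n)}"

lemma max_div_subset: "max_div \<subseteq> P"
  unfolding max_div_def by blast

lemma subspace_max_div: "Z.subspace max_div"
proof (rule Z.subspaceI)
  show "0 \<in> max_div" unfolding max_div_def
    using Z.subspace_0[OF subP] by (auto intro!: exI[of _ "\<lambda>_. 0"])
next
  fix x y assume "x \<in> max_div" "y \<in> max_div"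
  then obtain s t where "s 0 = x" "t 0 = y" "\<And>n. s n \<in> P \<and> p *\<^sub>Z s (Suc n) = s n"
    "\<And>n. t n \<in> P \<and> p *\<^sub>Z t (Suc n) = t n" unfolding max_div_def by auto
  then show "x + y \<in> max_div" unfolding max_div_def
    using Z.subspace_add[OF subP]
    by (intro CollectI exI[of _ "\<lambda>n. s n + t n"]) (simp add: Z.scale_right_distrib)
next
  fix k x assume "x \<in> max_div"
  then obtain s where s: "s 0 = x" "\<And>n. s n \<in> P \<and> p *\<^sub>Z s (Suc n) = s n"
    unfolding max_div_def by auto
  have "p *\<^sub>Z k *\<^sub>Z s (Suc n) = k *\<^sub>Z s n" for n
    using s(2)[of n] by (metis Z.scale_left_commute)
  then show "k *\<^sub>Z x \<in> max_div" unfolding max_div_def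
    using Z.subspace_scale[OF subP] s by (intro CollectI exI[of _ "\<lambda>n. k *\<^sub>Z s n"]) blast
qed

lemma max_div_div: 
  assumes "x \<in> max_div" obtains y where "y \<in> max_div" "x = p ^ n *\<^sub>Z y"
proof -
  have 1: "\<exists>y\<in>max_div. x = p *\<^sub>Z y" if x: "x \<in> max_div" for x
  proof -
    obtain s where s: "s 0 = x" "\<forall>n. s n \<in> P \<and> p *\<^sub>Z s (Suc n) = s n"
      using x unfolding max_div_def by blast
    then have "s 1 \<in> max_div" unfolding max_div_def
      by (intro CollectI exI[of _ "\<lambda>n. s (Suc n)"]) simp
    then show ?thesis using s by (metis One_nat_def)
  qed
  have "\<exists>y\<in>max_div. x = p ^ n *\<^sub>Z y"
  proof (induction n)
    case 0
    show ?case using assms by (intro bexI[of _ x]) auto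
  next
    case (Suc n)
    then obtain y where "y \<in> max_div" "x = p ^ n *\<^sub>Z y" by blast
    moreover obtain z where "z \<in> max_div" "y = p *\<^sub>Z z" using 1 calculation by blast
    ultimately show ?case by (intro bexI[of _ z]) (auto simp: mult.commute)
  qed
  then show ?thesis using that by blast
qed

lemma max_div_greatest:
  assumes "L \<subseteq> P" "\<And>y. y \<in> L \<Longrightarrow> \<exists>z\<in>L. y = p *\<^sub>Z z"
  shows "L \<subseteq> max_div"
proof
  fix y assume y: "y \<in> L"
  obtain h where h: "\<And>y. y \<in> L \<Longrightarrow> h y \<in> L \<and> y = p *\<^sub>Z h y" using assms(2) by metis
  have 1: "(h ^^ n) y \<in> L" for n by (induction n) (use y h in auto)
  then have "(h ^^ n) y \<in> P \<and> p *\<^sub>Z (h ^^ Suc n) y = (h ^^ n) y" for n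
    using h[OF 1[of n]] 1[of n] assms(1) by auto
  then show "y \<in> max_div" unfolding max_div_def by (intro CollectI exI[of _ "\<lambda>n. (h ^^ n) y"]) simp
qed

text \<open>
  An element \<open>x\<close> of the divisible part lies in a Pruefer subgroup (or is \<open>0\<close>). Its image is divisible
  and finite modulo it, so the Pruefer subgroup is invariant by \<open>divisible_fin_mod\<close>; and its subgroups
  are determined by their orders.
\<close>

lemma inert_power_max_div:
  assumes g: "inert P g"
  shows "power_on max_div g"
  unfolding power_on_def
proof
  fix x assume x: "x \<in> max_div"
  have add: "add_on P g" and gP: "g ` P = P" using aut_onD[OF inertD(1)[OF g]] by auto
  obtain s where s: "s 0 = x" "\<And>n. s n \<in> P" "\<And>n. p *\<^sub>Z s (Suc n) = s n"
    using x unfolding max_div_def by auto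
  have sp: "s i = p ^ d *\<^sub>Z s (i + d)" for i d
  proof (induction d)
    case (Suc d)
    then show ?case using s(3)[of "i + d"] by (metis Z.scale_scale add_Suc_right power_Suc2)
  qed simp
  define K where "K = {k *\<^sub>Z s n | k n. True}"
  have K: "Z.subspace K" "K \<subseteq> P"
  proof -
    show "K \<subseteq> P" using s(2) Z.subspace_scale[OF subP] by (auto simp: K_def)
    show "Z.subspace K"
    proof (rule Z.subspaceI)
      show "0 \<in> K" unfolding K_def by (auto intro!: exI[of _ 0])
    next
      fix u v assume "u \<in> K" "v \<in> K"
      then obtain k l m n where uv: "u = k *\<^sub>Z s m" "v = l *\<^sub>Z s n" by (auto simp: K_def)
      have "u + v = (k * p ^ n + l * p ^ m) *\<^sub>Z s (m + n)"
        using uv sp[of m n] sp[of n m] by (simp add: Z.scale_left_distrib add.commute)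
      then show "u + v \<in> K" unfolding K_def by blast
    next
      fix k u assume "u \<in> K"
      then obtain l n where "k *\<^sub>Z u = (k * l) *\<^sub>Z s n" by (auto simp: K_def)
      then show "k *\<^sub>Z u \<in> K" unfolding K_def by blast
    qed
  qed
  have "g ` K \<subseteq> K"
  proof (rule divisible_fin_mod[OF K(1)])
    show "fin_mod (g ` K) K" by (rule inertD(2)[OF g K])
    show "g ` K \<subseteq> P" using K(2) gP by blast
    fix y assume "y \<in> g ` K"
    then obtain k n where y: "y = g (k *\<^sub>Z s n)" by (auto simp: K_def)
    have "k *\<^sub>Z s n = p *\<^sub>Z k *\<^sub>Z s (Suc n)" using s(3)[of n] by (metis Z.scale_left_commute)
    then have "y = p *\<^sub>Z g (k *\<^sub>Z s (Suc n))"
      using y add_on_zmul[OF subP add] Z.subspace_scale[OF subP] s(2) by metis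
    moreover have "k *\<^sub>Z s (Suc n) \<in> K" by (auto simp: K_def)
    ultimately show "\<exists>z\<in>g ` K. y = p *\<^sub>Z z" by blast
  qed
  moreover have "x = 1 *\<^sub>Z s 0" using s(1) by simp
  then have "x \<in> K" unfolding K_def by blast
  ultimately obtain k n where gx: "g x = k *\<^sub>Z s n" unfolding K_def by blast
  have xP: "x \<in> P" using x max_div_subset by blast
  obtain e where e: "has_order (p ^ e) x" using has_order_exists[OF p] tors[OF xP] by metis
  obtain a where a: "has_order (p ^ a) (s n)" using has_order_exists[OF p] tors[OF s(2)] by metis
  have "p ^ e *\<^sub>Z x = 0" using e by (simp add: has_order_def)
  then have "p ^ e *\<^sub>Z g x = 0" using add_on_zmul[OF subP add xP] add_on_0[OF subP add] by metis
  then have "p ^ a dvd p ^ e * k" using a gx by (simp add: has_order_def)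
  have ord: "e \<le> b \<longleftrightarrow> a \<le> b + n" for b
  proof -
    have "e \<le> b \<longleftrightarrow> p ^ b *\<^sub>Z x = 0"
      using e p_pos prime_gt_1_int[OF p] by (simp add: has_order_def dvd_power_iff)
    also have "\<dots> \<longleftrightarrow> p ^ (b + n) *\<^sub>Z s n = 0" using sp[of 0 n] s(1) by (simp add: power_add)
    also have "\<dots> \<longleftrightarrow> a \<le> b + n"
      using a p_pos prime_gt_1_int[OF p] by (simp add: has_order_def dvd_power_iff)
    finally show ?thesis .
  qed
  show "g x \<in> Z.span {x}"
  proof (cases "e = 0")
    case True
    then have "x = 0" using e by (metis \<open>p ^ e *\<^sub>Z x = 0\<close> Z.scale_one power_0)
    then show ?thesis using add_on_0[OF subP add] by (simp add: Z.span_zero)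
  next
    case False
    then have "a = e + n" using ord[of e] ord[of "e - 1"] by auto
    then have "p ^ n dvd k" using \<open>p ^ a dvd p ^ e * k\<close> p_pos by (simp add: power_add)
    then obtain w where "k = w * p ^ n" by (metis dvdE mult.commute)
    then have "g x = w *\<^sub>Z x" using gx sp[of 0 n] s(1) by (metis Z.scale_scale add_0)
    then show ?thesis by (auto simp: in_span1)
  qed
qed

end

context p_primary
begin

section \<open>Power action on a subgroup of finite index\<close>

lemma fin_mod_bounded:
  assumes "Z.subspace C" "fin_mod {x \<in> P. p *\<^sub>Z x \<in> C} C" "\<And>x. x \<in> P \<Longrightarrow> p ^ k *\<^sub>Z x = 0"
  shows "fin_mod P C"
  by (rule fin_many_mono[OF fin_mod_socle_power[OF assms(1,2), of k]])
    (use assms Z.subspace_0 in auto)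

lemma max_div_complement:
  obtains H where "Z.subspace H" "H \<subseteq> P" "H \<inter> max_div \<subseteq> {0}" "\<And>x. x \<in> P \<Longrightarrow> \<exists>d\<in>max_div. x - d \<in> H"
proof -
  obtain H where H: "Z.subspace H" "H \<subseteq> P" "H \<inter> max_div \<subseteq> {0}"
    "\<And>x. x \<in> P \<Longrightarrow> x \<notin> H \<Longrightarrow> \<exists>f k. f \<in> max_div \<and> f \<noteq> 0 \<and> f - k *\<^sub>Z x \<in> H"
    using maximal_avoiding[OF subP, of max_div] by blast
  have "\<exists>d\<in>max_div. x - d \<in> H" if x: "x \<in> P" and s: "p ^ s *\<^sub>Z x = 0" for x s
    using x s
  proof (induction s arbitrary: x)
    case 0
    then show ?case using Z.subspace_0[OF H(1)] Z.subspace_0[OF subspace_max_div]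
      by (intro bexI[of _ 0]) auto
  next
    case (Suc s)
    have "p ^ s *\<^sub>Z p *\<^sub>Z x = 0" using Suc.prems(2) by (simp add: mult.commute)
    then obtain d where d: "d \<in> max_div" "p *\<^sub>Z x - d \<in> H"
      using Suc.IH Suc.prems(1) Z.subspace_scale[OF subP] by blast
    obtain e where e: "e \<in> max_div" "d = p ^ 1 *\<^sub>Z e" using d(1) max_div_div by blast
    define y where "y = x - e"
    have y: "y \<in> P" unfolding y_def using e max_div_subset Suc.prems(1) Z.subspace_diff[OF subP] by blast
    have py: "p *\<^sub>Z y \<in> H" using d e by (simp add: y_def Z.scale_right_diff_distrib)
    show ?case
    proof (cases "y \<in> H")
      case True
      then show ?thesis using e y_def by auto
    next
      case False
      then obtain f k where f: "f \<in> max_div" "f \<noteq> 0" "f - k *\<^sub>Z y \<in> H" using H(4) y by blast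
      have "\<not> p dvd k"
      proof
        assume "p dvd k"
        then have "k *\<^sub>Z y \<in> H" using zmul_dvd_mem[OF H(1) py] by blast
        then have "(f - k *\<^sub>Z y) + k *\<^sub>Z y \<in> H" using f(3) Z.subspace_add[OF H(1)] by blast
        then show False using f H(3) by auto
      qed
      then have "coprime k p" using prime_power_coprime[OF p, of k 1] by simp
      then obtain u v where uv: "u * k + v * p = 1" using bezout_int[of k p] by auto
      have "y = (u * k + v * p) *\<^sub>Z y" by (simp add: uv)
      then have "y - u *\<^sub>Z f = v *\<^sub>Z p *\<^sub>Z y - u *\<^sub>Z (f - k *\<^sub>Z y)"
        by (simp add: Z.scale_left_distrib Z.scale_right_diff_distrib add.commute)
      then have "y - u *\<^sub>Z f \<in> H"
        using py f(3) H(1) Z.subspace_scale Z.subspace_diff by metis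
      then have "x - (e + u *\<^sub>Z f) \<in> H" by (simp add: y_def diff_diff_eq)
      moreover have "e + u *\<^sub>Z f \<in> max_div"
        using e f Z.subspace_add[OF subspace_max_div] Z.subspace_scale[OF subspace_max_div] by blast
      ultimately show ?thesis by blast
    qed
  qed
  then show ?thesis using that[OF H(1-3)] tors by blast
qed

lemma finite_bounded:
  assumes "finite Y" "Y \<subseteq> P"
  obtains t where "\<And>y. y \<in> Y \<Longrightarrow> p ^ t *\<^sub>Z y = 0"
proof -
  obtain t where t: "\<And>y. y \<in> P \<Longrightarrow> p ^ t y *\<^sub>Z y = 0" using tors by metis
  have "p ^ Max (t ` Y) *\<^sub>Z y = 0" if "y \<in> Y" for y
    by (rule power_zmul_eq_0_le[OF t]) (use that assms in auto)
  then show ?thesis using that by blast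
qed

text \<open>A suitable multiple of an element of large order has order exactly \<open>p\<^sup>n\<close>.\<close>

lemma exact_order:
  assumes C: "Z.subspace C" "C \<subseteq> P" and c: "c \<in> C" "p ^ n *\<^sub>Z c \<noteq> 0"
  obtains c' where "c' \<in> C" "has_order (p ^ n) c'"
proof -
  obtain s where "p ^ s *\<^sub>Z c = 0" using tors c(1) C(2) by blast
  then obtain t where t: "has_order (p ^ t) c" using has_order_exists[OF p] by metis
  then have "\<not> p ^ t dvd p ^ n" using c(2) by (simp add: has_order_def)
  then have "n \<le> t" using le_imp_power_dvd nat_le_linear by blast
  then have pt: "p ^ t = p ^ (t - n) * p ^ n" by (simp flip: power_add)
  have "has_order (p ^ n) (p ^ (t - n) *\<^sub>Z c)"
    unfolding has_order_def
  proof
    fix a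
    have "a *\<^sub>Z p ^ (t - n) *\<^sub>Z c = 0 \<longleftrightarrow> p ^ (t - n) * p ^ n dvd p ^ (t - n) * a"
      using t pt by (simp add: has_order_def mult.commute)
    then show "a *\<^sub>Z p ^ (t - n) *\<^sub>Z c = 0 \<longleftrightarrow> p ^ n dvd a" using p_pos by simp
  qed
  then show ?thesis using that c(1) Z.subspace_scale[OF C(1)] by blast
qed

text \<open>
  With \<open>C\<close> and \<open>C\<^sub>1\<close> as in \<open>inert_power_socle\<close> and \<open>stable_image\<close>, unboundedness of \<open>P/D\<close> forces \<open>C\<close> to be
  unbounded modulo \<open>D = max_div\<close>. On \<open>C\<close> the map \<open>g\<close> is multiplication by a \<open>p\<close>-adic integer \<open>\<alpha>\<close>, given by
  multipliers \<open>al n\<close> on the elements of order dividing \<open>p\<^sup>n\<close>. The difference \<open>\<delta> = g - \<alpha>\<close> kills \<open>C\<close>, and \<open>\<delta> H\<close> is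
  finite modulo \<open>H\<close> for every subgroup \<open>H\<close>. It is shown that \<open>\<delta>\<close> kills \<open>D\<close>, and then that it kills \<open>C\<^sub>1\<close>.
\<close>

lemma inert_power_finite_index:
  assumes g: "inert P g" and unb: "\<And>k. \<exists>x\<in>P. p ^ k *\<^sub>Z x \<notin> max_div"
  obtains C where "Z.subspace C" "C \<subseteq> P" "power_on C g" "fin_mod P C"
proof -
  note D = subspace_max_div
  have add: "add_on P g" and gP: "g ` P = P" using aut_onD[OF inertD(1)[OF g]] by auto
  obtain C where C: "Z.subspace C" "C \<subseteq> P" "power_on C g" "fin_mod {x \<in> P. p *\<^sub>Z x \<in> C} C"
    using inert_power_socle[OF g] by blast
  obtain C1 m where C1: "Z.subspace C1" "C \<subseteq> C1" "C1 \<subseteq> P" "\<And>x. x \<in> P \<Longrightarrow> p ^ m *\<^sub>Z x \<in> C1"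
    "\<And>x. x \<in> C1 \<Longrightarrow> \<exists>y\<in>C1. x - p *\<^sub>Z y \<in> C" "fin_mod P C1"
    using stable_image[OF C(1,2,4)] by blast
  have addC: "add_on C g" using add_on_mono[OF add C(2)] .

  have Cunb: "\<exists>c\<in>C. p ^ k *\<^sub>Z c \<notin> max_div" for k
  proof (rule ccontr)
    assume "\<not> ?thesis"
    then have k: "p ^ k *\<^sub>Z c \<in> max_div" if "c \<in> C" for c using that by blast
    define M where "M = {p ^ k *\<^sub>Z x + d | x d. x \<in> C1 \<and> d \<in> max_div}"
    have "M \<subseteq> max_div"
    proof (rule max_div_greatest)
      show "M \<subseteq> P" unfolding M_def
        using C1(3) max_div_subset Z.subspace_add[OF subP] Z.subspace_scale[OF subP] by blast
      fix y assume "y \<in> M"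
      then obtain x d where y: "y = p ^ k *\<^sub>Z x + d" "x \<in> C1" "d \<in> max_div" by (auto simp: M_def)
      obtain z where z: "z \<in> C1" "x - p *\<^sub>Z z \<in> C" using C1(5) y(2) by blast
      have "p ^ k *\<^sub>Z (x - p *\<^sub>Z z) + d \<in> max_div" using k z(2) y(3) Z.subspace_add[OF D] by blast
      then obtain e where e: "e \<in> max_div" "p ^ k *\<^sub>Z (x - p *\<^sub>Z z) + d = p ^ 1 *\<^sub>Z e"
        using max_div_div by metis
      have "y = p *\<^sub>Z (p ^ k *\<^sub>Z z + e)"
        using e(2) y(1) by (simp add: Z.scale_right_distrib Z.scale_right_diff_distrib algebra_simps)
      then show "\<exists>z\<in>M. y = p *\<^sub>Z z" using z(1) e(1) unfolding M_def by blast
    qed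
    moreover have "p ^ k *\<^sub>Z p ^ m *\<^sub>Z x \<in> M" if "x \<in> P" for x
      unfolding M_def using C1(4)[OF that] Z.subspace_0[OF D]
      by (intro CollectI exI[of _ "p ^ m *\<^sub>Z x"] exI[of _ 0]) simp
    ultimately have "p ^ (k + m) *\<^sub>Z x \<in> max_div" if "x \<in> P" for x
      using that by (auto simp: power_add)
    then show False using unb[of "k + m"] by blast
  qed

  have "\<exists>c. c \<in> C \<and> has_order (p ^ n) c" for n
  proof -
    obtain c where c: "c \<in> C" "p ^ n *\<^sub>Z c \<notin> max_div" using Cunb by blast
    then have "p ^ n *\<^sub>Z c \<noteq> 0" using Z.subspace_0[OF D] by auto
    then show ?thesis using exact_order[OF C(1,2) c(1)] by blast
  qed
  then obtain cc where cc: "cc n \<in> C" "has_order (p ^ n) (cc n)" for n by metis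
  have "\<exists>a. g (cc n) = a *\<^sub>Z cc n" for n
    using C(3) cc(1) by (auto simp: power_on_def in_span1)
  then obtain al where al: "g (cc n) = al n *\<^sub>Z cc n" for n by metis
  have gC: "g c = al n *\<^sub>Z c" if "c \<in> C" "p ^ n *\<^sub>Z c = 0" for c n
    by (rule power_on_common[OF C(1) addC C(3) cc(1) cc(2) al that(1) order_refl that(2)])
  have al_le: "al k *\<^sub>Z x = al n *\<^sub>Z x" if "p ^ n *\<^sub>Z x = 0" "n \<le> k" for x k n
  proof -
    have 0: "p ^ n *\<^sub>Z cc n = 0" using cc(2) by (simp add: has_order_def)
    have "al k *\<^sub>Z cc n = al n *\<^sub>Z cc n"
      using gC[OF cc(1) 0] gC[OF cc(1) power_zmul_eq_0_le[OF 0 that(2)]] by simp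
    then have "(al k - al n) *\<^sub>Z cc n = 0" by (simp add: Z.scale_left_diff_distrib)
    then have "p ^ n dvd al k - al n" using cc(2) unfolding has_order_def by blast
    then have "(al k - al n) *\<^sub>Z x = 0" using that(1) zmul_dvd_mem[of "{0}" "p ^ n" x] by simp
    then show ?thesis by (simp add: Z.scale_left_diff_distrib)
  qed
  define \<delta> where "\<delta> x = g x - al (LEAST n. p ^ n *\<^sub>Z x = 0) *\<^sub>Z x" for x
  have \<delta>: "\<delta> x = g x - al n *\<^sub>Z x" if "p ^ n *\<^sub>Z x = 0" for x n
    unfolding \<delta>_def using al_le[OF LeastI[of "\<lambda>n. p ^ n *\<^sub>Z x = 0", OF that] Least_le[of "\<lambda>n. p ^ n *\<^sub>Z x = 0", OF that]] by simp
  have addd: "add_on P \<delta>" unfolding add_on_def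
  proof (intro ballI)
    fix x y assume xy: "x \<in> P" "y \<in> P"
    obtain n k where n: "p ^ n *\<^sub>Z x = 0" "p ^ k *\<^sub>Z y = 0" using tors xy by blast
    have n': "p ^ max n k *\<^sub>Z x = 0" "p ^ max n k *\<^sub>Z y = 0" using n power_zmul_eq_0_le by (meson max.cobounded1 max.cobounded2)+
    then have "p ^ max n k *\<^sub>Z (x + y) = 0" by (simp add: Z.scale_right_distrib)
    then show "\<delta> (x + y) = \<delta> x + \<delta> y"
      using \<delta>[OF n'(1)] \<delta>[OF n'(2)] \<delta> add_on_add[OF subP add xy] by (simp add: Z.scale_right_distrib)
  qed
  have \<delta>C: "\<delta> c = 0" if "c \<in> C" for c
    using gC[OF that] \<delta> tors C(2) that by fastforce
  have \<delta>P: "\<delta> x \<in> P" if "x \<in> P" for x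
    unfolding \<delta>_def using that gP Z.subspace_diff[OF subP] Z.subspace_scale[OF subP] by blast
  have \<delta>fin: "fin_mod (\<delta> ` H) H" if H: "Z.subspace H" "H \<subseteq> P" for H
  proof -
    obtain R where R: "finite R" "\<And>x. x \<in> g ` H \<Longrightarrow> \<exists>r\<in>R. r - x \<in> H"
      using inertD(2)[OF g H] by (rule fin_many_reps) blast
    show ?thesis
    proof (rule fin_modI_reps[OF H(1) R(1)])
      fix z assume "z \<in> \<delta> ` H"
      then obtain h where h: "h \<in> H" "z = \<delta> h" by blast
      obtain r where r: "r \<in> R" "r - g h \<in> H" using R(2) h(1) by blast
      have "z - r = - (r - g h) - al (LEAST n. p ^ n *\<^sub>Z h = 0) *\<^sub>Z h" by (simp add: h(2) \<delta>_def)
      then have "z - r \<in> H" using r(2) h(1) H(1) Z.subspace_diff Z.subspace_neg Z.subspace_scale by metis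
      then show "\<exists>r\<in>R. z - r \<in> H" using r(1) by blast
    qed
  qed

  have \<delta>DD: "\<delta> d \<in> max_div" if d: "d \<in> max_div" for d
  proof -
    obtain k where "g d = k *\<^sub>Z d" using inert_power_max_div[OF g] d by (auto simp: power_on_def in_span1)
    then show ?thesis unfolding \<delta>_def using d Z.subspace_diff[OF D] Z.subspace_scale[OF D] by metis
  qed
  have \<delta>D: "\<delta> d = 0" if "d \<in> max_div" for d
  proof (rule ccontr)
    assume nz: "\<delta> d \<noteq> 0"
    \<comment> \<open>otherwise \<open>\<delta> D\<close> is a nonzero divisible group; a subgroup \<open>Y\<close> with \<open>Y \<inter> D = 0\<close> and infinite
      \<open>\<delta> Y \<inter> D\<close> is generated by elements \<open>y = c + v'\<close> with \<open>c \<in> C\<close> of large order and \<open>v' \<in> D\<close>\<close>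
    have grow: "\<exists>w\<in>max_div. \<delta> w \<notin> E" if "finite E" for E
    proof (rule ccontr)
      assume "\<not> ?thesis"
      then have "\<delta> ` max_div \<subseteq> E" by blast
      then have "finite (\<delta> ` max_div)" using that finite_subset by blast
      then have "fin_mod (\<delta> ` max_div) {0}" by (rule fin_many_finite) simp
      then have "\<delta> ` max_div \<subseteq> {0}"
      proof (rule divisible_fin_mod[rotated 3])
        show "\<delta> ` max_div \<subseteq> P" using \<delta>DD max_div_subset by blast
        fix y assume "y \<in> \<delta> ` max_div"
        then obtain x where x: "x \<in> max_div" "y = \<delta> x" by blast
        obtain z where z: "z \<in> max_div" "x = p ^ 1 *\<^sub>Z z" using max_div_div x(1) by blast
        then have "y = p *\<^sub>Z \<delta> z" using x add_on_zmul[OF subP addd] max_div_subset by auto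
        then show "\<exists>z\<in>\<delta> ` max_div. y = p *\<^sub>Z z" using z(1) by blast
      qed simp
      then show False using nz \<open>d \<in> max_div\<close> by blast
    qed
    have step: "\<exists>y. y \<in> P \<and> Z.span (insert y Y) \<inter> max_div \<subseteq> {0} \<and> \<delta> y \<in> max_div \<and> \<delta> y \<notin> \<delta> ` Y"
      if Y: "finite Y" "Z.subspace Y" "Y \<subseteq> P" "Y \<inter> max_div \<subseteq> {0}" for Y
    proof -
      obtain w where w: "w \<in> max_div" "\<delta> w \<notin> \<delta> ` Y" using grow Y(1) by blast
      obtain j where j: "p ^ j *\<^sub>Z w = 0" using tors w(1) max_div_subset by blast
      obtain t where t: "\<And>y. y \<in> Y \<Longrightarrow> p ^ t *\<^sub>Z y = 0" using finite_bounded[OF Y(1,3)] by blast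
      obtain c where c: "c \<in> C" "p ^ (t + j) *\<^sub>Z c \<notin> max_div" using Cunb by blast
      define K where "K = Z.span (Y \<union> max_div)"
      have K: "Z.subspace K" "\<And>z. z \<in> K \<Longrightarrow> \<exists>y\<in>Y. \<exists>d\<in>max_div. z = y + d"
        "Y \<subseteq> K" "max_div \<subseteq> K"
      proof -
        have "Z.span Y = Y" "Z.span max_div = max_div" using Y(2) D by auto
        then show "\<And>z. z \<in> K \<Longrightarrow> \<exists>y\<in>Y. \<exists>d\<in>max_div. z = y + d" unfolding K_def Z.span_Un by blast
      qed (auto simp: K_def intro: Z.span_base)
      obtain s where s: "p ^ s *\<^sub>Z c = 0" using tors c(1) C(2) by blast
      have "p ^ s *\<^sub>Z c \<in> K" using s Z.subspace_0[OF K(1)] by simp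
      then obtain n where n: "\<And>a. a *\<^sub>Z c \<in> K \<longleftrightarrow> p ^ n dvd a" using order_mod[OF p K(1)] by metis
      have "j \<le> n"
      proof (rule ccontr)
        assume "\<not> j \<le> n"
        then have "p ^ j *\<^sub>Z c \<in> K" using n le_imp_power_dvd by (metis nat_le_linear)
        then obtain y d where yd: "y \<in> Y" "d \<in> max_div" "p ^ j *\<^sub>Z c = y + d" using K(2) by blast
        have "p ^ (t + j) *\<^sub>Z c = p ^ t *\<^sub>Z p ^ j *\<^sub>Z c" by (simp add: power_add)
        also have "\<dots> = p ^ t *\<^sub>Z d" using yd t by (simp add: Z.scale_right_distrib)
        finally show False using c(2) yd(2) Z.subspace_scale[OF D] by simp
      qed
      have "p ^ n *\<^sub>Z c \<in> K" using n by simp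
      then obtain y0 d0 where yd: "y0 \<in> Y" "d0 \<in> max_div" "p ^ n *\<^sub>Z c = y0 + d0" using K(2) by blast
      obtain v where v: "v \<in> max_div" "- d0 = p ^ n *\<^sub>Z v"
        using max_div_div[OF Z.subspace_neg[OF D yd(2)]] by blast
      \<comment> \<open>\<open>v\<close> may be changed by \<open>w\<close>, as \<open>p\<^sup>n w = 0\<close>; one of the two choices has a new image under \<open>\<delta>\<close>\<close>
      have "\<exists>v'\<in>max_div. p ^ n *\<^sub>Z v' = - d0 \<and> \<delta> v' \<notin> \<delta> ` Y"
      proof (cases "\<delta> v \<in> \<delta> ` Y")
        case True
        have vw: "v + w \<in> max_div" using v(1) w(1) Z.subspace_add[OF D] by blast
        have "\<delta> (v + w) \<notin> \<delta> ` Y"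
        proof
          assume "\<delta> (v + w) \<in> \<delta> ` Y"
          then obtain y2 y1 where y: "y1 \<in> Y" "y2 \<in> Y" "\<delta> v = \<delta> y1" "\<delta> (v + w) = \<delta> y2" using True by blast
          have "v \<in> P" "w \<in> P" using v(1) w(1) max_div_subset by blast+
          then have "\<delta> w = \<delta> y2 - \<delta> y1" using y add_on_add[OF subP addd, of v w] by (simp add: algebra_simps)
          also have "\<dots> = \<delta> (y2 - y1)" using y(1,2) Y(3) add_on_diff[OF subP addd, of y2 y1] by (simp add: subset_iff)
          finally show False using w(2) y Z.subspace_diff[OF Y(2)] by blast
        qed
        moreover have "p ^ n *\<^sub>Z (v + w) = - d0"
          using v(2) power_zmul_eq_0_le[OF j \<open>j \<le> n\<close>] by (simp add: Z.scale_right_distrib)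
        ultimately show ?thesis using vw by blast
      next
        case False
        then show ?thesis using v by auto
      qed
      then obtain v' where v': "v' \<in> max_div" "p ^ n *\<^sub>Z v' = - d0" "\<delta> v' \<notin> \<delta> ` Y" by blast
      define y where "y = c + v'"
      have cP: "c \<in> P" "v' \<in> P" using c(1) C(2) v'(1) max_div_subset by blast+
      then have "y \<in> P" unfolding y_def using Z.subspace_add[OF subP] by blast
      moreover have \<delta>y: "\<delta> y = \<delta> v'" unfolding y_def using add_on_add[OF subP addd cP] \<delta>C[OF c(1)] by simp
      moreover have "p ^ n *\<^sub>Z y = y0" using v'(2) yd(3) by (simp add: y_def Z.scale_right_distrib)
      have "Z.span (insert y Y) \<inter> max_div \<subseteq> {0}"
      proof
        fix z assume z: "z \<in> Z.span (insert y Y) \<inter> max_div"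
        have "Z.span Y = Y" using Y(2) by simp
        then obtain k where k: "z - k *\<^sub>Z y \<in> Y" using z Z.span_breakdown_eq[of z y Y] by (metis IntD1)
        have "k *\<^sub>Z c = z - (z - k *\<^sub>Z y) - k *\<^sub>Z v'" by (simp add: y_def Z.scale_right_distrib)
        moreover have "z \<in> K" "z - k *\<^sub>Z y \<in> K" "k *\<^sub>Z v' \<in> K" using z k v'(1) K(1,3,4) Z.subspace_scale by blast+
        ultimately have "k *\<^sub>Z c \<in> K" using K(1) Z.subspace_diff by metis
        then have "p ^ n dvd k" using n by blast
        then have "k *\<^sub>Z y \<in> Y" using \<open>p ^ n *\<^sub>Z y = y0\<close> yd(1) zmul_dvd_mem[OF Y(2)] by metis
        then have "(z - k *\<^sub>Z y) + k *\<^sub>Z y \<in> Y" using k Z.subspace_add[OF Y(2)] by blast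
        then show "z \<in> {0}" using z Y(4) by auto
      qed
      ultimately show ?thesis using \<delta>DD[OF v'(1)] v'(3) by metis
    qed
    define nxt where "nxt Y = (SOME y. y \<in> P \<and> Z.span (insert y Y) \<inter> max_div \<subseteq> {0} \<and> \<delta> y \<in> max_div \<and> \<delta> y \<notin> \<delta> ` Y)" for Y
    define Ys where "Ys = rec_nat {0} (\<lambda>_ Y. Z.span (insert (nxt Y) Y))"
    have Ys_0: "Ys 0 = {0}" and Ys_Suc: "Ys (Suc n) = Z.span (insert (nxt (Ys n)) (Ys n))" for n
      by (simp_all add: Ys_def)
    have nxt: "nxt Y \<in> P \<and> Z.span (insert (nxt Y) Y) \<inter> max_div \<subseteq> {0} \<and> \<delta> (nxt Y) \<in> max_div \<and> \<delta> (nxt Y) \<notin> \<delta> ` Y"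
      if "finite Y" "Z.subspace Y" "Y \<subseteq> P" "Y \<inter> max_div \<subseteq> {0}" for Y
      unfolding nxt_def using someI_ex[OF step[OF that]] .
    have Ys: "finite (Ys n) \<and> Z.subspace (Ys n) \<and> Ys n \<subseteq> P \<and> Ys n \<inter> max_div \<subseteq> {0}" for n
    proof (induction n)
      case 0
      show ?case using Z.subspace_0[OF subP] by (simp add: Ys_0)
    next
      case (Suc n)
      then have nx: "nxt (Ys n) \<in> P" "Z.span (insert (nxt (Ys n)) (Ys n)) \<inter> max_div \<subseteq> {0}" using nxt by blast+
      have sub: "insert (nxt (Ys n)) (Ys n) \<subseteq> P" using nx(1) Suc by blast
      have "finite (Ys (Suc n))" unfolding Ys_Suc
        by (rule finite_span_finite) (use Suc sub tors_nonzero in \<open>blast+\<close>)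
      with Z.span_minimal[OF sub subP] nx(2) show ?case by (simp add: Ys_Suc)
    qed
    define y where "y n = nxt (Ys n)" for n
    have y: "y n \<in> P" "\<delta> (y n) \<in> max_div" "\<delta> (y n) \<notin> \<delta> ` Ys n" "y n \<in> Ys (Suc n)" "Ys n \<subseteq> Ys (Suc n)" for n
      using nxt[of "Ys n"] Ys[of n] unfolding y_def Ys_Suc by (auto intro: Z.span_base)
    have mono: "Ys i \<subseteq> Ys j" if "i \<le> j" for i j
      using lift_Suc_mono_le[of Ys, OF y(5) that] .
    define Y where "Y = (\<Union>n. Ys n)"
    have Y: "Z.subspace Y"
    proof (rule Z.subspaceI)
      show "0 \<in> Y" unfolding Y_def using Ys_0 by blast
    next
      fix u v assume "u \<in> Y" "v \<in> Y"
      then obtain i j where "u \<in> Ys i" "v \<in> Ys j" by (auto simp: Y_def)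
      then have "u \<in> Ys (max i j)" "v \<in> Ys (max i j)" using mono[of i "max i j"] mono[of j "max i j"] by (simp_all add: subset_iff)
      then have "u + v \<in> Ys (max i j)" using Ys[of "max i j"] Z.subspace_add by blast
      then show "u + v \<in> Y" unfolding Y_def by blast
    next
      fix k u assume "u \<in> Y"
      then obtain i where "u \<in> Ys i" by (auto simp: Y_def)
      then have "k *\<^sub>Z u \<in> Ys i" using Ys[of i] Z.subspace_scale by blast
      then show "k *\<^sub>Z u \<in> Y" unfolding Y_def by blast
    qed
    have YP: "Y \<subseteq> P" using Ys by (auto simp: Y_def)
    have "\<delta> (y i) \<in> \<delta> ` Y" for i using y(4) by (auto simp: Y_def)
    then obtain i j where ij: "i < j" "\<delta> (y j) - \<delta> (y i) \<in> Y"
      using fin_many_pigeonhole[OF \<delta>fin[OF Y YP], of "\<lambda>i. \<delta> (y i)"] by blast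
    have "\<delta> (y j) - \<delta> (y i) \<in> max_div" using y(2) Z.subspace_diff[OF D] by blast
    moreover have "Y \<inter> max_div \<subseteq> {0}" unfolding Y_def using Ys by blast
    ultimately have "\<delta> (y j) - \<delta> (y i) = 0" using ij(2) by blast
    moreover have "y i \<in> Ys j" using y(4)[of i] mono[of "Suc i" j] ij(1) by auto
    ultimately show False using y(3)[of j] by auto
  qed

  \<comment> \<open>\<open>\<delta> C\<^sub>1\<close> is divisible, hence in \<open>D\<close>; it is contained in \<open>\<delta> H\<close> for a complement \<open>H\<close> of \<open>D\<close>, hence finite
    modulo \<open>H\<close> and therefore in \<open>H\<close>\<close>
  obtain H where H: "Z.subspace H" "H \<subseteq> P" "H \<inter> max_div \<subseteq> {0}" "\<And>x. x \<in> P \<Longrightarrow> \<exists>d\<in>max_div. x - d \<in> H"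
    using max_div_complement by blast
  have div: "\<exists>z\<in>\<delta> ` C1. y = p *\<^sub>Z z" if y: "y \<in> \<delta> ` C1" for y
  proof -
    obtain x where x: "x \<in> C1" "y = \<delta> x" using y by blast
    obtain z where z: "z \<in> C1" "x - p *\<^sub>Z z \<in> C" using C1(5) x(1) by blast
    have P: "x \<in> P" "z \<in> P" "p *\<^sub>Z z \<in> P" using x z C1(3) Z.subspace_scale[OF subP] by blast+
    have "\<delta> x - p *\<^sub>Z \<delta> z = 0"
      using \<delta>C[OF z(2)] add_on_diff[OF subP addd P(1,3)] add_on_zmul[OF subP addd P(2)] by simp
    then show ?thesis using x(2) z(1) by (intro bexI[of _ "\<delta> z"]) simp_all
  qed
  have sub: "\<delta> ` C1 \<subseteq> P" using \<delta>P C1(3) by blast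
  have inD: "\<delta> ` C1 \<subseteq> max_div" by (rule max_div_greatest[OF sub div])
  have "\<delta> ` C1 \<subseteq> \<delta> ` H"
  proof
    fix y assume "y \<in> \<delta> ` C1"
    then obtain x where x: "x \<in> P" "y = \<delta> x" using C1(3) by blast
    obtain d where d: "d \<in> max_div" "x - d \<in> H" using H(4) x(1) by blast
    then have "\<delta> (x - d) = y" using x \<delta>D[OF d(1)] add_on_diff[OF subP addd x(1)] max_div_subset by auto
    then show "y \<in> \<delta> ` H" using d(2) by blast
  qed
  then have "fin_mod (\<delta> ` C1) H" by (rule fin_many_mono[OF \<delta>fin[OF H(1,2)]])
  then have "\<delta> ` C1 \<subseteq> H" using divisible_fin_mod[OF H(1) sub div] by blast
  then have \<delta>C1: "\<delta> x = 0" if "x \<in> C1" for x using inD H(3) that by blast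
  have "power_on C1 g" unfolding power_on_def
  proof
    fix x assume "x \<in> C1"
    then have "g x = al (LEAST n. p ^ n *\<^sub>Z x = 0) *\<^sub>Z x" using \<delta>C1 unfolding \<delta>_def by simp
    then show "g x \<in> Z.span {x}" by (auto simp: in_span1)
  qed
  then show ?thesis using that C1 by blast
qed

end

section \<open>Groups generated by finitely many inertial automorphisms\<close>

text \<open>
  The group of automorphisms of \<open>S\<close> generated by \<open>\<Gamma>\<close>. Its elements are functions on the whole type, of
  which only the values on \<open>S\<close> are meaningful.
\<close>

inductive_set gen :: "'u::ab_group_add set \<Rightarrow> ('u \<Rightarrow> 'u) set \<Rightarrow> ('u \<Rightarrow> 'u) set" for S \<Gamma> where
  gen_one: "(\<lambda>x. x) \<in> gen S \<Gamma>"
| gen_incl: "g \<in> \<Gamma> \<Longrightarrow> g \<in> gen S \<Gamma>"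
| gen_inv: "g \<in> \<Gamma> \<Longrightarrow> inv_into S g \<in> gen S \<Gamma>"
| gen_comp: "g \<in> gen S \<Gamma> \<Longrightarrow> h \<in> gen S \<Gamma> \<Longrightarrow> (\<lambda>x. g (h x)) \<in> gen S \<Gamma>"

lemma inv_into_image:
  assumes "aut_on S g" "X \<subseteq> S" "g ` X = X"
  shows "inv_into S g ` X = X"
  using inv_into_image_cancel[OF aut_onD(4)[OF assms(1)] assms(2)] assms(3) by simp

lemma aut_on_inv:
  assumes g: "aut_on S g"
  shows "aut_on S (inv_into S g)"
proof -
  note S = aut_onD(1)[OF g] and add = aut_onD(2)[OF g] and im = aut_onD(3)[OF g] and inj = aut_onD(4)[OF g]
  have "add_on S (inv_into S g)" unfolding add_on_def
  proof (intro ballI)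
    fix x y assume "x \<in> S" "y \<in> S"
    then have "x \<in> g ` S" "y \<in> g ` S" using im by simp_all
    then obtain u v where uv: "u \<in> S" "v \<in> S" "x = g u" "y = g v" by (elim imageE)
    then have "x + y = g (u + v)" "u + v \<in> S"
      using add_on_add[OF S add] Z.subspace_add[OF S] by auto
    then show "inv_into S g (x + y) = inv_into S g x + inv_into S g y"
      using inv_into_f_f[OF inj] uv by simp
  qed
  moreover have "bij_betw (inv_into S g) S S" using g by (simp add: aut_on_def bij_betw_inv_into)
  ultimately show ?thesis using S by (simp add: aut_on_def)
qed

lemma power_on_inv:
  assumes g: "aut_on S g" and C: "Z.subspace C" "C \<subseteq> S" and pow: "power_on C g"
    and tors: "\<And>c. c \<in> C \<Longrightarrow> \<exists>n. n \<noteq> 0 \<and> n *\<^sub>Z c = 0"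
  shows "power_on C (inv_into S g)"
  unfolding power_on_def
proof
  fix c assume c: "c \<in> C"
  then have sub: "Z.span {c} \<subseteq> C" using C(1) by (intro Z.span_minimal) auto
  have "finite (Z.span {c})" using finite_span1 tors[OF c] by blast
  moreover have "inj_on g (Z.span {c})" using aut_onD(4)[OF g] sub C(2) by (meson inj_on_subset subset_trans)
  ultimately have "g ` Z.span {c} = Z.span {c}"
    using power_on_subspace[OF pow Z.subspace_span sub] by (intro inj_on_finite_eq)
  moreover have "c \<in> Z.span {c}" by (simp add: Z.span_base)
  ultimately have "c \<in> g ` Z.span {c}" by simp
  then obtain d where d: "c = g d" "d \<in> Z.span {c}" by (rule imageE)
  then have "d \<in> S" using sub C(2) by blast
  then have "inv_into S g c = d" using inv_into_f_f[OF aut_onD(4)[OF g], of d] d(1) by simp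
  then show "inv_into S g c \<in> Z.span {c}" using d(2) by simp
qed

context
  fixes S :: "'u::ab_group_add set" and \<Gamma>
  assumes S: "Z.subspace S" and \<Gamma>: "\<And>g. g \<in> \<Gamma> \<Longrightarrow> aut_on S g"
begin

lemma gen_image:
  assumes X: "X \<subseteq> S" "\<And>g. g \<in> \<Gamma> \<Longrightarrow> g ` X = X" and g: "g \<in> gen S \<Gamma>"
  shows "g ` X = X"
  using g
proof induction
  case (gen_inv g)
  then show ?case using inv_into_image[OF \<Gamma> X(1)] X(2) by blast
next
  case (gen_comp g h)
  then show ?case by (metis image_image)
qed (use X in auto)

lemma gen_aut_on: "g \<in> gen S \<Gamma> \<Longrightarrow> aut_on S g"
proof (induction rule: gen.induct)
  case gen_one
  then show ?case using S by (auto simp: aut_on_def add_on_def bij_betw_def)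
next
  case (gen_inv g)
  then show ?case using aut_on_inv \<Gamma> by blast
next
  case (gen_comp g h)
  have "bij_betw (g \<circ> h) S S" using gen_comp.IH by (auto simp: aut_on_def intro: bij_betw_trans)
  moreover have "add_on S (g \<circ> h)"
    using aut_onD(2,3)[OF gen_comp.IH(1)] aut_onD(2,3)[OF gen_comp.IH(2)]
    unfolding add_on_def by (metis comp_apply imageI)
  ultimately show ?case using S by (simp add: aut_on_def comp_def)
qed (use \<Gamma> in auto)

lemma gen_power_on:
  assumes C: "Z.subspace C" "C \<subseteq> S" and tors: "\<And>c. c \<in> C \<Longrightarrow> \<exists>n. n \<noteq> 0 \<and> n *\<^sub>Z c = 0"
    and pow: "\<And>g. g \<in> \<Gamma> \<Longrightarrow> power_on C g" and g: "g \<in> gen S \<Gamma>"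
  shows "power_on C g"
  using g
proof induction
  case gen_one
  then show ?case by (auto simp: power_on_def intro: Z.span_base)
next
  case (gen_inv g)
  then show ?case using power_on_inv[OF \<Gamma> C _ tors] pow by blast
next
  case (gen_comp g h)
  show ?case unfolding power_on_def
  proof
    fix c assume c: "c \<in> C"
    then have "Z.span {c} \<subseteq> C" using C(1) by (intro Z.span_minimal) auto
    moreover have "h c \<in> Z.span {c}" using gen_comp.IH(2) c by (auto simp: power_on_def)
    ultimately show "g (h c) \<in> Z.span {c}"
      using power_on_subspace[OF gen_comp.IH(1), of "Z.span {c}"] by blast
  qed
qed (use pow in auto)

end

text \<open>
  If \<open>P = C + P[p\<^sup>k]\<close> with \<open>C\<close> unbounded, and \<open>g\<close> and \<open>h\<close> act by multipliers \<open>a\<close> and \<open>b\<close> on elements of \<open>C\<close> of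
  order at most \<open>p\<^sup>n\<close>, then agreement on \<open>P[p\<^sup>k]\<close> gives \<open>a \<equiv> b\<close> modulo \<open>p\<^sup>k\<close>. If \<open>t \<equiv> b/a\<close> modulo \<open>p\<^sup>n\<close>, then
  \<open>h = t g\<close> on these elements, and also on \<open>P[p\<^sup>k]\<close>, because \<open>t \<equiv> 1\<close> modulo \<open>p\<^sup>k\<close>.
\<close>

lemma gen_agree_power:
  assumes g: "aut_on P g" "power_on C g" and h: "add_on P h" "power_on C h"
    and p: "p_primary p P" and C: "Z.subspace C" "C \<subseteq> P"
    and split: "\<And>x. x \<in> P \<Longrightarrow> \<exists>c\<in>C. p ^ k *\<^sub>Z (x - c) = 0"
    and unb: "\<And>n. \<exists>c\<in>C. p ^ n *\<^sub>Z c \<noteq> 0"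
    and agree: "\<And>x. x \<in> P \<Longrightarrow> p ^ k *\<^sub>Z x = 0 \<Longrightarrow> g x = h x"
    and x: "x \<in> P"
  shows "h x \<in> Z.span {g x}"
proof -
  interpret p_primary p P by fact
  note addg = aut_onD(2)[OF g(1)] 
  note addCg = add_on_mono[OF addg C(2)] and addCh = add_on_mono[OF h(1) C(2)]
  obtain c where c: "c \<in> C" "p ^ k *\<^sub>Z (x - c) = 0" using split x by blast
  define e where "e = x - c"
  have cP: "c \<in> P" and e: "e \<in> P" "p ^ k *\<^sub>Z e = 0" "x = c + e"
    using c C(2) x Z.subspace_diff[OF subP] by (auto simp: e_def)
  obtain s where s: "p ^ s *\<^sub>Z c = 0" using tors cP by blast
  define n where "n = Suc (s + k)"
  have nc: "p ^ n *\<^sub>Z c = 0" by (rule power_zmul_eq_0_le[OF s]) (simp add: n_def)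
  have kn: "k \<le> n" by (simp add: n_def)
  obtain c0 where c0: "c0 \<in> C" "has_order (p ^ n) c0" using exact_order[OF C] unb by metis
  obtain a where a: "g c0 = a *\<^sub>Z c0" using g(2) c0(1) by (auto simp: power_on_def in_span1)
  obtain b where b: "h c0 = b *\<^sub>Z c0" using h(2) c0(1) by (auto simp: power_on_def in_span1)
  have gc: "g c = a *\<^sub>Z c" by (rule power_on_common[OF C(1) addCg g(2) c0 a c(1) order_refl nc])
  have hc: "h c = b *\<^sub>Z c" by (rule power_on_common[OF C(1) addCh h(2) c0 b c(1) order_refl nc])
  have c0P: "c0 \<in> P" using c0 C by blast
  have "\<not> p dvd a"
  proof
    assume "p dvd a"
    define y where "y = p ^ (s + k) *\<^sub>Z c0"
    have y: "y \<in> P" unfolding y_def using c0P Z.subspace_scale[OF subP] by blast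
    have "g y = (p ^ (s + k) * a) *\<^sub>Z c0" unfolding y_def using add_on_zmul[OF subP addg c0P] a by simp
    moreover have "p ^ n dvd p ^ (s + k) * a" using \<open>p dvd a\<close> by (simp add: n_def mult_dvd_mono mult.commute)
    ultimately have "g y = g 0" using c0(2) add_on_0[OF subP addg] by (simp add: has_order_def)
    then have "y = 0" using aut_onD(4)[OF g(1)] y Z.subspace_0[OF subP] by (meson inj_onD)
    then have "p ^ n dvd p ^ (s + k)" using c0(2) by (simp add: y_def has_order_def)
    then show False using p_pos prime_gt_1_int[OF p] by (simp add: n_def dvd_power_iff del: power_Suc)
  qed
  then obtain u v where uv: "u * a + v * p ^ n = 1" using prime_power_coprime[OF p] bezout_int[of a "p ^ n"] by (metis coprime_imp_gcd_eq_1)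
  have "p ^ k dvd a - b"
  proof -
    have "p ^ k *\<^sub>Z p ^ (n - k) *\<^sub>Z c0 = 0" using c0(2) kn by (simp add: has_order_def flip: power_add)
    then have "g (p ^ (n - k) *\<^sub>Z c0) = h (p ^ (n - k) *\<^sub>Z c0)"
      using agree c0P Z.subspace_scale[OF subP] by blast
    then have "p ^ (n - k) *\<^sub>Z (a *\<^sub>Z c0 - b *\<^sub>Z c0) = 0"
      using add_on_zmul[OF subP addg c0P] add_on_zmul[OF subP h(1) c0P] a b by (simp add: Z.scale_right_diff_distrib)
    then have "(p ^ (n - k) * (a - b)) *\<^sub>Z c0 = 0" by (simp flip: Z.scale_left_diff_distrib)
    then have "p ^ n dvd p ^ (n - k) * (a - b)" using c0(2) unfolding has_order_def by blast
    moreover have "p ^ n = p ^ (n - k) * p ^ k" using kn by (simp flip: power_add)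
    ultimately show ?thesis using p_pos by simp
  qed
  then have t: "p ^ k dvd u * b - 1"
  proof -
    have "u * b - 1 = - (u * (a - b)) - v * p ^ n" using uv by (simp add: algebra_simps)
    moreover have "p ^ k dvd p ^ n" using kn by (simp add: le_imp_power_dvd)
    ultimately show ?thesis using \<open>p ^ k dvd a - b\<close> by simp
  qed
  have "p ^ k *\<^sub>Z g e = 0" using add_on_zmul[OF subP addg e(1), of "p ^ k"] e(2) add_on_0[OF subP addg] by simp
  then have "(u * b - 1) *\<^sub>Z g e = 0" using zmul_dvd_mem[of "{0}" "p ^ k" "g e"] t by simp
  then have te: "(u * b) *\<^sub>Z g e = h e" using agree[OF e(1,2)] by (simp add: Z.scale_left_diff_distrib)
  have "u * a = 1 - v * p ^ n" using uv by simp
  then have "(u * a) *\<^sub>Z c = c" using nc by (simp add: Z.scale_left_diff_distrib flip: Z.scale_scale)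
  then have tc: "(u * b) *\<^sub>Z a *\<^sub>Z c = b *\<^sub>Z c" by (metis Z.scale_scale mult.assoc mult.commute)
  have "(u * b) *\<^sub>Z g x = h x"
    using te tc gc hc e(3) add_on_add[OF subP addg cP e(1)] add_on_add[OF subP h(1) cP e(1)]
    by (simp add: Z.scale_right_distrib)
  then show ?thesis by (metis in_span1)
qed

text \<open>Finitely many subgroups of finite index have an intersection of finite index.\<close>

lemma common_finite_index:
  assumes fin: "finite \<Gamma>" and P: "Z.subspace P"
    and ex: "\<And>g. g \<in> \<Gamma> \<Longrightarrow> \<exists>C. Z.subspace C \<and> C \<subseteq> P \<and> power_on C g \<and> fin_mod P C"
  obtains C where "Z.subspace C" "C \<subseteq> P" "fin_mod P C" "\<And>g. g \<in> \<Gamma> \<Longrightarrow> power_on C g"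
proof -
  obtain Cs where Cs: "\<And>g. g \<in> \<Gamma> \<Longrightarrow> Z.subspace (Cs g) \<and> Cs g \<subseteq> P \<and> power_on (Cs g) g \<and> fin_mod P (Cs g)"
    using ex by metis
  define C where "C = P \<inter> (\<Inter>g\<in>\<Gamma>. Cs g)"
  have "Z.subspace (\<Inter>g\<in>\<Gamma>. Cs g)" by (rule Z.subspace_Int) (use Cs in auto)
  then have "Z.subspace C" unfolding C_def using P Z.subspace_inter by blast
  moreover have "fin_many P (\<lambda>x y. \<forall>g\<in>\<Gamma>. x - y \<in> Cs g)"
    by (rule fin_many_Ball[OF fin]) (use Cs in auto)
  then have "fin_mod P C"
    by (rule fin_many_mono) (use Z.subspace_diff[OF P] in \<open>auto simp: C_def\<close>)
  moreover have "power_on C g" if "g \<in> \<Gamma>" for g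
    using Cs[OF that] that by (auto simp: C_def power_on_def)
  ultimately show ?thesis using that[of C] by (auto simp: C_def)
qed

context p_primary
begin

text \<open>
  All of \<open>\<Gamma>\<close> acts by multipliers on some \<open>C\<close> of finite index. Representatives of \<open>P/C\<close> and the values of
  all \<open>g - al g\<close> for \<open>g \<in> \<Gamma>\<close> generate a finite invariant subgroup \<open>E\<close> with \<open>P = C + E\<close>. An element of
  the generated group is determined on \<open>P\<close> by its restriction to \<open>E\<close> and its value at an element \<open>c0\<close> of
  maximal order in \<open>C\<close>.
\<close>

lemma bounded_finite_action:
  assumes fin: "finite \<Gamma>" and S: "Z.subspace S" "P \<subseteq> S"
    and \<Gamma>: "\<And>g. g \<in> \<Gamma> \<Longrightarrow> aut_on S g" "\<And>g. g \<in> \<Gamma> \<Longrightarrow> inert P g"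
    and bd: "\<And>x. x \<in> P \<Longrightarrow> p ^ k *\<^sub>Z x = 0"
  shows "fin_many (gen S \<Gamma>) (\<lambda>g h. \<forall>x\<in>P. g x = h x)"
proof -
  have "\<exists>C. Z.subspace C \<and> C \<subseteq> P \<and> power_on C g \<and> fin_mod P C" if g: "g \<in> \<Gamma>" for g
  proof -
    obtain C where C: "Z.subspace C" "C \<subseteq> P" "power_on C g" "fin_mod {x \<in> P. p *\<^sub>Z x \<in> C} C"
      using inert_power_socle[OF \<Gamma>(2)[OF g]] by blast
    then show ?thesis using fin_mod_bounded[OF C(1,4) bd] by blast
  qed
  then obtain C where C: "Z.subspace C" "C \<subseteq> P" "fin_mod P C" "\<And>g. g \<in> \<Gamma> \<Longrightarrow> power_on C g"
    using common_finite_index[OF fin subP] by blast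
  have gP: "g ` P = P" if "g \<in> \<Gamma>" for g using aut_onD(3)[OF inertD(1)[OF \<Gamma>(2)[OF that]]] .
  have genP: "add_on P g" "g ` P = P" "power_on C g" if "g \<in> gen S \<Gamma>" for g
  proof -
    show "add_on P g" using gen_aut_on[OF S(1) \<Gamma>(1) that] aut_onD(2) add_on_mono[OF _ S(2)] by blast
    show "g ` P = P" using gen_image[OF S(1) \<Gamma>(1) S(2) gP that] .
    show "power_on C g"
      by (rule gen_power_on[OF S(1) \<Gamma>(1) C(1) _ _ C(4) that]) (use C(2) S(2) tors_nonzero in auto)
  qed
  obtain n c0 where n: "\<And>c. c \<in> C \<Longrightarrow> p ^ n *\<^sub>Z c = 0" and c0: "c0 \<in> C" "has_order (p ^ n) c0"
  proof -
    define n where "n = (LEAST n. \<forall>c\<in>C. p ^ n *\<^sub>Z c = 0)"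
    have n: "\<forall>c\<in>C. p ^ n *\<^sub>Z c = 0" unfolding n_def by (rule LeastI[of _ k]) (use bd C(2) in auto)
    show ?thesis
    proof (cases n)
      case 0
      then show ?thesis using that[of n 0] n Z.subspace_0[OF C(1)] by (auto simp: has_order_def)
    next
      case (Suc m)
      then have "\<not> (\<forall>c\<in>C. p ^ m *\<^sub>Z c = 0)" 
        using not_less_Least[of m "\<lambda>n. \<forall>c\<in>C. p ^ n *\<^sub>Z c = 0"] by (simp add: n_def)
      then obtain c where c: "c \<in> C" "p ^ m *\<^sub>Z c \<noteq> 0" by blast
      obtain t where t: "t \<le> n" "has_order (p ^ t) c"
        using has_order_exists[OF p, of n c] n c(1) by blast
      have "\<not> p ^ t dvd p ^ m" using t(2) c(2) by (simp add: has_order_def)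
      then have "t = n" using t(1) Suc le_imp_power_dvd by (metis le_SucE)
      then show ?thesis using that[of n c] n c(1) t(2) by auto
    qed
  qed
  have onC: "g c = a *\<^sub>Z c" if "add_on P g" "power_on C g" "g c0 = a *\<^sub>Z c0" "c \<in> C" for g a c
    by (rule power_on_common[OF C(1) add_on_mono[OF that(1) C(2)] that(2) c0 that(3,4) order_refl n[OF that(4)]])
  obtain D where D: "finite D" "D \<subseteq> P" "\<And>x. x \<in> P \<Longrightarrow> \<exists>d\<in>D. d - x \<in> C"
    using C(3) by (rule fin_many_reps) blast
  have "\<exists>a. g c0 = a *\<^sub>Z c0" if "g \<in> \<Gamma>" for g
    using C(4)[OF that] c0(1) by (auto simp: power_on_def in_span1)
  then obtain al where al: "\<And>g. g \<in> \<Gamma> \<Longrightarrow> g c0 = al g *\<^sub>Z c0" by metis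
  define E where "E = Z.span (D \<union> (\<Union>g\<in>\<Gamma>. (\<lambda>d. g d - al g *\<^sub>Z d) ` D))"
  have subE: "D \<union> (\<Union>g\<in>\<Gamma>. (\<lambda>d. g d - al g *\<^sub>Z d) ` D) \<subseteq> P"
  proof -
    have "g d - al g *\<^sub>Z d \<in> P" if "g \<in> \<Gamma>" "d \<in> D" for g d
      using that gP D(2) Z.subspace_diff[OF subP] Z.subspace_scale[OF subP] by blast
    then show ?thesis using D(2) by blast
  qed
  have E: "Z.subspace E" "E \<subseteq> P" "finite E"
  proof -
    show "E \<subseteq> P" unfolding E_def by (rule Z.span_minimal[OF subE subP])
    show "finite E" unfolding E_def
      by (rule finite_span_finite[OF _ tors_nonzero[OF subsetD[OF subE]]]) (use fin D(1) in auto)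
  qed (simp add: E_def)
  have gE: "g ` E = E" if g: "g \<in> \<Gamma>" for g
  proof (rule inj_on_finite_eq[OF _ E(3)])
    have add: "add_on P g" using genP gen_incl g by blast
    show "inj_on g E" using aut_onD(4)[OF \<Gamma>(1)[OF g]] E(2) S(2) by (meson inj_on_subset subset_trans)
    show "g ` E \<subseteq> E"
    proof
      fix y assume "y \<in> g ` E"
      then obtain x where x: "x \<in> E" "y = g x" by blast
      then obtain d where d: "d \<in> D" "d - x \<in> C" using D(3) E(2) by blast
      have "x \<in> P" "d \<in> P" using x E(2) d D(2) by auto
      then have "g d - g x = al g *\<^sub>Z (d - x)"
        using onC[OF add C(4)[OF g] al[OF g] d(2)] add_on_diff[OF subP add] by simp
      then have "y = al g *\<^sub>Z x + (g d - al g *\<^sub>Z d)" using x by (simp add: Z.scale_right_diff_distrib algebra_simps)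
      moreover have "g d - al g *\<^sub>Z d \<in> E" unfolding E_def by (rule Z.span_base) (use g d(1) in blast)
      ultimately show "y \<in> E" using x(1) Z.subspace_add[OF E(1)] Z.subspace_scale[OF E(1)] by metis
    qed
  qed
  have c0fin: "finite (Z.span {c0})" using finite_span1 tors_nonzero c0(1) C(2) by blast
  show ?thesis
  proof (rule fin_manyI[of "\<lambda>g. (g c0, restrict g E)"])
    have mem: "(g c0, restrict g E) \<in> Z.span {c0} \<times> (E \<rightarrow>\<^sub>E E)" if g: "g \<in> gen S \<Gamma>" for g
    proof (rule SigmaI)
      show "g c0 \<in> Z.span {c0}" using genP(3)[OF g] c0(1) by (simp add: power_on_def)
      have "g ` E = E" using gen_image[OF S(1) \<Gamma>(1) _ gE g] E(2) S(2) by blast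
      then show "restrict g E \<in> E \<rightarrow>\<^sub>E E" by (intro restrict_PiE_iff[THEN iffD2] ballI) blast
    qed
    have "finite (Z.span {c0} \<times> (E \<rightarrow>\<^sub>E E))" using c0fin E(3) by (intro finite_cartesian_product finite_PiE)
    moreover have "(\<lambda>g. (g c0, restrict g E)) ` gen S \<Gamma> \<subseteq> Z.span {c0} \<times> (E \<rightarrow>\<^sub>E E)"
      using mem by (rule image_subsetI)
    ultimately show "finite ((\<lambda>g. (g c0, restrict g E)) ` gen S \<Gamma>)" by (rule finite_subset[rotated])
  next
    fix g h assume g: "g \<in> gen S \<Gamma>" and h: "h \<in> gen S \<Gamma>" and eq: "(g c0, restrict g E) = (h c0, restrict h E)"
    show "\<forall>x\<in>P. g x = h x"
    proof
      fix x assume x: "x \<in> P"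
      obtain d where d: "d \<in> D" "d - x \<in> C" using D(3) x by blast
      have "d \<in> E" unfolding E_def by (rule Z.span_base) (use d(1) in blast)
      then have "g d = h d" using eq by (metis prod.inject restrict_apply')
      obtain a where a: "g c0 = a *\<^sub>Z c0" using genP(3)[OF g] c0(1) by (auto simp: power_on_def in_span1)
      then have "h c0 = a *\<^sub>Z c0" using eq by simp
      then have "g (d - x) = h (d - x)"
        using onC[OF genP(1,3)[OF g] a d(2)] onC[OF genP(1,3)[OF h] _ d(2)] by simp
      moreover have dP: "d \<in> P" using d(1) D(2) by blast
      ultimately have "g d - g x = h d - h x"
        using add_on_diff[OF subP genP(1)[OF g] dP x] add_on_diff[OF subP genP(1)[OF h] dP x] by simp
      then show "g x = h x" using \<open>g d = h d\<close> by simp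
    qed
  qed
qed

text \<open>
  If \<open>P\<close> is unbounded then \<open>P = C + P[p\<^sup>k]\<close>, where \<open>C\<close> is the divisible part of \<open>P\<close> if this has a bounded
  quotient, and a subgroup of finite index otherwise.
\<close>

lemma primary_finite_action:
  assumes fin: "finite \<Gamma>" and S: "Z.subspace S" "P \<subseteq> S"
    and \<Gamma>: "\<And>g. g \<in> \<Gamma> \<Longrightarrow> aut_on S g" "\<And>g. g \<in> \<Gamma> \<Longrightarrow> inert P g"
  shows "fin_many (gen S \<Gamma>) (\<lambda>g h. \<forall>x\<in>P. h x \<in> Z.span {g x})"
proof (cases "\<exists>k. \<forall>x\<in>P. p ^ k *\<^sub>Z x = 0")
  case True
  then obtain k where "\<And>x. x \<in> P \<Longrightarrow> p ^ k *\<^sub>Z x = 0" by blast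
  from bounded_finite_action[OF fin S \<Gamma> this] show ?thesis
    by (rule fin_many_mono) (auto intro: Z.span_base)
next
  case unbP: False
  have gP: "g ` P = P" if "g \<in> \<Gamma>" for g using aut_onD(3)[OF inertD(1)[OF \<Gamma>(2)[OF that]]] .
  obtain C k where C: "Z.subspace C" "C \<subseteq> P" "\<And>g. g \<in> \<Gamma> \<Longrightarrow> power_on C g"
    and k: "\<And>x. x \<in> P \<Longrightarrow> \<exists>c\<in>C. p ^ k *\<^sub>Z (x - c) = 0"
  proof (cases "\<exists>k. \<forall>x\<in>P. p ^ k *\<^sub>Z x \<in> max_div")
    case True
    then obtain k where k: "\<And>x. x \<in> P \<Longrightarrow> p ^ k *\<^sub>Z x \<in> max_div" by blast
    have "\<exists>c\<in>max_div. p ^ k *\<^sub>Z (x - c) = 0" if "x \<in> P" for x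
      by (rule max_div_div[OF k[OF that], of k]) (auto simp: Z.scale_right_diff_distrib)
    then show ?thesis using that[of max_div k] subspace_max_div max_div_subset inert_power_max_div \<Gamma>(2) by blast
  next
    case False
    then have unb: "\<exists>x\<in>P. p ^ k *\<^sub>Z x \<notin> max_div" for k by blast
    have "\<exists>C. Z.subspace C \<and> C \<subseteq> P \<and> power_on C g \<and> fin_mod P C" if g: "g \<in> \<Gamma>" for g
      by (rule inert_power_finite_index[OF \<Gamma>(2)[OF g] unb]) blast
    then obtain C where C: "Z.subspace C" "C \<subseteq> P" "fin_mod P C" "\<And>g. g \<in> \<Gamma> \<Longrightarrow> power_on C g"
      using common_finite_index[OF fin subP] by blast
    obtain D where D: "finite D" "D \<subseteq> P" "\<And>x. x \<in> P \<Longrightarrow> \<exists>d\<in>D. d - x \<in> C"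
      using C(3) by (rule fin_many_reps) blast
    obtain t where t: "\<And>d. d \<in> D \<Longrightarrow> p ^ t *\<^sub>Z d = 0" using finite_bounded[OF D(1,2)] by blast
    have "\<exists>c\<in>C. p ^ t *\<^sub>Z (x - c) = 0" if x: "x \<in> P" for x
    proof -
      obtain d where d: "d \<in> D" "d - x \<in> C" using D(3) x by blast
      show ?thesis
        by (rule bexI[of _ "- (d - x)"]) (use t[OF d(1)] Z.subspace_neg[OF C(1) d(2)] in auto)
    qed
    then show ?thesis using that C(1,2,4) by blast
  qed
  have unb: "\<exists>c\<in>C. p ^ n *\<^sub>Z c \<noteq> 0" for n
  proof (rule ccontr)
    assume "\<not> ?thesis"
    then have n: "\<And>c. c \<in> C \<Longrightarrow> p ^ n *\<^sub>Z c = 0" by blast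
    have "p ^ (n + k) *\<^sub>Z x = 0" if x: "x \<in> P" for x
    proof -
      obtain c where c: "c \<in> C" "p ^ k *\<^sub>Z (x - c) = 0" using k x by blast
      have "p ^ (n + k) *\<^sub>Z x = p ^ (n + k) *\<^sub>Z (x - c) + p ^ (n + k) *\<^sub>Z c"
        by (simp add: Z.scale_right_diff_distrib)
      also have "\<dots> = 0" using power_zmul_eq_0_le[OF c(2), of "n + k"] power_zmul_eq_0_le[OF n[OF c(1)], of "n + k"] by simp
      finally show ?thesis .
    qed
    then show False using unbP by blast
  qed
  define K where "K = {x \<in> P. p ^ k *\<^sub>Z x = 0}"
  have K: "Z.subspace K" "K \<subseteq> P" unfolding K_def
    using add_on_subspace_vimage[OF subP, of "\<lambda>x. p ^ k *\<^sub>Z x" "{0}"] by (auto simp: add_on_def Z.scale_right_distrib)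
  interpret K: p_primary p K
    by unfold_locales (use p K tors in auto)
  have gK: "g ` K = K" if g: "g \<in> \<Gamma>" for g
  proof -
    note a = aut_onD[OF inertD(1)[OF \<Gamma>(2)[OF g]]]
    have eq: "p ^ k *\<^sub>Z g x = 0 \<longleftrightarrow> p ^ k *\<^sub>Z x = 0" if "x \<in> P" for x
    proof -
      have "p ^ k *\<^sub>Z g x = 0 \<longleftrightarrow> g (p ^ k *\<^sub>Z x) = g 0"
        using add_on_zmul[OF a(1,2) that] add_on_0[OF a(1,2)] by simp
      also have "\<dots> \<longleftrightarrow> p ^ k *\<^sub>Z x = 0"
        by (rule inj_on_eq_iff[OF a(4) Z.subspace_scale[OF subP that] Z.subspace_0[OF subP]])
      finally show ?thesis .
    qed
    show ?thesis
    proof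
      show "g ` K \<subseteq> K" using eq gP[OF g] by (auto simp: K_def)
      show "K \<subseteq> g ` K"
      proof
        fix y assume y: "y \<in> K"
        then obtain x where "x \<in> P" "y = g x" using gP[OF g] K(2) by blast
        then show "y \<in> g ` K" using y eq by (auto simp: K_def)
      qed
    qed
  qed
  have "fin_many (gen S \<Gamma>) (\<lambda>g h. \<forall>x\<in>K. g x = h x)"
    by (rule K.bounded_finite_action[OF fin S(1) _ \<Gamma>(1) inert_sub[OF \<Gamma>(2) K gK]])
      (use K(2) S(2) in \<open>auto simp: K_def\<close>)
  then show ?thesis
  proof (rule fin_many_mono)
    fix g h assume g: "g \<in> gen S \<Gamma>" and h: "h \<in> gen S \<Gamma>" and eq: "\<forall>x\<in>K. g x = h x"
    have pow: "power_on C g" if "g \<in> gen S \<Gamma>" for g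
      by (rule gen_power_on[OF S(1) \<Gamma>(1) C(1) _ _ C(3) that]) (use C(2) S(2) tors_nonzero in auto)
    have aut: "aut_on P g" if "g \<in> gen S \<Gamma>" for g
      using aut_on_sub[OF gen_aut_on[OF S(1) \<Gamma>(1) that] subP S(2) gen_image[OF S(1) \<Gamma>(1) S(2) gP that]] .
    show "\<forall>x\<in>P. h x \<in> Z.span {g x}"
    proof
      fix x assume x: "x \<in> P"
      show "h x \<in> Z.span {g x}"
        by (rule gen_agree_power[OF aut[OF g] pow[OF g] aut_onD(2)[OF aut[OF h]] pow[OF h] p_primary_axioms C(1,2) k unb _ x])
          (use eq in \<open>auto simp: K_def\<close>)
    qed
  qed simp
qed

end

section \<open>Torsion groups\<close>

text \<open>The torsion subgroup of \<open>S\<close>.\<close>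

definition tor :: "'u::ab_group_add set \<Rightarrow> 'u set" where
  "tor S = {x \<in> S. \<exists>n. n \<noteq> 0 \<and> n *\<^sub>Z x = 0}"

text \<open>The \<open>p\<close>-component of \<open>S\<close>.\<close>

definition prim :: "int \<Rightarrow> 'u::ab_group_add set \<Rightarrow> 'u set" where
  "prim p S = {x \<in> S. \<exists>n. p ^ n *\<^sub>Z x = 0}"

lemma subspace_tor:
  assumes S: "Z.subspace S"
  shows "Z.subspace (tor S)"
proof (rule Z.subspaceI)
  show "0 \<in> tor S" using Z.subspace_0[OF S] by (auto simp: tor_def intro!: exI[of _ 1])
next
  fix x y assume "x \<in> tor S" "y \<in> tor S"
  then obtain m n where mn: "x \<in> S" "y \<in> S" "m \<noteq> 0" "n \<noteq> 0" "m *\<^sub>Z x = 0" "n *\<^sub>Z y = 0"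
    by (auto simp: tor_def)
  have "(m * n) *\<^sub>Z (x + y) = n *\<^sub>Z m *\<^sub>Z x + m *\<^sub>Z n *\<^sub>Z y"
    by (simp add: Z.scale_right_distrib mult.commute)
  then have "(m * n) *\<^sub>Z (x + y) = 0" using mn by simp
  moreover have "m * n \<noteq> 0" using mn by simp
  ultimately show "x + y \<in> tor S" using mn Z.subspace_add[OF S] unfolding tor_def by blast
next
  fix k x assume "x \<in> tor S"
  then obtain m where m: "x \<in> S" "m \<noteq> 0" "m *\<^sub>Z x = 0" by (auto simp: tor_def)
  have "m *\<^sub>Z k *\<^sub>Z x = 0" using m(3) by (metis Z.scale_left_commute Z.scale_zero_right)
  then show "k *\<^sub>Z x \<in> tor S" using m Z.subspace_scale[OF S] unfolding tor_def by blast
qed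

lemma p_primary_prim:
  assumes S: "Z.subspace S" and p: "prime p"
  shows "p_primary p (prim p S)"
proof
  show "prime p" by fact
  show "Z.subspace (prim p S)"
  proof (rule Z.subspaceI)
    show "0 \<in> prim p S" using Z.subspace_0[OF S] by (auto simp: prim_def)
  next
    fix x y assume "x \<in> prim p S" "y \<in> prim p S"
    then obtain m n where mn: "x \<in> S" "y \<in> S" "p ^ m *\<^sub>Z x = 0" "p ^ n *\<^sub>Z y = 0"
      by (auto simp: prim_def)
    have "p ^ (m + n) *\<^sub>Z (x + y) = 0"
      using power_zmul_eq_0_le[OF mn(3), of "m + n"] power_zmul_eq_0_le[OF mn(4), of "m + n"]
      by (simp add: Z.scale_right_distrib)
    then show "x + y \<in> prim p S" using mn Z.subspace_add[OF S] unfolding prim_def by blast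
  next
    fix k x assume "x \<in> prim p S"
    then obtain m where m: "x \<in> S" "p ^ m *\<^sub>Z x = 0" by (auto simp: prim_def)
    have "p ^ m *\<^sub>Z k *\<^sub>Z x = 0" using m(2) by (metis Z.scale_left_commute Z.scale_zero_right)
    then show "k *\<^sub>Z x \<in> prim p S" using m Z.subspace_scale[OF S] unfolding prim_def by blast
  qed
qed (auto simp: prim_def)

lemma aut_on_zmul_eq_0:
  assumes "aut_on S g" "x \<in> S"
  shows "n *\<^sub>Z g x = 0 \<longleftrightarrow> n *\<^sub>Z x = 0"
proof -
  note a = aut_onD[OF assms(1)]
  have "n *\<^sub>Z g x = 0 \<longleftrightarrow> g (n *\<^sub>Z x) = g 0"
    using add_on_zmul[OF a(1,2) assms(2)] add_on_0[OF a(1,2)] by simp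
  also have "\<dots> \<longleftrightarrow> n *\<^sub>Z x = 0"
    by (rule inj_on_eq_iff[OF a(4) Z.subspace_scale[OF a(1) assms(2)] Z.subspace_0[OF a(1)]])
  finally show ?thesis .
qed

lemma aut_on_image_annihilated:
  assumes "aut_on S g"
  shows "g ` {x \<in> S. \<exists>n. Q n \<and> n *\<^sub>Z x = 0} = {x \<in> S. \<exists>n. Q n \<and> n *\<^sub>Z x = 0}" (is "g ` ?X = ?X")
proof
  show "g ` ?X \<subseteq> ?X"
  proof (rule image_subsetI)
    fix x assume x: "x \<in> ?X"
    then have "g x \<in> S" using aut_onD(3)[OF assms] by blast
    then show "g x \<in> ?X" using x aut_on_zmul_eq_0[OF assms] by simp
  qed
  show "?X \<subseteq> g ` ?X"
  proof
    fix y assume y: "y \<in> ?X"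
    then have "y \<in> g ` S" using aut_onD(3)[OF assms] by auto
    then obtain x where x: "y = g x" "x \<in> S" by (rule imageE)
    then have "x \<in> ?X" using y aut_on_zmul_eq_0[OF assms x(2)] by auto
    then show "y \<in> g ` ?X" using x(1) by blast
  qed
qed

lemma aut_on_tor: "aut_on S g \<Longrightarrow> g ` tor S = tor S"
  unfolding tor_def using aut_on_image_annihilated[of S g "\<lambda>n. n \<noteq> 0"] .

lemma aut_on_prim: "aut_on S g \<Longrightarrow> g ` prim p S = prim p S"
proof -
  assume a: "aut_on S g"
  have eq: "prim p S = {x \<in> S. \<exists>n. (\<exists>k. n = p ^ k) \<and> n *\<^sub>Z x = 0}" unfolding prim_def by blast
  show ?thesis unfolding eq using aut_on_image_annihilated[OF a, of "\<lambda>n. \<exists>k. n = p ^ k"] .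
qed

text \<open>
  Only those primes \<open>p\<close> are exceptional for which the finite subgroup of \<open>inert_torsion_escape\<close>
  contains a nonzero element of the \<open>p\<close>-component.
\<close>

lemma inert_power_almost_all_primes:
  assumes g: "inert S g"
  shows "finite {p. prime p \<and> \<not> power_on (prim p S) g}"
proof -
  have a: "aut_on S g" using inertD(1)[OF g] .
  note S = aut_onD(1)[OF a]
  have tS: "tor S \<subseteq> S" by (auto simp: tor_def)
  have gT: "inert (tor S) g" using inert_sub[OF g subspace_tor[OF S] tS aut_on_tor[OF a]] .
  have tt: "\<exists>n. n \<noteq> 0 \<and> n *\<^sub>Z x = 0" if "x \<in> tor S" for x
    using that by (simp add: tor_def)
  obtain F where F: "finite F" "Z.subspace F" "F \<subseteq> tor S"
    "\<And>x. x \<in> tor S \<Longrightarrow> Z.span {x, g x} \<inter> F \<subseteq> {0} \<Longrightarrow> g x \<in> Z.span {x}"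
    using inert_torsion_escape[OF gT tt] by blast
  have "\<exists>f. f \<in> F \<and> f \<noteq> 0 \<and> f \<in> prim p S" if pp: "prime p" "\<not> power_on (prim p S) g" for p
  proof -
    interpret p_primary p "prim p S" using p_primary_prim[OF S pp(1)] .
    obtain x where x: "x \<in> prim p S" "g x \<notin> Z.span {x}" using pp(2) by (auto simp: power_on_def)
    have "x \<in> tor S" using tors_nonzero[OF x(1)] x(1) by (simp add: tor_def prim_def)
    then have "\<not> Z.span {x, g x} \<inter> F \<subseteq> {0}" using F(4) x(2) by blast
    moreover have "g x \<in> prim p S" using imageI[OF x(1), of g] aut_on_prim[OF a, of p] by simp
    then have "Z.span {x, g x} \<subseteq> prim p S" using x(1) by (intro Z.span_minimal subP) auto
    ultimately show ?thesis by blast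
  qed
  then have "\<forall>p. \<exists>f. prime p \<and> \<not> power_on (prim p S) g \<longrightarrow> f \<in> F \<and> f \<noteq> 0 \<and> f \<in> prim p S"
    by blast
  from choice[OF this] obtain f where
    "\<forall>p. prime p \<and> \<not> power_on (prim p S) g \<longrightarrow> f p \<in> F \<and> f p \<noteq> 0 \<and> f p \<in> prim p S"
    by (rule exE)
  then have f: "f p \<in> F \<and> f p \<noteq> 0 \<and> f p \<in> prim p S" if "prime p" "\<not> power_on (prim p S) g" for p
    using that by simp
  have "inj_on f {p. prime p \<and> \<not> power_on (prim p S) g}"
  proof (rule inj_onI)
    fix p q assume "p \<in> {p. prime p \<and> \<not> power_on (prim p S) g}" "q \<in> {p. prime p \<and> \<not> power_on (prim p S) g}"
      and eq: "f p = f q"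
    then have pq: "prime p" "prime q" "f p \<noteq> 0" "f p \<in> prim p S" "f p \<in> prim q S"
      using f[of p] f[of q] eq by auto
    obtain m n where mn: "p ^ m *\<^sub>Z f p = 0" "q ^ n *\<^sub>Z f p = 0"
      using pq(4,5) unfolding prim_def by blast
    show "p = q"
    proof (rule ccontr)
      assume "p \<noteq> q"
      then have "coprime p q" by (rule primes_coprime[OF pq(1,2)])
      then have "coprime (p ^ m) (q ^ n)" by simp
      then have "f p \<in> {0}" using coprime_zmul_mem[of "{0}" "p ^ m" "f p" "q ^ n"] mn by simp
      then show False using pq(3) by simp
    qed
  qed
  moreover have "f ` {p. prime p \<and> \<not> power_on (prim p S) g} \<subseteq> F" using f by auto
  ultimately show ?thesis using F(1) by (rule inj_on_finite)
qed

text \<open>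
  The hypothesis on the \<open>p\<close>-components carries over to all torsion elements, because the primary
  components of \<open>x\<close> are multiples of \<open>x\<close>.
\<close>

lemma primary_generate:
  assumes S: "Z.subspace S" and g: "add_on S g" and h: "add_on S h"
    and pr: "\<And>p x. prime p \<Longrightarrow> x \<in> prim p S \<Longrightarrow> h x \<in> Z.span {g x}"
  shows "x \<in> S \<Longrightarrow> n *\<^sub>Z x = 0 \<Longrightarrow> n > 0 \<Longrightarrow> h x \<in> Z.span {g x}"
proof (induction "nat n" arbitrary: n x rule: less_induct)
  case less
  show ?case
  proof (cases "n = 1")
    case True
    then have "x = 0" using less.prems by simp
    then show ?thesis using add_on_0[OF S h] by (simp add: Z.span_zero)
  next
    case False
    then obtain p where p: "prime p" "p dvd n" using less.prems(3) prime_factor_int[of n] by auto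
    define k where "k = multiplicity p n"
    obtain m where m: "n = p ^ k * m" using multiplicity_dvd[of p n] unfolding k_def by (rule dvdE)
    have ppos: "p > 1" using prime_gt_1_int p(1) .
    have "\<not> p dvd n div p ^ k" unfolding k_def
      by (rule multiplicity_decompose) (use less.prems(3) ppos in auto)
    then have "\<not> p dvd m" using m ppos by simp
    then have cop: "coprime m (p ^ k)" using prime_power_coprime p(1) by blast
    obtain u v where uv: "u * m + v * p ^ k = 1" using bezout_int[of m "p ^ k"] cop by auto
    have "k > 0" using p(2) m \<open>\<not> p dvd m\<close> by (cases k) auto
    have mpos: "m > 0" using m less.prems(3) ppos by (simp add: zero_less_mult_iff)
    have "p ^ k > 1" using ppos \<open>k > 0\<close> by simp
    then have "m < n" using m mpos by simp
    have key: "h (a *\<^sub>Z x) \<in> Z.span {g x}" if ha: "h (a *\<^sub>Z x) \<in> Z.span {g (a *\<^sub>Z x)}" for a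
    proof -
      obtain b where "h (a *\<^sub>Z x) = b *\<^sub>Z g (a *\<^sub>Z x)" using ha by (auto simp: in_span1)
      then show ?thesis using add_on_zmul[OF S g less.prems(1)] by (auto simp: in_span1)
    qed
    have "(u * m) *\<^sub>Z x \<in> prim p S" unfolding prim_def
    proof (intro CollectI conjI exI)
      show "(u * m) *\<^sub>Z x \<in> S" using less.prems(1) Z.subspace_scale[OF S] by blast
      have "p ^ k *\<^sub>Z (u * m) *\<^sub>Z x = u *\<^sub>Z n *\<^sub>Z x" using m by (simp add: mult_ac)
      then show "p ^ k *\<^sub>Z (u * m) *\<^sub>Z x = 0" using less.prems(2) by simp
    qed
    then have 1: "h ((u * m) *\<^sub>Z x) \<in> Z.span {g x}" using pr p(1) key by blast
    have "m *\<^sub>Z (v * p ^ k) *\<^sub>Z x = v *\<^sub>Z n *\<^sub>Z x" using m by (simp add: mult_ac)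
    then have "m *\<^sub>Z (v * p ^ k) *\<^sub>Z x = 0" using less.prems(2) by simp
    then have 2: "h ((v * p ^ k) *\<^sub>Z x) \<in> Z.span {g x}"
      using less.hyps[of m "(v * p ^ k) *\<^sub>Z x"] mpos \<open>m < n\<close> less.prems(1) Z.subspace_scale[OF S] key
      by auto
    have "x = (u * m) *\<^sub>Z x + (v * p ^ k) *\<^sub>Z x" using uv by (simp flip: Z.scale_left_distrib)
    then have "h x = h ((u * m) *\<^sub>Z x) + h ((v * p ^ k) *\<^sub>Z x)"
      using add_on_add[OF S h] less.prems(1) Z.subspace_scale[OF S] by metis
    then show ?thesis using 1 2 Z.span_add by metis
  qed
qed

text \<open>
  Finitely many inertial automorphisms generate a group that induces only finitely many
  permutations on the set of cyclic subgroups of the torsion subgroup.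
\<close>

theorem torsion_finite_action:
  assumes fin: "finite \<Gamma>" and S: "Z.subspace S" and \<Gamma>: "\<And>g. g \<in> \<Gamma> \<Longrightarrow> inert S g"
  shows "fin_many (gen S \<Gamma>) (\<lambda>g h. \<forall>x\<in>tor S. h x \<in> Z.span {g x})"
proof -
  have aut: "aut_on S g" if "g \<in> \<Gamma>" for g using inertD(1)[OF \<Gamma>[OF that]] .
  define B where "B = (\<Union>g\<in>\<Gamma>. {p. prime p \<and> \<not> power_on (prim p S) g})"
  have "finite B" unfolding B_def using fin inert_power_almost_all_primes[OF \<Gamma>] by blast
  have "fin_many (gen S \<Gamma>) (\<lambda>g h. \<forall>x\<in>prim p S. h x \<in> Z.span {g x})" if p: "p \<in> B" for p
  proof -
    have "prime p" using p by (auto simp: B_def)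
    then interpret p_primary p "prim p S" using p_primary_prim[OF S] by blast
    have sub: "prim p S \<subseteq> S" by (auto simp: prim_def)
    show ?thesis
      by (rule primary_finite_action[OF fin S sub aut inert_sub[OF \<Gamma> subP sub aut_on_prim[OF aut]]])
  qed
  then have "fin_many (gen S \<Gamma>) (\<lambda>g h. \<forall>p\<in>B. \<forall>x\<in>prim p S. h x \<in> Z.span {g x})"
    by (rule fin_many_Ball[OF \<open>finite B\<close>])
  then show ?thesis
  proof (rule fin_many_mono)
    fix g h assume g: "g \<in> gen S \<Gamma>" and h: "h \<in> gen S \<Gamma>"
      and gh: "\<forall>p\<in>B. \<forall>x\<in>prim p S. h x \<in> Z.span {g x}"
    have ga: "aut_on S g" "aut_on S h" using gen_aut_on[OF S aut] g h by blast+
    have pr: "h x \<in> Z.span {g x}" if p: "prime p" and x: "x \<in> prim p S" for p x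
    proof (cases "p \<in> B")
      case True
      then show ?thesis using gh x by blast
    next
      case False
      interpret p_primary p "prim p S" using p_primary_prim[OF S p] .
      have sub: "prim p S \<subseteq> S" by (auto simp: prim_def)
      have pow: "power_on (prim p S) k" if "k \<in> gen S \<Gamma>" for k
      proof (rule gen_power_on[OF S aut subP sub tors_nonzero _ that])
        show "power_on (prim p S) \<gamma>" if "\<gamma> \<in> \<Gamma>" for \<gamma> using False p that by (auto simp: B_def)
      qed
      have xs: "Z.span {x} \<subseteq> prim p S" using x by (intro Z.span_minimal subP) auto
      have "finite (Z.span {x})" using finite_span1 tors_nonzero[OF x] by blast
      moreover have "g ` Z.span {x} \<subseteq> Z.span {x}"
        by (rule power_on_subspace[OF pow[OF g] Z.subspace_span xs])
      moreover have "inj_on g (Z.span {x})" by (rule inj_on_subset[OF aut_onD(4)[OF ga(1)]]) (use xs sub in blast)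
      ultimately have "g ` Z.span {x} = Z.span {x}" by (intro inj_on_finite_eq)
      moreover have "h x \<in> Z.span {x}" using pow[OF h] x by (auto simp: power_on_def)
      ultimately have "h x \<in> g ` Z.span {x}" by simp
      then obtain k where "h x = g (k *\<^sub>Z x)" by (auto simp: in_span1)
      then have "h x = k *\<^sub>Z g x" using add_on_zmul[OF aut_onD(1,2)[OF ga(1)]] x sub by auto
      then show ?thesis by (auto simp: in_span1)
    qed
    show "\<forall>x\<in>tor S. h x \<in> Z.span {g x}"
    proof
      fix x assume "x \<in> tor S"
      then obtain n where n: "x \<in> S" "n \<noteq> 0" "n *\<^sub>Z x = 0" by (auto simp: tor_def)
      have "\<bar>n\<bar> *\<^sub>Z x = 0" "\<bar>n\<bar> > 0" using n by (cases "n \<ge> 0"; simp)+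
      then show "h x \<in> Z.span {g x}"
        by (intro primary_generate[OF S aut_onD(2)[OF ga(1)] aut_onD(2)[OF ga(2)] _ n(1)]) (rule pr)
    qed
  qed simp
qed

section \<open>Embedding an abelian group into a power of the circle group\<close>

text \<open>
  The circle group \<open>\<real>/\<int>\<close>, written additively. Characters into it embed every abelian group with
  carrier in \<open>'a\<close> into the type \<open>('a \<Rightarrow> circle) \<Rightarrow> circle\<close>, which belongs to the class \<open>ab_group_add\<close>. This
  makes the previous sections applicable to groups that are given by a carrier set.
\<close>

quotient_type circle = real / "\<lambda>x y. x - y \<in> \<int>" morphisms rep_circle circle_of
proof (rule equivpI)
  show "reflp (\<lambda>x y :: real. x - y \<in> \<int>)" by (simp add: reflp_def)
  show "symp (\<lambda>x y :: real. x - y \<in> \<int>)"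
    by (rule sympI) (metis Ints_minus minus_diff_eq)
  show "transp (\<lambda>x y :: real. x - y \<in> \<int>)"
    by (rule transpI) (metis Ints_add diff_add_cancel add_diff_eq)
qed

instantiation circle :: ab_group_add
begin

lift_definition zero_circle :: circle is 0 .
lift_definition plus_circle :: "circle \<Rightarrow> circle \<Rightarrow> circle" is "(+)"
  by (metis Ints_add add_diff_add)
lift_definition minus_circle :: "circle \<Rightarrow> circle \<Rightarrow> circle" is "(-)"
  by (metis Ints_diff diff_diff_eq2 diff_diff_eq add_diff_eq diff_add_eq)
lift_definition uminus_circle :: "circle \<Rightarrow> circle" is uminus
  by (metis Ints_minus minus_diff_minus)

instance
proof
  fix a b c :: circle
  show "a + b + c = a + (b + c)" by transfer (simp add: algebra_simps)
  show "a + b = b + a" by transfer simp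
  show "0 + a = a" by transfer simp
  show "- a + a = 0" by transfer simp
  show "a - b = a + - b" by transfer simp
qed

end

lemma circle_of_zmul: "circle_of (of_int k * x) = k *\<^sub>Z circle_of x"
proof (induction k rule: int_induct[where k = 0])
  case base
  show ?case by (simp add: zmul_0 zero_circle.abs_eq)
next
  case (step1 i)
  have "circle_of (of_int (i + 1) * x) = circle_of (of_int i * x) + circle_of x"
    by (simp add: plus_circle.abs_eq algebra_simps)
  then show ?case using step1 by (simp add: zmul_succ)
next
  case (step2 i)
  have "circle_of (of_int (i - 1) * x) + circle_of x = circle_of (of_int i * x)"
    by (simp add: plus_circle.abs_eq algebra_simps)
  then show ?case using step2 zmul_succ[of "i - 1" "circle_of x"] by (simp add: algebra_simps)
qed

lemma circle_of_eq_0: "circle_of x = 0 \<longleftrightarrow> x \<in> \<int>"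
  unfolding zero_circle_def circle.abs_eq_iff by simp

lemma circle_divisible:
  assumes "n \<noteq> 0"
  obtains d :: circle where "n *\<^sub>Z d = c"
proof -
  obtain x where x: "c = circle_of x" by (metis Quotient_abs_rep Quotient_circle)
  have "n *\<^sub>Z circle_of (x / of_int n) = circle_of (of_int n * (x / of_int n))"
    by (simp only: circle_of_zmul)
  also have "\<dots> = c" using assms x by simp
  finally show ?thesis using that by blast
qed

lemma int_subgroup_principal:
  assumes Q0: "Q (0 :: int)" and Qd: "\<And>k l. Q k \<Longrightarrow> Q l \<Longrightarrow> Q (k - l)"
  obtains n where "n \<ge> 0" "\<And>k. Q k \<longleftrightarrow> n dvd k"
proof (cases "\<exists>n > 0. Q n")
  case False
  have "Q k \<longleftrightarrow> 0 dvd k" for k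
  proof -
    have "\<not> k > 0" "\<not> k < 0" if "Q k" using that False Qd[OF Q0 that] by auto
    then show ?thesis using Q0 by force
  qed
  then show ?thesis using that[of 0] by simp
next
  case True
  define n where "n = (LEAST n. n > 0 \<and> Q (int n))"
  obtain m where "m > 0" "Q m" using True by blast
  then have "nat m > 0 \<and> Q (int (nat m))" by simp
  then have n: "n > 0 \<and> Q (int n)" unfolding n_def by (rule LeastI)
  have least: "n \<le> k" if "k > 0" "Q (int k)" for k
    unfolding n_def using that by (intro Least_le) blast
  have Qneg: "Q (- k)" if "Q k" for k using Qd[OF Q0 that] by simp
  have Qadd: "Q (k + l)" if "Q k" "Q l" for k l using Qd[OF that(1) Qneg[OF that(2)]] by simp
  have mult: "Q (int n * q)" for q
  proof (induction q rule: int_induct[where k = 0])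
    case base
    show ?case using Q0 by simp
  next
    case (step1 i)
    then show ?case using Qadd[OF step1(2) conjunct2[OF n]] by (simp add: distrib_left)
  next
    case (step2 i)
    then show ?case using Qd[OF step2(2) conjunct2[OF n]] by (simp add: right_diff_distrib)
  qed
  have "Q k \<longleftrightarrow> int n dvd k" for k
  proof
    assume "Q k"
    then have "Q (k - int n * (k div int n))" using Qd mult by blast
    then have "Q (k mod int n)" by (simp add: minus_mult_div_eq_mod)
    then have "Q (int (nat (k mod int n)))" using n by simp
    moreover have "nat (k mod int n) < n" using n by (simp add: nat_less_iff)
    ultimately have "nat (k mod int n) = 0" using least by (meson not_gr_zero not_le)
    then have "k mod int n = 0" using pos_mod_sign[of "int n" k] n by linarith
    then show "int n dvd k" by presburger
  next
    assume "int n dvd k"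
    then show "Q k" using mult by (auto elim: dvdE)
  qed
  then show ?thesis using that[of "int n"] by simp
qed

text \<open>The graph of a homomorphism from a subgroup of \<open>A\<close> to the circle group.\<close>

definition partial_char :: "('a, 'b) monoid_scheme \<Rightarrow> ('a \<times> circle) set \<Rightarrow> bool" where
  "partial_char A R \<longleftrightarrow> R \<subseteq> carrier A \<times> UNIV \<and> (\<one>\<^bsub>A\<^esub>, 0) \<in> R \<and>
     (\<forall>x c y d. (x, c) \<in> R \<longrightarrow> (y, d) \<in> R \<longrightarrow> (x \<otimes>\<^bsub>A\<^esub> y, c + d) \<in> R) \<and>
     (\<forall>x c. (x, c) \<in> R \<longrightarrow> (inv\<^bsub>A\<^esub> x, - c) \<in> R) \<and>
     (\<forall>c. (\<one>\<^bsub>A\<^esub>, c) \<in> R \<longrightarrow> c = 0)"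

context comm_group
begin

text \<open>
  The value \<open>v\<close> at \<open>y\<close> has to satisfy \<open>n v = c\<^sub>0\<close>, where \<open>y\<^sup>n\<close> generates the intersection of the domain
  with \<open>\<langle>y\<rangle>\<close> and \<open>c\<^sub>0\<close> is its image. This is possible because the circle group is divisible.
\<close>

lemma partial_char_extend:
  assumes R: "partial_char G R" and y: "y \<in> carrier G"
  obtains v where "partial_char G {(x \<otimes> y [^] (k::int), c + k *\<^sub>Z v) | x c k. (x, c) \<in> R}"
proof -
  have sub: "(x, c) \<in> R \<Longrightarrow> x \<in> carrier G" and R1: "(\<one>, 0) \<in> R"
    and Rm: "(x, c) \<in> R \<Longrightarrow> (z, d) \<in> R \<Longrightarrow> (x \<otimes> z, c + d) \<in> R"
    and Ri: "(x, c) \<in> R \<Longrightarrow> (inv x, - c) \<in> R" and Rf: "(\<one>, c) \<in> R \<Longrightarrow> c = 0" for x c z d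
    using R unfolding partial_char_def by blast+
  have Rpow: "(x [^] (k::int), k *\<^sub>Z c) \<in> R" if xc: "(x, c) \<in> R" for x c k
  proof (induction k rule: int_induct[where k = 0])
    case base
    show ?case using R1 by (simp add: zmul_0)
  next
    case (step1 i)
    then show ?case using Rm[OF step1(2) xc] sub[OF xc] by (simp add: int_pow_mult zmul_succ)
  next
    case (step2 i)
    have "x [^] (i - 1) = x [^] i \<otimes> inv x" using int_pow_mult[OF sub[OF xc], of i "-1"] sub[OF xc]
      by (simp add: int_pow_neg)
    moreover have "(i - 1) *\<^sub>Z c = i *\<^sub>Z c + - c" by (simp add: Z.scale_left_diff_distrib)
    ultimately show ?case using Rm[OF step2(2) Ri[OF xc]] by simp
  qed
  have Runiq: "c = d" if "(x, c) \<in> R" "(x, d) \<in> R" for x c d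
    using Rf[of "c + - d"] Rm[OF that(1) Ri[OF that(2)]] sub[OF that(1)] by simp
  have "\<exists>v. \<forall>(k::int) c. (y [^] k, c) \<in> R \<longrightarrow> c = k *\<^sub>Z v"
  proof -
    have diff: "\<exists>c. (y [^] (k - l), c) \<in> R" if "\<exists>c. (y [^] k, c) \<in> R" "\<exists>c. (y [^] l, c) \<in> R" for k l :: int
      using that Rm Ri int_pow_diff[OF y, of k l] by metis
    have "\<exists>c. (y [^] (0::int), c) \<in> R" using R1 by auto
    then obtain n :: int where n: "n \<ge> 0" "\<And>k. (\<exists>c. (y [^] k, c) \<in> R) \<longleftrightarrow> n dvd k"
      using int_subgroup_principal[of "\<lambda>k. \<exists>c. (y [^] k, c) \<in> R"] diff by blast
    obtain c0 where c0: "(y [^] n, c0) \<in> R" using n(2)[of n] by auto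
    obtain v where v: "n *\<^sub>Z v = c0"
    proof (cases "n = 0")
      case True
      then show ?thesis using that[of 0] c0 Rf by simp
    next
      case False
      then show ?thesis using circle_divisible that by blast
    qed
    have "c = k *\<^sub>Z v" if k: "(y [^] k, c) \<in> R" for k :: int and c
    proof -
      have "n dvd k" using n(2) k by blast
      then obtain q where q: "k = n * q" by (rule dvdE)
      then have "(y [^] k, q *\<^sub>Z c0) \<in> R" using Rpow[OF c0, of q] y by (simp add: int_pow_pow)
      then have "c = q *\<^sub>Z n *\<^sub>Z v" using Runiq k v by blast
      then show ?thesis using q by (simp add: mult.commute)
    qed
    then show ?thesis by blast
  qed
  then obtain v where v: "\<And>(k::int) c. (y [^] k, c) \<in> R \<Longrightarrow> c = k *\<^sub>Z v" by blast
  have "partial_char G {(x \<otimes> y [^] (k::int), c + k *\<^sub>Z v) | x c k. (x, c) \<in> R}" (is "partial_char G ?E")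
    unfolding partial_char_def
  proof (intro conjI allI impI)
    show "?E \<subseteq> carrier G \<times> UNIV" using sub y by auto
    have "(\<one> \<otimes> y [^] (0::int), 0 + 0 *\<^sub>Z v) \<in> ?E" using R1 by blast
    then show "(\<one>, 0) \<in> ?E" by (simp add: zmul_0)
  next
    fix x c z d assume "(x, c) \<in> ?E" "(z, d) \<in> ?E"
    then obtain x' c' k z' d' l where *: "(x', c') \<in> R" "(z', d') \<in> R"
      "x = x' \<otimes> y [^] (k::int)" "c = c' + k *\<^sub>Z v" "z = z' \<otimes> y [^] (l::int)" "d = d' + l *\<^sub>Z v" by blast
    have "x \<otimes> z = (x' \<otimes> z') \<otimes> y [^] (k + l)"
      using * sub[OF *(1)] sub[OF *(2)] y by (simp add: int_pow_mult m_ac)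
    moreover have "c + d = (c' + d') + (k + l) *\<^sub>Z v" using * by (simp add: Z.scale_left_distrib)
    ultimately show "(x \<otimes> z, c + d) \<in> ?E" using Rm[OF *(1,2)] by blast
  next
    fix x c assume "(x, c) \<in> ?E"
    then obtain x' c' k where *: "(x', c') \<in> R" "x = x' \<otimes> y [^] (k::int)" "c = c' + k *\<^sub>Z v" by blast
    have "inv x = inv x' \<otimes> y [^] (- k)" using * sub[OF *(1)] y by (simp add: inv_mult int_pow_neg)
    moreover have "- c = - c' + (- k) *\<^sub>Z v" using * by simp
    ultimately show "(inv x, - c) \<in> ?E" using Ri[OF *(1)] by blast
  next
    fix c assume "(\<one>, c) \<in> ?E"
    then obtain x' c' k where *: "(x', c') \<in> R" "\<one> = x' \<otimes> y [^] (k::int)" "c = c' + k *\<^sub>Z v" by blast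
    have "y [^] k = inv x'" using * sub[OF *(1)] y by (metis int_pow_closed inv_equality inv_inv m_comm)
    then have "- c' = k *\<^sub>Z v" using v Ri[OF *(1)] by metis
    then show "c = 0" using *(3) by (metis add.right_inverse)
  qed
  then show ?thesis by (rule that)
qed

lemma separating_character:
  assumes x: "x \<in> carrier G" "x \<noteq> \<one>"
  obtains \<chi> :: "'a \<Rightarrow> circle" where "\<And>y z. y \<in> carrier G \<Longrightarrow> z \<in> carrier G \<Longrightarrow> \<chi> (y \<otimes> z) = \<chi> y + \<chi> z" "\<chi> x \<noteq> 0"
proof -
  have triv: "partial_char G {(\<one>, 0)}" by (auto simp: partial_char_def)
  have "\<exists>R r. partial_char G R \<and> (x, r) \<in> R \<and> r \<noteq> 0"
  proof -
    have "\<exists>r :: circle. r \<noteq> 0 \<and> (\<forall>k::int. x [^] k = \<one> \<longrightarrow> k *\<^sub>Z r = 0)"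
    proof -
      have "x [^] (k - l) = \<one>" if "x [^] k = \<one>" "x [^] l = \<one>" for k l :: int
        using that int_pow_diff[OF x(1), of k l] by simp
      then obtain n :: int where n: "n \<ge> 0" "\<And>k. x [^] k = \<one> \<longleftrightarrow> n dvd k"
        using int_subgroup_principal[of "\<lambda>k. x [^] k = \<one>"] by (metis int_pow_0)
      \<comment> \<open>an element of infinite order may be sent to any nonzero element, here to one of order two\<close>
      define m where "m = (if n = 0 then 2 else n)"
      have "n \<noteq> 1" using n(2)[of 1] x by auto
      then have m: "m > 1" using n(1) by (simp add: m_def)
      have nz: "circle_of (1 / of_int m) \<noteq> 0"
      proof
        assume "circle_of (1 / of_int m) = 0"
        then obtain l :: int where "1 / of_int m = (of_int l :: real)" using circle_of_eq_0 by (auto elim: Ints_cases)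
        then have "of_int (m * l) = (1 :: real)" using m by (simp add: field_simps)
        then have "m * l = 1" by linarith
        then show False using m by (simp add: zmult_eq_1_iff)
      qed
      have kz: "k *\<^sub>Z circle_of (1 / of_int m) = 0" if k: "x [^] k = \<one>" for k :: int
      proof -
        have "m dvd k" using k n(2)[of k] by (auto simp: m_def)
        then obtain l where "k = m * l" by (rule dvdE)
        then have "of_int k * (1 / of_int m) = (of_int l :: real)" using m by simp
        then have "circle_of (of_int k * (1 / of_int m)) = 0" by (simp only: circle_of_eq_0 Ints_of_int)
        then show ?thesis by (simp only: circle_of_zmul)
      qed
      show ?thesis by (intro exI[of _ "circle_of (1 / of_int m)"] conjI allI impI nz kz)
    qed
    then obtain r :: circle where r: "r \<noteq> 0" "\<And>k::int. x [^] k = \<one> \<Longrightarrow> k *\<^sub>Z r = 0" by blast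
    have "partial_char G {(x [^] k, k *\<^sub>Z r) | k :: int. True}" (is "partial_char G ?E")
      unfolding partial_char_def
    proof (intro conjI allI impI)
      show "?E \<subseteq> carrier G \<times> UNIV" using x by auto
      have "(x [^] (0::int), 0 *\<^sub>Z r) \<in> ?E" by blast
      then show "(\<one>, 0) \<in> ?E" by (simp add: zmul_0)
    next
      fix a c b d assume "(a, c) \<in> ?E" "(b, d) \<in> ?E"
      then obtain k l :: int where "a = x [^] k" "c = k *\<^sub>Z r" "b = x [^] l" "d = l *\<^sub>Z r" by blast
      then have "a \<otimes> b = x [^] (k + l)" "c + d = (k + l) *\<^sub>Z r" using x by (simp_all add: int_pow_mult zmul_add)
      then show "(a \<otimes> b, c + d) \<in> ?E" by blast
    next
      fix a c assume "(a, c) \<in> ?E"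
      then obtain k :: int where "a = x [^] k" "c = k *\<^sub>Z r" by blast
      then have "inv a = x [^] (- k)" "- c = (- k) *\<^sub>Z r" using x by (simp_all add: int_pow_neg)
      then show "(inv a, - c) \<in> ?E" by blast
    next
      fix c assume "(\<one>, c) \<in> ?E"
      then show "c = 0" using r(2) by auto
    qed
    moreover have "(x [^] (1::int), 1 *\<^sub>Z r) \<in> ?E" by blast
    then have "(x, r) \<in> ?E" using x by (simp add: zmul_1)
    ultimately show ?thesis using r(1) by blast
  qed
  then obtain R0 r where R0: "partial_char G R0" "(x, r) \<in> R0" "r \<noteq> 0" by blast
  define \<A> where "\<A> = {R. partial_char G R \<and> (x, r) \<in> R}"
  have ch: "\<Union>\<C> \<in> \<A>" if \<C>: "\<C> \<noteq> {}" "subset.chain \<A> \<C>" for \<C>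
  proof -
    have pc: "partial_char G X" "(x, r) \<in> X" if "X \<in> \<C>" for X
      using \<C>(2) that by (auto simp: subset.chain_def \<A>_def)
    have "partial_char G (\<Union>\<C>)" unfolding partial_char_def
    proof (intro conjI allI impI)
      show "\<Union>\<C> \<subseteq> carrier G \<times> UNIV" using pc(1) unfolding partial_char_def by blast
      show "(\<one>, 0) \<in> \<Union>\<C>" using pc(1) \<C>(1) unfolding partial_char_def by blast
    next
      fix a c b d assume "(a, c) \<in> \<Union>\<C>" "(b, d) \<in> \<Union>\<C>"
      then obtain X Y where XY: "X \<in> \<C>" "(a, c) \<in> X" "Y \<in> \<C>" "(b, d) \<in> Y" by blast
      have "X \<subseteq> Y \<or> Y \<subseteq> X" using \<C>(2) XY by (auto simp: subset.chain_def)
      then obtain Z where "Z \<in> \<C>" "(a, c) \<in> Z" "(b, d) \<in> Z" using XY by blast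
      then show "(a \<otimes> b, c + d) \<in> \<Union>\<C>" using pc(1) unfolding partial_char_def by blast
    next
      fix a c assume "(a, c) \<in> \<Union>\<C>"
      then show "(inv a, - c) \<in> \<Union>\<C>" using pc(1) unfolding partial_char_def by blast
    next
      fix c assume "(\<one>, c) \<in> \<Union>\<C>"
      then show "c = 0" using pc(1) unfolding partial_char_def by blast
    qed
    then show ?thesis using pc(2) \<C>(1) by (auto simp: \<A>_def)
  qed
  have "\<A> \<noteq> {}" using R0 by (auto simp: \<A>_def)
  from subset_Zorn_nonempty[OF this ch] obtain R where R: "R \<in> \<A>" "\<And>X. X \<in> \<A> \<Longrightarrow> R \<subseteq> X \<Longrightarrow> X = R"
    by blast
  have pR: "partial_char G R" and xR: "(x, r) \<in> R" using R(1) by (auto simp: \<A>_def)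
  have R1: "(\<one>, 0) \<in> R" and Rm: "(a, c) \<in> R \<Longrightarrow> (b, d) \<in> R \<Longrightarrow> (a \<otimes> b, c + d) \<in> R"
    and Ri: "(a, c) \<in> R \<Longrightarrow> (inv a, - c) \<in> R" and Rf: "(\<one>, c) \<in> R \<Longrightarrow> c = 0"
    and sub: "(a, c) \<in> R \<Longrightarrow> a \<in> carrier G" for a b c d
    using pR unfolding partial_char_def by blast+
  have total: "\<exists>c. (y, c) \<in> R" if y: "y \<in> carrier G" for y
  proof -
    obtain v where v: "partial_char G {(a \<otimes> y [^] (k::int), c + k *\<^sub>Z v) | a c k. (a, c) \<in> R}" (is "partial_char G ?E")
      using partial_char_extend[OF pR y] by blast
    have "R \<subseteq> ?E"
    proof (rule subrelI)
      fix a c assume ac: "(a, c) \<in> R"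
      then have "(a \<otimes> y [^] (0::int), c + 0 *\<^sub>Z v) \<in> ?E" by blast
      then show "(a, c) \<in> ?E" using sub[OF ac] by (simp add: zmul_0)
    qed
    moreover from this have "?E \<in> \<A>" using v xR unfolding \<A>_def by blast
    ultimately have "?E = R" using R(2) by blast
    moreover have "(\<one> \<otimes> y [^] (1::int), 0 + 1 *\<^sub>Z v) \<in> ?E" using R1 by blast
    ultimately have "(\<one> \<otimes> y [^] (1::int), 0 + 1 *\<^sub>Z v) \<in> R" by (simp only:)
    moreover have "\<one> \<otimes> y [^] (1::int) = y" using y by simp
    ultimately show ?thesis by (simp only:) blast
  qed
  have uniq: "c = d" if "(a, c) \<in> R" "(a, d) \<in> R" for a c d
    using Rf[of "c + - d"] Rm[OF that(1) Ri[OF that(2)]] sub[OF that(1)] by simp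
  define \<chi> where "\<chi> y = (THE c. (y, c) \<in> R)" for y
  have \<chi>: "\<chi> y = c" if "(y, c) \<in> R" for y c
    unfolding \<chi>_def using that uniq by blast
  show ?thesis
  proof (rule that[of \<chi>])
    fix y z assume "y \<in> carrier G" "z \<in> carrier G"
    then obtain c d where "(y, c) \<in> R" "(z, d) \<in> R" using total by blast
    then show "\<chi> (y \<otimes> z) = \<chi> y + \<chi> z" using Rm \<chi> by metis
  next
    show "\<chi> x \<noteq> 0" using \<chi>[OF xR] R0(3) by simp
  qed
qed

lemma embedding:
  obtains e :: "'a \<Rightarrow> ('a \<Rightarrow> circle) \<Rightarrow> circle" where "inj_on e (carrier G)"
    "\<And>x y. x \<in> carrier G \<Longrightarrow> y \<in> carrier G \<Longrightarrow> e (x \<otimes> y) = e x + e y"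
proof -
  define e :: "'a \<Rightarrow> ('a \<Rightarrow> circle) \<Rightarrow> circle" where
    "e x \<chi> = (if \<forall>y\<in>carrier G. \<forall>z\<in>carrier G. \<chi> (y \<otimes> z) = \<chi> y + \<chi> z then \<chi> x else 0)" for x \<chi>
  have hom: "e (x \<otimes> y) = e x + e y" if "x \<in> carrier G" "y \<in> carrier G" for x y
  proof
    fix \<chi> :: "'a \<Rightarrow> circle"
    show "e (x \<otimes> y) \<chi> = (e x + e y) \<chi>"
    proof (cases "\<forall>y\<in>carrier G. \<forall>z\<in>carrier G. \<chi> (y \<otimes> z) = \<chi> y + \<chi> z")
      case True
      then have "e z \<chi> = \<chi> z" for z by (simp add: e_def)
      moreover have "\<chi> (x \<otimes> y) = \<chi> x + \<chi> y" using True that by blast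
      ultimately show ?thesis by simp
    next
      case False
      then have "e z \<chi> = 0" for z unfolding e_def by (rule if_not_P)
      then show ?thesis by simp
    qed
  qed
  have inj: "x = y" if xy: "x \<in> carrier G" "y \<in> carrier G" "e x = e y" for x y
  proof (rule ccontr)
    assume "x \<noteq> y"
    then have nz: "x \<otimes> inv y \<noteq> \<one>" using xy by (metis inv_closed inv_equality inv_inv)
    have zc: "x \<otimes> inv y \<in> carrier G" using xy by simp
    obtain \<chi> :: "'a \<Rightarrow> circle" where \<chi>: "\<And>y z. y \<in> carrier G \<Longrightarrow> z \<in> carrier G \<Longrightarrow> \<chi> (y \<otimes> z) = \<chi> y + \<chi> z"
      "\<chi> (x \<otimes> inv y) \<noteq> 0" using separating_character[OF zc nz] by metis
    have "e z \<chi> = \<chi> z" for z unfolding e_def by (rule if_P) (use \<chi>(1) in blast)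
    then have "\<chi> x = \<chi> y" using fun_cong[OF xy(3), of \<chi>] by simp
    moreover have "\<chi> (x \<otimes> inv y) = \<chi> x + \<chi> (inv y)" "\<chi> (y \<otimes> inv y) = \<chi> y + \<chi> (inv y)"
      using \<chi>(1)[OF xy(1) inv_closed[OF xy(2)]] \<chi>(1)[OF xy(2) inv_closed[OF xy(2)]] .
    moreover have "\<chi> \<one> = 0" using \<chi>(1)[of \<one> \<one>] by simp
    ultimately have "\<chi> (x \<otimes> inv y) = 0" using xy by simp
    then show False using \<chi>(2) by simp
  qed
  show ?thesis using that[of e] hom inj by (simp add: inj_on_def)
qed

end

section \<open>The automorphism group of an abelian group\<close>

lemma (in group) generate_finite_subset:
  assumes "x \<in> generate G X"
  shows "\<exists>F. finite F \<and> F \<subseteq> X \<and> x \<in> generate G F"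
  using assms
proof induction
  case one
  show ?case by (intro exI[of _ "{}"]) (simp add: generate.one)
next
  case (incl h)
  then show ?case by (intro exI[of _ "{h}"]) (simp add: generate.incl)
next
  case (inv h)
  then show ?case by (intro exI[of _ "{h}"]) (simp add: generate.inv)
next
  case (eng h1 h2)
  then obtain F1 F2 where F: "finite F1" "F1 \<subseteq> X" "h1 \<in> generate G F1" "finite F2" "F2 \<subseteq> X" "h2 \<in> generate G F2"
    by blast
  have "generate G F1 \<subseteq> generate G (F1 \<union> F2)" "generate G F2 \<subseteq> generate G (F1 \<union> F2)"
    by (simp_all add: mono_generate)
  then have "h1 \<otimes>\<^bsub>G\<^esub> h2 \<in> generate G (F1 \<union> F2)" using F by (meson generate.eng subsetD)
  then show ?case using F by (intro exI[of _ "F1 \<union> F2"]) auto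
qed

text \<open>
  An abelian group \<open>A\<close> with an embedding \<open>e\<close> into a type of class \<open>ab_group_add\<close>; \<open>S\<close> is the image and
  \<open>tr \<gamma>\<close> is the map of \<open>S\<close> that corresponds to \<open>\<gamma>\<close>.
\<close>

locale embedded_group = comm_group A for A :: "('a, 'b) monoid_scheme" (structure) +
  fixes e :: "'a \<Rightarrow> 'u::ab_group_add"
  assumes inj: "inj_on e (carrier A)"
    and hom: "\<And>x y. x \<in> carrier A \<Longrightarrow> y \<in> carrier A \<Longrightarrow> e (x \<otimes> y) = e x + e y"
begin

abbreviation AutA :: "('a \<Rightarrow> 'a) monoid" where "AutA \<equiv> AutoGroup A"

abbreviation IA :: "('a \<Rightarrow> 'a) monoid" where "IA \<equiv> IAut A"

definition S :: "'u set" where "S = e ` carrier A"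

definition tr :: "('a \<Rightarrow> 'a) \<Rightarrow> 'u \<Rightarrow> 'u" where
  "tr \<gamma> u = e (\<gamma> (inv_into (carrier A) e u))"

lemma e_one: "e \<one> = 0"
  using hom[of \<one> \<one>] by simp

lemma e_inv: "x \<in> carrier A \<Longrightarrow> e (inv x) = - e x"
  using hom[of x "inv x"] e_one by (simp add: eq_neg_iff_add_eq_0 add.commute)

lemma e_pow: "x \<in> carrier A \<Longrightarrow> e (x [^] (k::int)) = k *\<^sub>Z e x"
proof (induction k rule: int_induct[where k = 0])
  case base
  then show ?case by (simp add: e_one zmul_0)
next
  case (step1 i)
  then show ?case by (simp add: int_pow_mult hom zmul_succ)
next
  case (step2 i)
  then show ?case using int_pow_diff[of x i 1] by (simp add: hom e_inv Z.scale_left_diff_distrib)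
qed

lemma subspace_S: "Z.subspace S"
proof (rule Z.subspaceI)
  show "0 \<in> S" unfolding S_def using e_one one_closed by (metis imageI)
next
  fix u v assume "u \<in> S" "v \<in> S"
  then obtain x y where "x \<in> carrier A" "y \<in> carrier A" "u = e x" "v = e y" by (auto simp: S_def)
  then have "u + v = e (x \<otimes> y)" "x \<otimes> y \<in> carrier A" using hom by auto
  then show "u + v \<in> S" unfolding S_def by blast
next
  fix k u assume "u \<in> S"
  then obtain x where "x \<in> carrier A" "u = e x" by (auto simp: S_def)
  then have "k *\<^sub>Z u = e (x [^] k)" "x [^] k \<in> carrier A" using e_pow by auto
  then show "k *\<^sub>Z u \<in> S" unfolding S_def by blast
qed

lemma tr_e: "x \<in> carrier A \<Longrightarrow> tr \<gamma> (e x) = e (\<gamma> x)"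
  unfolding tr_def using inv_into_f_f[OF inj] by simp

lemma autoD:
  assumes "\<gamma> \<in> auto A"
  shows "bij_betw \<gamma> (carrier A) (carrier A)" "\<gamma> \<in> extensional (carrier A)"
    "\<And>x. x \<in> carrier A \<Longrightarrow> \<gamma> x \<in> carrier A"
    "\<And>x y. x \<in> carrier A \<Longrightarrow> y \<in> carrier A \<Longrightarrow> \<gamma> (x \<otimes> y) = \<gamma> x \<otimes> \<gamma> y"
  using assms unfolding auto_def Bij_def hom_def by auto

lemma tr_aut_on:
  assumes \<gamma>: "\<gamma> \<in> auto A"
  shows "aut_on S (tr \<gamma>)"
proof -
  note a = autoD[OF \<gamma>]
  have "add_on S (tr \<gamma>)" unfolding add_on_def
  proof (intro ballI)
    fix u v assume "u \<in> S" "v \<in> S"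
    then obtain x y where xy: "x \<in> carrier A" "y \<in> carrier A" "u = e x" "v = e y" by (auto simp: S_def)
    have "tr \<gamma> (u + v) = e (\<gamma> (x \<otimes> y))" using xy hom[OF xy(1,2)] tr_e[of "x \<otimes> y" \<gamma>] by simp
    also have "\<dots> = tr \<gamma> u + tr \<gamma> v" using xy a(3,4) hom tr_e by simp
    finally show "tr \<gamma> (u + v) = tr \<gamma> u + tr \<gamma> v" .
  qed
  moreover have "bij_betw (tr \<gamma>) S S" unfolding bij_betw_def
  proof
    show "inj_on (tr \<gamma>) S"
    proof (rule inj_onI)
      fix u v assume "u \<in> S" "v \<in> S" and eq: "tr \<gamma> u = tr \<gamma> v"
      then obtain x y where xy: "x \<in> carrier A" "y \<in> carrier A" "u = e x" "v = e y" by (auto simp: S_def)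
      then have "e (\<gamma> x) = e (\<gamma> y)" using eq tr_e by simp
      then have "\<gamma> x = \<gamma> y" using inj a(3) xy by (meson inj_onD)
      then have "x = y" using a(1) xy by (meson bij_betw_def inj_onD)
      then show "u = v" using xy by simp
    qed
    have "tr \<gamma> ` S = (\<lambda>x. e (\<gamma> x)) ` carrier A" unfolding S_def using tr_e by (auto simp: image_iff)
    also have "\<dots> = e ` (\<gamma> ` carrier A)" by auto
    also have "\<dots> = S" using a(1) by (simp add: bij_betw_def S_def)
    finally show "tr \<gamma> ` S = S" .
  qed
  ultimately show ?thesis using subspace_S by (simp add: aut_on_def)
qed

lemma tr_inert:
  assumes \<gamma>: "inertial A \<gamma>"
  shows "inert S (tr \<gamma>)"
  unfolding inert_def
proof (intro conjI allI impI)
  have aut: "\<gamma> \<in> auto A" using \<gamma> by (simp add: inertial_def)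
  then show "aut_on S (tr \<gamma>)" by (rule tr_aut_on)
  fix H assume H: "Z.subspace H" "H \<subseteq> S"
  define H0 where "H0 = {x \<in> carrier A. e x \<in> H}"
  have sub: "subgroup H0 A"
  proof (rule subgroupI)
    show "H0 \<subseteq> carrier A" by (auto simp: H0_def)
    show "H0 \<noteq> {}" using e_one Z.subspace_0[OF H(1)] one_closed by (auto simp: H0_def)
    show "inv a \<in> H0" if "a \<in> H0" for a using that Z.subspace_neg[OF H(1)] by (simp add: H0_def e_inv)
    show "a \<otimes> b \<in> H0" if "a \<in> H0" "b \<in> H0" for a b
      using that Z.subspace_add[OF H(1)] by (simp add: H0_def hom)
  qed
  interpret H0: subgroup H0 A by fact
  let ?B = "A\<lparr>carrier := H0 <#> (\<gamma> ` H0)\<rparr>"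
  have fin: "finite (carrier (?B Mod H0))" using \<gamma> sub by (simp add: inertial_def)
  have mem: "H0 #> (\<gamma> h) \<in> carrier (?B Mod H0)" if h: "h \<in> H0" for h
  proof -
    have "\<gamma> h \<in> carrier A" using autoD(3)[OF aut] h H0.subset by auto
    then have "\<gamma> h = \<one> \<otimes> \<gamma> h" by simp
    then have "\<gamma> h \<in> carrier ?B" using H0.one_closed h by (force simp: set_mult_def)
    then show ?thesis by (auto simp: FactGroup_def RCOSETS_def r_coset_def)
  qed
  let ?i = "inv_into (carrier A) e"
  show "fin_mod (tr \<gamma> ` H) H"
  proof (rule fin_manyI[of "\<lambda>u. H0 #> (?i u)"])
    have el: "\<exists>h\<in>H0. u = e (\<gamma> h) \<and> ?i u = \<gamma> h \<and> \<gamma> h \<in> carrier A" if u: "u \<in> tr \<gamma> ` H" for u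
    proof -
      obtain v where v: "v \<in> H" "u = tr \<gamma> v" using u by blast
      have "v \<in> e ` carrier A" using subsetD[OF H(2) v(1)] by (simp only: S_def)
      then obtain h where h: "v = e h" "h \<in> carrier A" by (rule imageE)
      have "e h \<in> H" using v(1) unfolding h(1) .
      then have "h \<in> H0" unfolding H0_def using h(2) by (intro CollectI conjI)
      moreover have "u = e (\<gamma> h)" using v(2) unfolding h(1) tr_e[OF h(2)] .
      moreover have "\<gamma> h \<in> carrier A" using autoD(3)[OF aut h(2)] .
      moreover from this have "?i (e (\<gamma> h)) = \<gamma> h" by (rule inv_into_f_f[OF inj])
      ultimately show ?thesis by blast
    qed
    have "(\<lambda>u. H0 #> (?i u)) ` (tr \<gamma> ` H) \<subseteq> carrier (?B Mod H0)"
    proof (rule image_subsetI)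
      fix u assume "u \<in> tr \<gamma> ` H"
      then obtain h where "h \<in> H0" "?i u = \<gamma> h" using el by blast
      then show "H0 #> (?i u) \<in> carrier (?B Mod H0)" using mem by simp
    qed
    then show "finite ((\<lambda>u. H0 #> (?i u)) ` (tr \<gamma> ` H))" using fin by (rule finite_subset)
    fix u v assume u: "u \<in> tr \<gamma> ` H" and v: "v \<in> tr \<gamma> ` H" and eq: "H0 #> (?i u) = H0 #> (?i v)"
    obtain x where x: "u = e x" "?i u = x" "x \<in> carrier A" using el[OF u] by blast
    obtain y where y: "v = e y" "?i v = y" "y \<in> carrier A" using el[OF v] by blast
    have "x \<in> H0 #> y" using eq x y rcos_self[OF x(3) sub] by simp
    then obtain h where h: "h \<in> H0" "x = h \<otimes> y" by (auto simp: r_coset_def)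
    have "e x = e h + e y" unfolding h(2) by (rule hom[OF H0.mem_carrier[OF h(1)] y(3)])
    then have "u - v = e h" unfolding x(1) y(1) by (simp only: add_diff_cancel_right')
    moreover have "e h \<in> H" using h(1) unfolding H0_def by (elim CollectE conjE)
    ultimately show "u - v \<in> H" by (simp only:)
  qed
qed

lemma Aut_group: "group (AutA)"
  by (rule AutoGroup)

lemma Aut_simps: "carrier (AutA) = auto A" "\<one>\<^bsub>AutA\<^esub> = (\<lambda>x\<in>carrier A. x)"
  by (simp_all add: AutoGroup_def BijGroup_def)

lemma tr_one: "u \<in> S \<Longrightarrow> tr (\<one>\<^bsub>AutA\<^esub>) u = u"
  using tr_e by (auto simp: S_def Aut_simps)

lemma tr_mult:
  assumes "g \<in> auto A" "h \<in> auto A" "u \<in> S"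
  shows "tr (g \<otimes>\<^bsub>AutA\<^esub> h) u = tr g (tr h u)"
proof -
  obtain x where x: "x \<in> carrier A" "u = e x" using assms(3) by (auto simp: S_def)
  have "g \<in> Bij (carrier A)" "h \<in> Bij (carrier A)" using assms by (auto simp: auto_def)
  then have "(g \<otimes>\<^bsub>AutA\<^esub> h) x = g (h x)" using x by (simp add: AutoGroup_def BijGroup_def compose_def)
  then show ?thesis using x tr_e autoD(3)[OF assms(2)] by simp
qed

lemma tr_inv:
  assumes g: "g \<in> auto A" and u: "u \<in> S"
  shows "tr (inv\<^bsub>AutA\<^esub> g) u \<in> S" "tr g (tr (inv\<^bsub>AutA\<^esub> g) u) = u"
    "tr (inv\<^bsub>AutA\<^esub> g) (tr g u) = u" "tr (inv\<^bsub>AutA\<^esub> g) u = inv_into S (tr g) u"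
proof -
  interpret Aut: group "AutA" by (rule Aut_group)
  have gc: "g \<in> carrier (AutA)" using g Aut_simps by simp
  have ig: "inv\<^bsub>AutA\<^esub> g \<in> auto A" using Aut.inv_closed[OF gc] Aut_simps by simp
  show 1: "tr (inv\<^bsub>AutA\<^esub> g) u \<in> S" using aut_onD(3)[OF tr_aut_on[OF ig]] u by blast
  show 2: "tr g (tr (inv\<^bsub>AutA\<^esub> g) u) = u"
    using tr_mult[OF g ig u] tr_one[OF u] Aut.r_inv[OF gc] by simp
  show "tr (inv\<^bsub>AutA\<^esub> g) (tr g u) = u"
    using tr_mult[OF ig g u] tr_one[OF u] Aut.l_inv[OF gc] by simp
  show "tr (inv\<^bsub>AutA\<^esub> g) u = inv_into S (tr g) u"
    using inv_into_f_f[OF aut_onD(4)[OF tr_aut_on[OF g]] 1] 2 by simp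
qed

lemma tr_ext:
  assumes "g \<in> auto A" "h \<in> auto A" "\<And>u. u \<in> S \<Longrightarrow> tr g u = tr h u"
  shows "g = h"
proof (rule extensionalityI[OF autoD(2)[OF assms(1)] autoD(2)[OF assms(2)]])
  fix x assume x: "x \<in> carrier A"
  then have "e (g x) = e (h x)" using assms(3)[of "e x"] tr_e by (simp add: S_def)
  then show "g x = h x" using inj autoD(3)[OF assms(1) x] autoD(3)[OF assms(2) x] by (meson inj_onD)
qed

lemma generate_gen:
  assumes \<Gamma>: "\<Gamma> \<subseteq> auto A" and w: "w \<in> generate (AutA) \<Gamma>"
  shows "\<exists>g\<in>gen S (tr ` \<Gamma>). \<forall>u\<in>S. tr w u = g u"
  using w
proof induction
  case one
  show ?case using tr_one gen_one by (metis (no_types, lifting))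
next
  case (incl h)
  then show ?case using gen_incl by blast
next
  case (inv h)
  then have "inv_into S (tr h) \<in> gen S (tr ` \<Gamma>)" by (intro gen_inv) blast
  moreover have "h \<in> auto A" using inv \<Gamma> by blast
  ultimately show ?case using tr_inv(4) by blast
next
  case (eng h1 h2)
  interpret Aut: group "AutA" by (rule Aut_group)
  have a: "h1 \<in> auto A" "h2 \<in> auto A"
    using Aut.generate_in_carrier[of \<Gamma>] \<Gamma> eng.hyps Aut_simps by auto
  obtain g1 g2 where g: "g1 \<in> gen S (tr ` \<Gamma>)" "g2 \<in> gen S (tr ` \<Gamma>)"
    "\<forall>u\<in>S. tr h1 u = g1 u" "\<forall>u\<in>S. tr h2 u = g2 u" using eng.IH by blast
  have "tr (h1 \<otimes>\<^bsub>AutA\<^esub> h2) u = g1 (g2 u)" if u: "u \<in> S" for u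
  proof -
    have "tr h2 u \<in> S" using aut_onD(3)[OF tr_aut_on[OF a(2)]] u by blast
    then show ?thesis using tr_mult[OF a u] g(3,4) u by simp
  qed
  then show ?case using gen_comp[OF g(1,2)] by (intro bexI[of _ "\<lambda>x. g1 (g2 x)"]) auto
qed

lemma IAut_simps: "carrier (IA) = generate (AutA) {\<gamma>. inertial A \<gamma>}"
  "mult (IA) = mult (AutA)" "\<one>\<^bsub>IA\<^esub> = \<one>\<^bsub>AutA\<^esub>"
  by (simp_all add: IAut_def)

lemma IAut_subgroup: "subgroup (carrier (IA)) (AutA)"
  unfolding IAut_simps
  by (rule group.generate_is_subgroup[OF Aut_group]) (auto simp: Aut_simps inertial_def)

lemma IAut_auto: "g \<in> carrier (IA) \<Longrightarrow> g \<in> auto A"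
  using subgroup.subset[OF IAut_subgroup] Aut_simps by auto

lemma IAut_inv: "g \<in> carrier (IA) \<Longrightarrow> inv\<^bsub>IA\<^esub> g = inv\<^bsub>AutA\<^esub> g"
  using group.m_inv_consistent[OF Aut_group IAut_subgroup] by (simp add: IAut_def)

lemma IAut_group: "group (IA)"
  by (rule group_IAut) (rule is_group)

lemma inert_rational:
  assumes g: "inert S g" and u: "u \<in> S"
  shows "\<exists>n m. n \<noteq> 0 \<and> n *\<^sub>Z g u = m *\<^sub>Z u"
proof -
  note a = aut_onD[OF inertD(1)[OF g]]
  have "Z.span {u} \<subseteq> S" using u by (intro Z.span_minimal a(1)) auto
  then have "fin_mod (g ` Z.span {u}) (Z.span {u})" by (intro inertD(2)[OF g]) auto
  moreover have "g (int i *\<^sub>Z u) \<in> g ` Z.span {u}" for i by (intro imageI) (auto simp: in_span1)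
  ultimately obtain i j where ij: "i < j" "g (int i *\<^sub>Z u) - g (int j *\<^sub>Z u) \<in> Z.span {u}"
    by (rule fin_many_pigeonhole[where s = "\<lambda>i. g (int i *\<^sub>Z u)"]) blast
  then obtain m where "g (int i *\<^sub>Z u) - g (int j *\<^sub>Z u) = m *\<^sub>Z u" by (auto simp: in_span1)
  then have "(int i - int j) *\<^sub>Z g u = m *\<^sub>Z u"
    using add_on_zmul[OF a(1,2) u] by (simp add: Z.scale_left_diff_distrib)
  moreover have "int i - int j \<noteq> 0" using ij(1) by simp
  ultimately show ?thesis by blast
qed

text \<open>
  Every element of \<open>IAut A\<close> acts on each \<open>u\<close> modulo torsion as a rational number. If \<open>u\<close> is a torsion
  element this says nothing, as then both sides may vanish.
\<close>

lemma IAut_rational: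
  assumes "g \<in> carrier (IA)" "u \<in> S"
  shows "\<exists>n m. n \<noteq> 0 \<and> n *\<^sub>Z tr g u = m *\<^sub>Z u"
  using assms unfolding IAut_simps
proof (induction arbitrary: u)
  case one
  then show ?case using tr_one by (intro exI[of _ 1]) simp
next
  case (incl h)
  then show ?case using inert_rational[OF tr_inert] by blast
next
  case (inv h)
  then have h: "h \<in> auto A" "inertial A h" by (auto simp: inertial_def)
  define v where "v = tr (inv\<^bsub>AutA\<^esub> h) u"
  have v: "v \<in> S" "tr h v = u" using tr_inv[OF h(1) inv.prems] by (auto simp: v_def)
  obtain n m where nm: "n \<noteq> 0" "n *\<^sub>Z u = m *\<^sub>Z v" using inert_rational[OF tr_inert[OF h(2)] v(1)] v(2) by metis
  show ?case
  proof (cases "m = 0")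
    case True
    then have "n *\<^sub>Z tr h v = 0" using nm v by simp
    then have "n *\<^sub>Z v = 0 *\<^sub>Z u" using aut_on_zmul_eq_0[OF tr_aut_on[OF h(1)] v(1)] by simp
    then show ?thesis using nm(1) unfolding v_def by blast
  next
    case False
    then show ?thesis using nm(2) unfolding v_def by metis
  qed
next
  case (eng h1 h2)
  have a: "h1 \<in> auto A" "h2 \<in> auto A" using eng.hyps IAut_auto unfolding IAut_simps by blast+
  have v: "tr h2 u \<in> S" using aut_onD(3)[OF tr_aut_on[OF a(2)]] eng.prems by blast
  obtain n m where 1: "n \<noteq> 0" "n *\<^sub>Z tr h2 u = m *\<^sub>Z u" using eng.IH(2)[OF eng.prems] by blast
  obtain k l where 2: "k \<noteq> 0" "k *\<^sub>Z tr h1 (tr h2 u) = l *\<^sub>Z tr h2 u" using eng.IH(1)[OF v] by blast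
  have "(n * k) *\<^sub>Z tr h1 (tr h2 u) = l *\<^sub>Z n *\<^sub>Z tr h2 u" using 2(2) by (metis Z.scale_scale Z.scale_left_commute)
  then have "(n * k) *\<^sub>Z tr (h1 \<otimes>\<^bsub>AutA\<^esub> h2) u = (l * m) *\<^sub>Z u" using 1(2) tr_mult[OF a eng.prems] by simp
  then show ?case using 1(1) 2(1) by (metis mult_eq_0_iff)
qed

text \<open>The elements of \<open>IAut A\<close> that act as power automorphisms on the torsion subgroup.\<close>

definition N :: "('a \<Rightarrow> 'a) set" where
  "N = {g \<in> carrier (IA). power_on (tor S) (tr g)}"

lemma tr_S: "g \<in> auto A \<Longrightarrow> u \<in> S \<Longrightarrow> tr g u \<in> S"
  using aut_onD(3)[OF tr_aut_on] by blast

lemma tr_tor: "g \<in> auto A \<Longrightarrow> u \<in> tor S \<Longrightarrow> tr g u \<in> tor S"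
  using aut_on_tor[OF tr_aut_on] by blast

lemma tor_S: "tor S \<subseteq> S"
  by (auto simp: tor_def)

lemma tr_zmul: "g \<in> auto A \<Longrightarrow> u \<in> S \<Longrightarrow> tr g (k *\<^sub>Z u) = k *\<^sub>Z tr g u"
  using add_on_zmul[OF subspace_S aut_onD(2)[OF tr_aut_on]] .

lemma N_subgroup: "subgroup N (IA)"
proof -
  interpret I: group "IA" by (rule IAut_group)
  show ?thesis
  proof (rule I.subgroupI)
    show "N \<subseteq> carrier (IA)" by (auto simp: N_def)
    have "\<one>\<^bsub>IA\<^esub> \<in> N" unfolding N_def power_on_def
      using tr_one tor_S by (auto simp: IAut_simps(3) intro: Z.span_base generate.one)
        (metis IAut_simps(3) I.one_closed)
    then show "N \<noteq> {}" by blast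
  next
    fix g assume g: "g \<in> N"
    then have gI: "g \<in> carrier (IA)" "g \<in> auto A" "power_on (tor S) (tr g)" using IAut_auto by (auto simp: N_def)
    have "power_on (tor S) (inv_into S (tr g))"
      by (rule power_on_inv[OF tr_aut_on[OF gI(2)] subspace_tor[OF subspace_S] tor_S gI(3)]) (auto simp: tor_def)
    then have "power_on (tor S) (tr (inv\<^bsub>AutA\<^esub> g))"
      unfolding power_on_def using tr_inv(4)[OF gI(2)] tor_S by (metis subsetD)
    then show "inv\<^bsub>IA\<^esub> g \<in> N" using gI IAut_inv I.inv_closed by (auto simp: N_def)
  next
    fix g h assume "g \<in> N" "h \<in> N"
    then have gh: "g \<in> carrier (IA)" "g \<in> auto A" "power_on (tor S) (tr g)"
      "h \<in> carrier (IA)" "h \<in> auto A" "power_on (tor S) (tr h)" using IAut_auto by (auto simp: N_def)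
    have "power_on (tor S) (tr (g \<otimes>\<^bsub>AutA\<^esub> h))" unfolding power_on_def
    proof
      fix u assume u: "u \<in> tor S"
      obtain k where k: "tr h u = k *\<^sub>Z u" using gh(6) u by (auto simp: power_on_def in_span1)
      obtain l where l: "tr g u = l *\<^sub>Z u" using gh(3) u by (auto simp: power_on_def in_span1)
      have "u \<in> S" using u tor_S by blast
      then have "tr (g \<otimes>\<^bsub>AutA\<^esub> h) u = k *\<^sub>Z l *\<^sub>Z u"
        using tr_mult[OF gh(2,5)] tr_zmul[OF gh(2)] k l by simp
      then show "tr (g \<otimes>\<^bsub>AutA\<^esub> h) u \<in> Z.span {u}" by (auto simp: in_span1)
    qed
    then show "g \<otimes>\<^bsub>IA\<^esub> h \<in> N" using I.m_closed[OF gh(1,4)] by (simp add: N_def IAut_simps(2))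
  qed
qed

lemma N_normal: "N \<lhd> IA"
proof -
  interpret I: group "IA" by (rule IAut_group)
  show ?thesis
  proof (rule I.normal_invI[OF N_subgroup])
    fix x h assume x: "x \<in> carrier (IA)" and h: "h \<in> N"
    have hI: "h \<in> carrier (IA)" "power_on (tor S) (tr h)" using h by (auto simp: N_def)
    have a: "x \<in> auto A" "h \<in> auto A" "inv\<^bsub>IA\<^esub> x \<in> auto A" "x \<otimes>\<^bsub>IA\<^esub> h \<in> auto A"
      using IAut_auto x hI I.inv_closed I.m_closed by blast+
    have "power_on (tor S) (tr (x \<otimes>\<^bsub>IA\<^esub> h \<otimes>\<^bsub>IA\<^esub> inv\<^bsub>IA\<^esub> x))" unfolding power_on_def
    proof
      fix u assume u: "u \<in> tor S"
      define v where "v = tr (inv\<^bsub>IA\<^esub> x) u"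
      have uS: "u \<in> S" using u tor_S by blast
      have v: "v \<in> tor S" "v \<in> S" "tr x v = u"
        using tr_tor[OF a(3) u] tr_S[OF a(3) uS] tr_inv(2)[OF a(1) uS] IAut_inv[OF x] by (auto simp: v_def)
      obtain k where k: "tr h v = k *\<^sub>Z v" using hI(2) v(1) by (auto simp: power_on_def in_span1)
      have "tr (x \<otimes>\<^bsub>IA\<^esub> h \<otimes>\<^bsub>IA\<^esub> inv\<^bsub>IA\<^esub> x) u = tr (x \<otimes>\<^bsub>IA\<^esub> h) v"
        using tr_mult[OF a(4,3) uS] by (simp add: IAut_simps(2) v_def)
      also have "\<dots> = tr x (tr h v)" using tr_mult[OF a(1,2) v(2)] by (simp add: IAut_simps(2))
      also have "\<dots> = k *\<^sub>Z u" using k v tr_zmul[OF a(1)] by simp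
      finally show "tr (x \<otimes>\<^bsub>IA\<^esub> h \<otimes>\<^bsub>IA\<^esub> inv\<^bsub>IA\<^esub> x) u \<in> Z.span {u}" by (auto simp: in_span1)
    qed
    then show "x \<otimes>\<^bsub>IA\<^esub> h \<otimes>\<^bsub>IA\<^esub> inv\<^bsub>IA\<^esub> x \<in> N"
      using x hI(1) I.m_closed I.inv_closed by (auto simp: N_def)
  qed
qed

lemma commutator_tor:
  assumes g: "g \<in> N" and h: "h \<in> N" and u: "u \<in> tor S"
  shows "tr g (tr h u) = tr h (tr g u)"
proof -
  have a: "g \<in> auto A" "h \<in> auto A" using g h IAut_auto by (auto simp: N_def)
  obtain k where k: "tr h u = k *\<^sub>Z u" using h u by (auto simp: N_def power_on_def in_span1)
  obtain l where l: "tr g u = l *\<^sub>Z u" using g u by (auto simp: N_def power_on_def in_span1)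
  have "u \<in> S" using u tor_S by blast
  then show ?thesis using k l tr_zmul[OF a(1)] tr_zmul[OF a(2)] by (simp add: mult.commute)
qed

lemma commutator_mod_tor:
  assumes g: "g \<in> carrier (IA)" and h: "h \<in> carrier (IA)" and u: "u \<in> S"
  shows "tr g (tr h u) - tr h (tr g u) \<in> tor S"
proof -
  have a: "g \<in> auto A" "h \<in> auto A" using g h IAut_auto by auto
  obtain n m where 1: "n \<noteq> 0" "n *\<^sub>Z tr g u = m *\<^sub>Z u" using IAut_rational[OF g u] by blast
  obtain k l where 2: "k \<noteq> 0" "k *\<^sub>Z tr h u = l *\<^sub>Z u" using IAut_rational[OF h u] by blast
  note S = tr_S[OF a(1) u] tr_S[OF a(2) u]
  have "n *\<^sub>Z k *\<^sub>Z tr g (tr h u) = n *\<^sub>Z tr g (l *\<^sub>Z u)"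
    using tr_zmul[OF a(1) S(2), of k] 2(2) by simp
  also have "\<dots> = l *\<^sub>Z m *\<^sub>Z u" using tr_zmul[OF a(1) u] 1(2) by (metis Z.scale_left_commute)
  finally have e1: "(n * k) *\<^sub>Z tr g (tr h u) = (l * m) *\<^sub>Z u" by simp
  have "k *\<^sub>Z n *\<^sub>Z tr h (tr g u) = k *\<^sub>Z tr h (m *\<^sub>Z u)"
    using tr_zmul[OF a(2) S(1), of n] 1(2) by simp
  also have "\<dots> = m *\<^sub>Z l *\<^sub>Z u" using tr_zmul[OF a(2) u] 2(2) by (metis Z.scale_left_commute)
  finally have e2: "(n * k) *\<^sub>Z tr h (tr g u) = (l * m) *\<^sub>Z u" by (simp add: mult.commute)
  have "(n * k) *\<^sub>Z (tr g (tr h u) - tr h (tr g u)) = 0" using e1 e2 by (simp add: Z.scale_right_diff_distrib)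
  moreover have "n * k \<noteq> 0" using 1 2 by simp
  moreover have "tr g (tr h u) - tr h (tr g u) \<in> S"
    using tr_S[OF a(1) S(2)] tr_S[OF a(2) S(1)] Z.subspace_diff[OF subspace_S] by blast
  ultimately show ?thesis unfolding tor_def by blast
qed

text \<open>
  The automorphisms that act trivially on the torsion subgroup \<open>T\<close> and on the quotient by it. They
  form an abelian group, isomorphic to \<open>Hom(A/T, T)\<close>, which contains the derived subgroup of \<open>N\<close>.
\<close>

definition K :: "('a \<Rightarrow> 'a) set" where
  "K = {g \<in> auto A. (\<forall>u\<in>tor S. tr g u = u) \<and> (\<forall>u\<in>S. tr g u - u \<in> tor S)}"

lemma K_mult:
  assumes g: "g \<in> K" and h: "h \<in> K"
  shows "g \<otimes>\<^bsub>AutA\<^esub> h \<in> K"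
proof -
  interpret Aut: group "AutA" by (rule Aut_group)
  have a: "g \<in> auto A" "h \<in> auto A" using g h by (auto simp: K_def)
  have "g \<otimes>\<^bsub>AutA\<^esub> h \<in> auto A" using Aut.m_closed a Aut_simps by simp
  moreover have "tr (g \<otimes>\<^bsub>AutA\<^esub> h) u = u" if "u \<in> tor S" for u
    using tr_mult[OF a] g h that tor_S by (auto simp: K_def)
  moreover have "tr (g \<otimes>\<^bsub>AutA\<^esub> h) u - u \<in> tor S" if u: "u \<in> S" for u
  proof -
    have "tr g (tr h u) - tr h u \<in> tor S" "tr h u - u \<in> tor S" using g h u tr_S[OF a(2) u] by (auto simp: K_def)
    from Z.subspace_add[OF subspace_tor[OF subspace_S] this] show ?thesis using tr_mult[OF a u] by simp
  qed
  ultimately show ?thesis by (simp add: K_def)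
qed

lemma K_inv:
  assumes g: "g \<in> K"
  shows "inv\<^bsub>AutA\<^esub> g \<in> K"
proof -
  interpret Aut: group "AutA" by (rule Aut_group)
  have a: "g \<in> auto A" using g by (auto simp: K_def)
  have "inv\<^bsub>AutA\<^esub> g \<in> auto A" using Aut.inv_closed a Aut_simps by simp
  moreover have "tr (inv\<^bsub>AutA\<^esub> g) u = u" if u: "u \<in> tor S" for u
  proof -
    have "tr g u = u" using g u by (auto simp: K_def)
    then show ?thesis using tr_inv(3)[OF a, of u] u tor_S by auto
  qed
  moreover have "tr (inv\<^bsub>AutA\<^esub> g) u - u \<in> tor S" if u: "u \<in> S" for u
  proof -
    define v where "v = tr (inv\<^bsub>AutA\<^esub> g) u"
    have v: "v \<in> S" "tr g v = u" using tr_inv(1,2)[OF a u] by (auto simp: v_def)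
    then have "u - v \<in> tor S" using g by (auto simp: K_def)
    then have "- (u - v) \<in> tor S" using Z.subspace_neg[OF subspace_tor[OF subspace_S]] by blast
    then show ?thesis by (simp add: v_def)
  qed
  ultimately show ?thesis by (simp add: K_def)
qed

lemma K_comm:
  assumes g: "g \<in> K" and h: "h \<in> K"
  shows "g \<otimes>\<^bsub>AutA\<^esub> h = h \<otimes>\<^bsub>AutA\<^esub> g"
proof (rule tr_ext)
  have a: "g \<in> auto A" "h \<in> auto A" using g h by (auto simp: K_def)
  show "g \<otimes>\<^bsub>AutA\<^esub> h \<in> auto A" "h \<otimes>\<^bsub>AutA\<^esub> g \<in> auto A"
    using K_mult[OF g h] K_mult[OF h g] by (auto simp: K_def)
  fix u assume u: "u \<in> S"
  define s t where "s = tr g u - u" and "t = tr h u - u"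
  have st: "s \<in> tor S" "t \<in> tor S" using g h u by (auto simp: K_def s_def t_def)
  then have "tr g t = t" "tr h s = s" using g h by (auto simp: K_def)
  moreover have "tr g (u + t) = tr g u + tr g t" "tr h (u + s) = tr h u + tr h s"
    using add_on_add[OF subspace_S aut_onD(2)[OF tr_aut_on[OF a(1)]] u, of t]
      add_on_add[OF subspace_S aut_onD(2)[OF tr_aut_on[OF a(2)]] u, of s] st tor_S by blast+
  moreover have "tr h u = u + t" "tr g u = u + s" by (simp_all add: s_def t_def)
  ultimately have "tr g (tr h u) = tr h (tr g u)" by (simp add: algebra_simps)
  then show "tr (g \<otimes>\<^bsub>AutA\<^esub> h) u = tr (h \<otimes>\<^bsub>AutA\<^esub> g) u"
    using tr_mult[OF a u] tr_mult[OF a(2,1) u] by simp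
qed

lemma commutator_K:
  assumes g: "g \<in> N" and h: "h \<in> N"
  shows "g \<otimes>\<^bsub>AutA\<^esub> h \<otimes>\<^bsub>AutA\<^esub> inv\<^bsub>AutA\<^esub> g \<otimes>\<^bsub>AutA\<^esub> inv\<^bsub>AutA\<^esub> h \<in> K" (is "?c \<in> K")
proof -
  interpret Aut: group "AutA" by (rule Aut_group)
  have I: "g \<in> carrier (IA)" "h \<in> carrier (IA)" using g h by (auto simp: N_def)
  have a: "g \<in> auto A" "h \<in> auto A" using I IAut_auto by auto
  let ?g' = "inv\<^bsub>AutA\<^esub> g" and ?h' = "inv\<^bsub>AutA\<^esub> h"
  have c: "g \<otimes>\<^bsub>AutA\<^esub> h \<in> auto A" "?g' \<in> auto A" "?h' \<in> auto A"
    "g \<otimes>\<^bsub>AutA\<^esub> h \<otimes>\<^bsub>AutA\<^esub> ?g' \<in> auto A" "?c \<in> auto A"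
    using a Aut.m_closed Aut.inv_closed Aut_simps by simp_all
  have key: "tr ?c u = tr g (tr h (tr ?g' (tr ?h' u)))" "tr h (tr g (tr ?g' (tr ?h' u))) = u" if u: "u \<in> S" for u
  proof -
    have S: "tr ?h' u \<in> S" "tr ?g' (tr ?h' u) \<in> S" using tr_S c u by blast+
    show "tr ?c u = tr g (tr h (tr ?g' (tr ?h' u)))"
      using tr_mult[OF c(4,3) u] tr_mult[OF c(1,2) S(1)] tr_mult[OF a S(2)] by simp
    show "tr h (tr g (tr ?g' (tr ?h' u))) = u"
      using tr_inv(2)[OF a(1) S(1)] tr_inv(2)[OF a(2) u] by simp
  qed
  have "tr ?c u = u" if u: "u \<in> tor S" for u
  proof -
    have uS: "u \<in> S" using u tor_S by blast
    have "tr ?g' (tr ?h' u) \<in> tor S" using tr_tor c u by blast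
    from commutator_tor[OF g h this] show ?thesis unfolding key(1)[OF uS] key(2)[OF uS] .
  qed
  moreover have "tr ?c u - u \<in> tor S" if u: "u \<in> S" for u
  proof -
    have "tr ?g' (tr ?h' u) \<in> S" using tr_S c u by blast
    from commutator_mod_tor[OF I this] show ?thesis unfolding key(1)[OF u] key(2)[OF u] .
  qed
  ultimately show ?thesis using c(5) by (simp add: K_def)
qed

lemma N_metabelian: "metabelian ((IA)\<lparr>carrier := N\<rparr>)" (is "metabelian ?M")
proof -
  interpret I: group "IA" by (rule IAut_group)
  interpret M: group ?M by (rule I.subgroup_imp_group[OF N_subgroup])
  have invM: "inv\<^bsub>?M\<^esub> g = inv\<^bsub>AutA\<^esub> g" if "g \<in> N" for g
    using I.m_inv_consistent[OF N_subgroup that] IAut_inv that by (simp add: N_def)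
  have sub: "derived ?M N \<subseteq> K"
  proof
    fix x assume "x \<in> derived ?M N"
    then show "x \<in> K" unfolding derived_def
    proof induction
      case one
      have "\<one>\<^bsub>AutA\<^esub> \<in> auto A" using group.is_monoid[OF Aut_group] monoid.one_closed Aut_simps by metis
      then have "\<one>\<^bsub>AutA\<^esub> \<in> K"
        using tr_one tor_S Z.subspace_0[OF subspace_tor[OF subspace_S]] by (auto simp: K_def)
      then show ?case by (simp add: IAut_simps)
    next
      case (incl h)
      then obtain g k where "g \<in> N" "k \<in> N" "h = g \<otimes>\<^bsub>?M\<^esub> k \<otimes>\<^bsub>?M\<^esub> inv\<^bsub>?M\<^esub> g \<otimes>\<^bsub>?M\<^esub> inv\<^bsub>?M\<^esub> k" by blast
      then show ?case using commutator_K[of g k] invM by (simp add: IAut_simps(2))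
    next
      case (inv h)
      then obtain g k where gk: "g \<in> N" "k \<in> N" "h = g \<otimes>\<^bsub>?M\<^esub> k \<otimes>\<^bsub>?M\<^esub> inv\<^bsub>?M\<^esub> g \<otimes>\<^bsub>?M\<^esub> inv\<^bsub>?M\<^esub> k" by blast
      then have "h \<in> K" using commutator_K[of g k] invM by (simp add: IAut_simps(2))
      moreover have "h \<in> N" using gk M.m_closed M.inv_closed by simp
      ultimately show ?case using K_inv[of h] invM[of h] by simp
    next
      case (eng h1 h2)
      then show ?case using K_mult by (simp add: IAut_simps)
    qed
  qed
  have "subgroup (derived ?M N) ?M" using M.derived_is_subgroup[of N] by simp
  then interpret D: group "?M\<lparr>carrier := derived ?M N\<rparr>" by (rule M.subgroup_imp_group)
  have "comm_group (?M\<lparr>carrier := derived ?M N\<rparr>)"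
  proof (rule D.group_comm_groupI)
    fix x y
    assume "x \<in> carrier (?M\<lparr>carrier := derived ?M N\<rparr>)" "y \<in> carrier (?M\<lparr>carrier := derived ?M N\<rparr>)"
    then have "x \<in> K" "y \<in> K" using sub by auto
    then show "x \<otimes>\<^bsub>?M\<lparr>carrier := derived ?M N\<rparr>\<^esub> y = y \<otimes>\<^bsub>?M\<lparr>carrier := derived ?M N\<rparr>\<^esub> x"
      using K_comm by (simp add: IAut_simps(2))
  qed
  then show ?thesis unfolding metabelian_def using M.is_group by simp
qed

text \<open>
  Two automorphisms that permute the cyclic subgroups of the torsion subgroup in the same way agree
  modulo \<open>N\<close>.
\<close>

lemma N_coset_eq:
  assumes g: "g \<in> carrier (IA)" and h: "h \<in> carrier (IA)"
    and pow: "\<And>u. u \<in> tor S \<Longrightarrow> tr h u \<in> Z.span {tr g u}"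
  shows "N #>\<^bsub>IA\<^esub> g = N #>\<^bsub>IA\<^esub> h"
proof -
  interpret I: group "IA" by (rule IAut_group)
  have a: "g \<in> auto A" "h \<in> auto A" "inv\<^bsub>IA\<^esub> g \<in> auto A" using IAut_auto g h I.inv_closed by blast+
  have c: "h \<otimes>\<^bsub>IA\<^esub> inv\<^bsub>IA\<^esub> g \<in> carrier (IA)" using g h by simp
  have "power_on (tor S) (tr (h \<otimes>\<^bsub>IA\<^esub> inv\<^bsub>IA\<^esub> g))" unfolding power_on_def
  proof
    fix u assume u: "u \<in> tor S"
    then have uS: "u \<in> S" using tor_S by blast
    have "tr (h \<otimes>\<^bsub>IA\<^esub> inv\<^bsub>IA\<^esub> g) u = tr h (tr (inv\<^bsub>IA\<^esub> g) u)"
      using tr_mult[OF a(2,3) uS] by (simp add: IAut_simps)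
    moreover have "tr h (tr (inv\<^bsub>IA\<^esub> g) u) \<in> Z.span {tr g (tr (inv\<^bsub>IA\<^esub> g) u)}"
      using pow tr_tor[OF a(3) u] by blast
    ultimately show "tr (h \<otimes>\<^bsub>IA\<^esub> inv\<^bsub>IA\<^esub> g) u \<in> Z.span {u}"
      using tr_inv(2)[OF a(1) uS] IAut_inv[OF g] by simp
  qed
  then have "h \<otimes>\<^bsub>IA\<^esub> inv\<^bsub>IA\<^esub> g \<in> N" using c by (simp add: N_def)
  moreover have "h = (h \<otimes>\<^bsub>IA\<^esub> inv\<^bsub>IA\<^esub> g) \<otimes>\<^bsub>IA\<^esub> g" using g h by (simp add: I.m_assoc)
  ultimately have "h \<in> N #>\<^bsub>IA\<^esub> g" unfolding r_coset_def by blast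
  then show ?thesis using I.repr_independence[OF _ g N_subgroup] by blast
qed

lemma finite_cosets:
  assumes fin: "finite \<Gamma>" and \<Gamma>: "\<Gamma> \<subseteq> {\<gamma>. inertial A \<gamma>}"
  shows "finite ((\<lambda>w. N #>\<^bsub>IA\<^esub> w) ` generate (AutA) \<Gamma>)"
proof -
  have aut: "\<Gamma> \<subseteq> auto A" using \<Gamma> by (auto simp: inertial_def)
  have "fin_many (gen S (tr ` \<Gamma>)) (\<lambda>g h. \<forall>u\<in>tor S. h u \<in> Z.span {g u})"
    by (rule torsion_finite_action[OF _ subspace_S]) (use fin \<Gamma> tr_inert in auto)
  moreover obtain \<phi> where \<phi>: "\<And>w. w \<in> generate (AutA) \<Gamma> \<Longrightarrow> \<phi> w \<in> gen S (tr ` \<Gamma>) \<and> (\<forall>u\<in>S. tr w u = \<phi> w u)"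
    using generate_gen[OF aut] by metis
  then have "\<phi> ` generate (AutA) \<Gamma> \<subseteq> gen S (tr ` \<Gamma>)" by blast
  ultimately have "fin_many (generate (AutA) \<Gamma>) (\<lambda>g h. \<forall>u\<in>tor S. \<phi> h u \<in> Z.span {\<phi> g u})"
    by (rule fin_many_comp)
  then obtain D where D: "finite D" "D \<subseteq> generate (AutA) \<Gamma>"
    "\<And>w. w \<in> generate (AutA) \<Gamma> \<Longrightarrow> \<exists>d\<in>D. \<forall>u\<in>tor S. \<phi> w u \<in> Z.span {\<phi> d u}"
    by (rule fin_many_reps) blast
  have sub: "generate (AutA) \<Gamma> \<subseteq> carrier (IA)" unfolding IAut_simps by (rule group.mono_generate[OF Aut_group \<Gamma>])
  have "(\<lambda>w. N #>\<^bsub>IA\<^esub> w) ` generate (AutA) \<Gamma> \<subseteq> (\<lambda>w. N #>\<^bsub>IA\<^esub> w) ` D"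
  proof (rule image_subsetI)
    fix w assume w: "w \<in> generate (AutA) \<Gamma>"
    obtain d where d: "d \<in> D" "\<forall>u\<in>tor S. \<phi> w u \<in> Z.span {\<phi> d u}" using D(3)[OF w] by blast
    have dg: "d \<in> generate (AutA) \<Gamma>" using d(1) D(2) by blast
    have "N #>\<^bsub>IA\<^esub> d = N #>\<^bsub>IA\<^esub> w"
    proof (rule N_coset_eq)
      show "d \<in> carrier (IA)" "w \<in> carrier (IA)" using sub dg w by blast+
      fix u assume u: "u \<in> tor S"
      then have "u \<in> S" using tor_S by blast
      then show "tr w u \<in> Z.span {tr d u}" using d(2) u \<phi>[OF w] \<phi>[OF dg] by simp
    qed
    then show "N #>\<^bsub>IA\<^esub> w \<in> (\<lambda>w. N #>\<^bsub>IA\<^esub> w) ` D" using d(1) by blast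
  qed
  then show ?thesis using D(1) by (meson finite_imageI finite_subset)
qed

lemma quotient_locally_finite: "locally_finite (IA Mod N)"
proof -
  interpret I: group "IA" by (rule IAut_group)
  interpret N: normal N "IA" by (rule N_normal)
  show ?thesis unfolding locally_finite_def
  proof (intro conjI allI impI)
    show "group (IA Mod N)" by (rule N.factorgroup_is_group)
    fix X assume X: "finite X \<and> X \<subseteq> carrier (IA Mod N)"
    have "\<forall>c\<in>X. \<exists>q. c = N #>\<^bsub>IA\<^esub> fst q \<and> finite (snd q) \<and> snd q \<subseteq> {\<gamma>. inertial A \<gamma>} \<and>
        fst q \<in> generate (AutA) (snd q)"
    proof
      fix c assume c: "c \<in> X"
      then have "c \<in> rcosets\<^bsub>IA\<^esub> N" using X by (auto simp: FactGroup_def)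
      then obtain g where g: "g \<in> carrier (IA)" "c = N #>\<^bsub>IA\<^esub> g" by (auto simp: RCOSETS_def)
      have "g \<in> generate (AutA) {\<gamma>. inertial A \<gamma>}" using g(1) by (simp add: IAut_simps)
      from group.generate_finite_subset[OF Aut_group this]
      obtain F where "finite F" "F \<subseteq> {\<gamma>. inertial A \<gamma>}" "g \<in> generate (AutA) F" by blast
      then show "\<exists>q. c = N #>\<^bsub>IA\<^esub> fst q \<and> finite (snd q) \<and> snd q \<subseteq> {\<gamma>. inertial A \<gamma>} \<and>
          fst q \<in> generate (AutA) (snd q)"
        using g(2) by (intro exI[of _ "(g, F)"]) simp
    qed
    from bchoice[OF this] obtain q where q: "\<forall>c\<in>X. c = N #>\<^bsub>IA\<^esub> fst (q c) \<and> finite (snd (q c)) \<and>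
        snd (q c) \<subseteq> {\<gamma>. inertial A \<gamma>} \<and> fst (q c) \<in> generate (AutA) (snd (q c))"
      by (rule exE)
    define r F where "r c = fst (q c)" and "F c = snd (q c)" for c
    have rF: "c = N #>\<^bsub>IA\<^esub> r c \<and> finite (F c) \<and> F c \<subseteq> {\<gamma>. inertial A \<gamma>} \<and> r c \<in> generate (AutA) (F c)"
      if "c \<in> X" for c
      using bspec[OF q that] by (simp only: r_def F_def)
    define \<Gamma> where "\<Gamma> = (\<Union>c\<in>X. F c)"
    have \<Gamma>: "finite \<Gamma>" "\<Gamma> \<subseteq> {\<gamma>. inertial A \<gamma>}" using rF X by (auto simp: \<Gamma>_def)
    have rg: "r c \<in> generate (AutA) \<Gamma>" if "c \<in> X" for c
      using rF[OF that] group.mono_generate[OF Aut_group, of "F c" \<Gamma>] that unfolding \<Gamma>_def by blast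
    have sub: "generate (AutA) \<Gamma> \<subseteq> carrier (IA)" unfolding IAut_simps by (rule group.mono_generate[OF Aut_group \<Gamma>(2)])
    have aut: "\<Gamma> \<subseteq> carrier (AutA)" using \<Gamma>(2) by (auto simp: inertial_def Aut_simps)
    let ?W = "(\<lambda>w. N #>\<^bsub>IA\<^esub> w) ` generate (AutA) \<Gamma>"
    have invW: "inv\<^bsub>IA Mod N\<^esub> (N #>\<^bsub>IA\<^esub> w) \<in> ?W" if w: "w \<in> generate (AutA) \<Gamma>" for w
    proof -
      have wI: "w \<in> carrier (IA)" using sub w by blast
      then have "N #>\<^bsub>IA\<^esub> w \<in> carrier (IA Mod N)" by (auto simp: FactGroup_def RCOSETS_def)
      then have "inv\<^bsub>IA Mod N\<^esub> (N #>\<^bsub>IA\<^esub> w) = N #>\<^bsub>IA\<^esub> inv\<^bsub>IA\<^esub> w"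
        using N.inv_FactGroup N.rcos_inv[OF wI] by simp
      moreover have "inv\<^bsub>IA\<^esub> w \<in> generate (AutA) \<Gamma>"
        using group.generate_m_inv_closed[OF Aut_group aut w] IAut_inv[OF wI] by simp
      ultimately show ?thesis by simp
    qed
    have "generate (IA Mod N) X \<subseteq> ?W"
    proof
      fix x assume "x \<in> generate (IA Mod N) X"
      then show "x \<in> ?W"
      proof induction
        case one
        have "\<one>\<^bsub>IA Mod N\<^esub> = N #>\<^bsub>IA\<^esub> \<one>\<^bsub>IA\<^esub>" by (simp add: FactGroup_def I.coset_mult_one[OF N.subset])
        then show ?case using generate.one[of "AutA" \<Gamma>] by (simp add: IAut_simps)
      next
        case (incl c)
        then show ?case using rF rg by blast
      next
        case (inv c)
        then show ?case using invW[OF rg[OF inv]] rF[OF inv] by simp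
      next
        case (eng c d)
        then obtain v w where vw: "v \<in> generate (AutA) \<Gamma>" "w \<in> generate (AutA) \<Gamma>"
          "c = N #>\<^bsub>IA\<^esub> v" "d = N #>\<^bsub>IA\<^esub> w" by blast
        have "c \<otimes>\<^bsub>IA Mod N\<^esub> d = N #>\<^bsub>IA\<^esub> (v \<otimes>\<^bsub>IA\<^esub> w)"
          using N.rcos_sum[of v w] vw sub by (auto simp: FactGroup_def)
        then show ?case using generate.eng[OF vw(1,2)] by (simp add: IAut_simps)
      qed
    qed
    then show "finite (generate (IA Mod N) X)" using finite_cosets[OF \<Gamma>] by (rule finite_subset)
  qed
qed

end

theorem IAut_metabelian_by_locally_finite:
  fixes A :: "('a, 'b) monoid_scheme"
  assumes "comm_group A"
  shows "is_X_by_Y metabelian locally_finite (IAut A)"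
proof -
  obtain e :: "'a \<Rightarrow> ('a \<Rightarrow> circle) \<Rightarrow> circle" where e: "inj_on e (carrier A)"
    "\<And>x y. x \<in> carrier A \<Longrightarrow> y \<in> carrier A \<Longrightarrow> e (x \<otimes>\<^bsub>A\<^esub> y) = e x + e y"
    using comm_group.embedding[OF assms] by blast
  interpret embedded_group A e
    using assms e by (intro embedded_group.intro embedded_group_axioms.intro)
  show ?thesis unfolding is_X_by_Y_def using N_normal N_metabelian quotient_locally_finite by blast
qed

section \<open>The group \<open>\<int>(p\<^sup>\<infinity>) \<oplus> \<int>\<close>\<close>

lemma (in normal) locally_finite_power_mem:
  assumes lf: "locally_finite (G Mod H)" and g: "g \<in> carrier G"
  obtains m :: nat where "m > 0" "g [^] m \<in> H"
proof -
  interpret Q: group "G Mod H" by (rule factorgroup_is_group)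
  let ?c = "H #> g"
  have c: "?c \<in> carrier (G Mod H)" using g by (auto simp: FactGroup_def RCOSETS_def)
  have fin: "finite (generate (G Mod H) {?c})" using lf c unfolding locally_finite_def by simp
  have mem: "H #> g [^] i \<in> generate (G Mod H) {?c}" for i :: nat
  proof (induction i)
    case 0
    have "\<one>\<^bsub>G Mod H\<^esub> = H #> g [^] (0::nat)" by (simp add: FactGroup_def coset_mult_one[OF subset])
    then show ?case using generate.one[of "G Mod H" "{?c}"] by simp
  next
    case (Suc i)
    have "H #> g [^] Suc i = (H #> g [^] i) \<otimes>\<^bsub>G Mod H\<^esub> ?c" using g by (simp add: FactGroup_def rcos_sum)
    then show ?case using generate.eng[OF Suc generate.incl[of ?c "{?c}" "G Mod H"]] by simp
  qed
  have "finite (range (\<lambda>i :: nat. H #> g [^] i))" by (rule finite_subset[OF _ fin]) (use mem in blast)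
  then have "\<not> inj (\<lambda>i :: nat. H #> g [^] i)" using finite_imageD infinite_UNIV_nat by blast
  then obtain i j :: nat where "i \<noteq> j" "H #> g [^] i = H #> g [^] j" unfolding inj_def by blast
  then obtain i j :: nat where ij: "i < j" "H #> g [^] i = H #> g [^] j" by (metis linorder_neqE_nat)
  have "g [^] j \<in> H #> g [^] i" using ij(2) rcos_self[of "g [^] j" H] g is_subgroup by simp
  then obtain h where h: "h \<in> H" "g [^] j = h \<otimes> g [^] i" by (auto simp: r_coset_def)
  have "g [^] (j - i) \<otimes> g [^] i = h \<otimes> g [^] i" using h(2) ij(1) g by (simp add: nat_pow_mult)
  then have "g [^] (j - i) = h" using g h(1) mem_carrier by simp
  then show ?thesis using that[of "j - i"] ij(1) h(1) by simp
qed

text \<open>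
  It suffices that \<open>\<gamma> H\<close> is covered by finitely many cosets of \<open>H\<close>, as \<open>H\<close> and \<open>\<gamma> H\<close> together generate
  no further ones.
\<close>

lemma inertialI:
  assumes A: "comm_group A" and \<gamma>: "\<gamma> \<in> auto A"
    and fin: "\<And>H. subgroup H A \<Longrightarrow> \<exists>R. finite R \<and> R \<subseteq> carrier A \<and> (\<forall>h\<in>H. \<exists>k\<in>H. \<exists>r\<in>R. \<gamma> h = k \<otimes>\<^bsub>A\<^esub> r)"
  shows "inertial A \<gamma>"
  unfolding inertial_def
proof (intro conjI allI impI)
  interpret comm_group A by fact
  show "\<gamma> \<in> auto A" by fact
  fix H assume H: "subgroup H A"
  interpret H: subgroup H A by fact
  obtain R where R: "finite R" "R \<subseteq> carrier A" "\<forall>h\<in>H. \<exists>k\<in>H. \<exists>r\<in>R. \<gamma> h = k \<otimes>\<^bsub>A\<^esub> r"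
    using fin[OF H] by blast
  have "carrier (A\<lparr>carrier := H <#>\<^bsub>A\<^esub> (\<gamma> ` H)\<rparr> Mod H) \<subseteq> (\<lambda>r. H #>\<^bsub>A\<^esub> r) ` R"
  proof
    fix c assume "c \<in> carrier (A\<lparr>carrier := H <#>\<^bsub>A\<^esub> (\<gamma> ` H)\<rparr> Mod H)"
    then obtain a where a: "a \<in> H <#>\<^bsub>A\<^esub> (\<gamma> ` H)" "c = H #>\<^bsub>A\<^esub> a"
      by (auto simp: FactGroup_def RCOSETS_def r_coset_def)
    then obtain h1 h2 where h: "h1 \<in> H" "h2 \<in> H" "a = h1 \<otimes>\<^bsub>A\<^esub> \<gamma> h2" by (auto simp: set_mult_def)
    obtain k r where k: "k \<in> H" "r \<in> R" "\<gamma> h2 = k \<otimes>\<^bsub>A\<^esub> r" using R(3) h(2) by blast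
    have "r \<in> carrier A" using k R by blast
    then have "a = (h1 \<otimes>\<^bsub>A\<^esub> k) \<otimes>\<^bsub>A\<^esub> r" using h k H.mem_carrier by (simp add: m_assoc)
    then have "a \<in> H #>\<^bsub>A\<^esub> r" using h k unfolding r_coset_def by blast
    then have "H #>\<^bsub>A\<^esub> r = H #>\<^bsub>A\<^esub> a" using repr_independence \<open>r \<in> carrier A\<close> H by blast
    then show "c \<in> (\<lambda>r. H #>\<^bsub>A\<^esub> r) ` R" using a(2) k(2) by blast
  qed
  then show "finite (carrier (A\<lparr>carrier := H <#>\<^bsub>A\<^esub> (\<gamma> ` H)\<rparr> Mod H))"
    using R(1) finite_subset by blast
qed

lemma complex_root_exists:
  assumes "z \<noteq> 0" "n > 0"
  obtains w :: complex where "w ^ n = z"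
proof -
  have "card {w. w ^ n = z} = n" using card_nth_roots assms by blast
  then have "{w. w ^ n = z} \<noteq> {}" using assms(2) by force
  then show ?thesis using that by blast
qed

text \<open>The Pruefer group \<open>T\<close> is multiplicative, so the elements of \<open>A\<close> are pairs of a root of unity and an integer.\<close>

locale prufer_times_int =
  fixes p :: nat
  assumes p: "prime p"
begin

abbreviation T :: "complex set" where "T \<equiv> {z. \<exists>n. z ^ (p ^ n) = 1}"

abbreviation A :: "(complex \<times> int) monoid" where "A \<equiv> prufer_group p \<times>\<times> integer_group"

abbreviation IA :: "(complex \<times> int \<Rightarrow> complex \<times> int) monoid" where "IA \<equiv> IAut A"

lemma p_pos: "p > 0" using p prime_gt_0_nat by blast

lemma carrier_A: "carrier A = T \<times> UNIV"
  by (simp add: prufer_group_def)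

lemma mult_A: "(a, m) \<otimes>\<^bsub>A\<^esub> (b, n) = (a * b, m + n)"
  by (simp add: prufer_group_def)

lemma one_A: "\<one>\<^bsub>A\<^esub> = (1, 0)"
  by (simp add: prufer_group_def)

lemma comm_A: "comm_group A"
proof -
  interpret P: comm_group "prufer_group p" by (rule comm_group_prufer_group[OF p_pos])
  interpret A: group A by (rule DirProd_group[OF P.is_group group_integer_group])
  show ?thesis
  proof (rule A.group_comm_groupI)
    fix x y :: "complex \<times> int"
    show "x \<otimes>\<^bsub>A\<^esub> y = y \<otimes>\<^bsub>A\<^esub> x" by (cases x; cases y) (simp add: mult_A del: mult_DirProd)
  qed
qed

lemma T_nonzero: "z \<in> T \<Longrightarrow> z \<noteq> 0"
  using p_pos by (auto simp: power_0_left)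

lemma T_1: "1 \<in> T" by simp

lemma T_raise: "z ^ (p ^ n) = 1 \<Longrightarrow> n \<le> m \<Longrightarrow> z ^ (p ^ m) = (1 :: complex)"
  by (metis le_Suc_ex power_add power_mult power_one)

lemma T_mult: "z \<in> T \<Longrightarrow> w \<in> T \<Longrightarrow> z * w \<in> T"
proof -
  assume "z \<in> T" "w \<in> T"
  then obtain m n where "z ^ (p ^ m) = 1" "w ^ (p ^ n) = 1" by blast
  then have "(z * w) ^ (p ^ (m + n)) = 1" using T_raise[of z m "m + n"] T_raise[of w n "m + n"]
    by (simp add: power_mult_distrib)
  then show ?thesis by blast
qed

lemma powi_root: "z ^ k = 1 \<Longrightarrow> (z powi n) ^ k = (1 :: complex)"
  by (metis mult.commute power_int_1_left power_int_mult power_int_of_nat)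

lemma T_powi: "z \<in> T \<Longrightarrow> z powi n \<in> T"
  using powi_root by blast

lemma T_power: "z \<in> T \<Longrightarrow> z ^ n \<in> T"
  using T_powi[of z "int n"] by simp

lemma T_divisible:
  assumes r: "r > 0" and z: "z \<in> T"
  obtains w where "w \<in> T" "w ^ r = z"
proof -
  obtain n where n: "z ^ (p ^ n) = 1" using z by blast
  define j where "j = multiplicity p r"
  obtain u where u: "r = p ^ j * u" "\<not> p dvd u"
    unfolding j_def using multiplicity_decompose'[of r p] r p by (metis not_prime_unit less_irrefl)
  have "coprime (int u) (int (p ^ n))"
    using u(2) p by (simp add: coprime_commute prime_imp_coprime)
  then obtain a b where ab: "a * int u + b * int (p ^ n) = 1"
    using bezout_int[of "int u" "int (p ^ n)"] by (metis coprime_imp_gcd_eq_1)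
  obtain w0 where w0: "w0 ^ (p ^ j) = z" using complex_root_exists[of z "p ^ j"] T_nonzero[OF z] p_pos by auto
  have "w0 ^ (p ^ (j + n)) = 1" using w0 n by (simp add: power_add power_mult)
  then have "w0 powi a \<in> T" by (intro T_powi) blast
  moreover have "(w0 powi a) ^ r = z"
  proof -
    have "(w0 powi a) ^ r = w0 powi (int (p ^ j) * (a * int u))"
      by (simp add: u(1) mult_ac flip: power_int_mult power_int_of_nat)
    also have "\<dots> = z powi (a * int u)" using w0 by (simp only: power_int_mult power_int_of_nat)
    also have "a * int u = 1 + int (p ^ n) * (- b)" using ab by (simp add: algebra_simps)
    also have "z powi (1 + int (p ^ n) * (- b)) = z * (z powi int (p ^ n)) powi (- b)"
      using T_nonzero[OF z] by (simp only: power_int_add power_int_mult power_int_1_right not_False_eq_True simp_thms)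
    also have "\<dots> = z" using n by (simp only: power_int_of_nat power_int_1_left mult_1_right)
    finally show ?thesis .
  qed
  ultimately show ?thesis by (rule that)
qed

lemma T_root_unique:
  assumes r: "coprime r p" and z: "z \<in> T" and "z ^ r = 1"
  shows "z = 1"
proof -
  obtain n where n: "z ^ (p ^ n) = 1" using z by blast
  have "coprime (int r) (int (p ^ n))" using r by simp
  then obtain a b where ab: "a * int r + b * int (p ^ n) = 1"
    using bezout_int[of "int r" "int (p ^ n)"] by (metis coprime_imp_gcd_eq_1)
  have "z = z powi (int r * a + int (p ^ n) * b)" using ab by (simp add: mult.commute)
  also have "\<dots> = (z powi int r) powi a * (z powi int (p ^ n)) powi b"
    using T_nonzero[OF z] by (simp only: power_int_add power_int_mult simp_thms not_False_eq_True)
  also have "\<dots> = 1" using n assms(3) by (simp only: power_int_of_nat power_int_1_left mult_1_right)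
  finally show ?thesis .
qed

text \<open>
  The automorphisms \<open>(z, n) \<mapsto> (z a\<^sup>n, n)\<close>, which act trivially on \<open>T\<close> and on the quotient by it.
\<close>

definition shear :: "complex \<Rightarrow> complex \<times> int \<Rightarrow> complex \<times> int" where
  "shear a = (\<lambda>x\<in>carrier A. (fst x * a powi snd x, snd x))"

text \<open>The endomorphisms \<open>(z, n) \<mapsto> (z\<^sup>r, n)\<close>; they are automorphisms if \<open>r\<close> is prime to \<open>p\<close>.\<close>

definition scaling :: "nat \<Rightarrow> complex \<times> int \<Rightarrow> complex \<times> int" where
  "scaling r = (\<lambda>x\<in>carrier A. (fst x ^ r, snd x))"

lemma shear_apply: "z \<in> T \<Longrightarrow> shear a (z, n) = (z * a powi n, n)"
  by (simp add: shear_def carrier_A del: carrier_DirProd)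

lemma scaling_apply: "z \<in> T \<Longrightarrow> scaling r (z, n) = (z ^ r, n)"
  by (simp add: scaling_def carrier_A del: carrier_DirProd)

lemma shear_auto:
  assumes a: "a \<in> T"
  shows "shear a \<in> auto A"
proof -
  have a0: "a \<noteq> 0" using T_nonzero[OF a] .
  have "shear a \<in> hom A A"
  proof (rule homI)
    fix x assume "x \<in> carrier A"
    then obtain z m where x: "x = (z, m)" "z \<in> T" unfolding carrier_A by blast
    show "shear a x \<in> carrier A" using x T_mult[OF x(2) T_powi[OF a]] unfolding carrier_A x(1) shear_apply[OF x(2)] by blast
    fix y assume "y \<in> carrier A"
    then obtain w n where y: "y = (w, n)" "w \<in> T" unfolding carrier_A by blast
    show "shear a (x \<otimes>\<^bsub>A\<^esub> y) = shear a x \<otimes>\<^bsub>A\<^esub> shear a y"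
      unfolding x(1) y(1) mult_A shear_apply[OF x(2)] shear_apply[OF y(2)] shear_apply[OF T_mult[OF x(2) y(2)]]
      using a0 by (simp add: power_int_add)
  qed
  moreover have "bij_betw (shear a) (carrier A) (carrier A)"
  proof (rule bij_betwI[of _ _ _ "shear (inverse a)"])
    have ia: "inverse a \<in> T" using T_powi[OF a, of "-1"] by simp
    have maps: "shear b \<in> carrier A \<rightarrow> carrier A" if b: "b \<in> T" for b
    proof
      fix x assume "x \<in> carrier A"
      then obtain z m where x: "x = (z, m)" "z \<in> T" unfolding carrier_A by blast
      show "shear b x \<in> carrier A" using T_mult[OF x(2) T_powi[OF b]] unfolding carrier_A x(1) shear_apply[OF x(2)] by blast
    qed
    show "shear a \<in> carrier A \<rightarrow> carrier A" "shear (inverse a) \<in> carrier A \<rightarrow> carrier A" using maps a ia by blast+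
    have cancel: "shear c (shear b x) = x" if bc: "b \<in> T" "c \<in> T" "b * c = 1" and x: "x \<in> carrier A" for b c x
    proof -
      obtain z m where x: "x = (z, m)" "z \<in> T" using x unfolding carrier_A by blast
      have "b powi m * c powi m = 1" using bc(3) by (metis power_int_1_left power_int_mult_distrib)
      then show ?thesis
        unfolding x(1) shear_apply[OF x(2)] shear_apply[OF T_mult[OF x(2) T_powi[OF bc(1)]]] by (simp add: mult.assoc)
    qed
    show "shear (inverse a) (shear a x) = x" if "x \<in> carrier A" for x by (rule cancel[OF a ia _ that]) (use a0 in simp)
    show "shear a (shear (inverse a) x) = x" if "x \<in> carrier A" for x by (rule cancel[OF ia a _ that]) (use a0 in simp)
  qed
  moreover have "shear a \<in> extensional (carrier A)" unfolding shear_def by (rule restrict_extensional)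
  ultimately show ?thesis by (simp only: auto_def Bij_def Int_iff mem_Collect_eq simp_thms)
qed

lemma scaling_auto:
  assumes r: "r > 0" "coprime r p"
  shows "scaling r \<in> auto A"
proof -
  have "scaling r \<in> hom A A"
  proof (rule homI)
    fix x assume "x \<in> carrier A"
    then obtain z m where x: "x = (z, m)" "z \<in> T" unfolding carrier_A by blast
    show "scaling r x \<in> carrier A" using T_power[OF x(2)] unfolding carrier_A x(1) scaling_apply[OF x(2)] by blast
    fix y assume "y \<in> carrier A"
    then obtain w n where y: "y = (w, n)" "w \<in> T" unfolding carrier_A by blast
    show "scaling r (x \<otimes>\<^bsub>A\<^esub> y) = scaling r x \<otimes>\<^bsub>A\<^esub> scaling r y"
      unfolding x(1) y(1) mult_A scaling_apply[OF x(2)] scaling_apply[OF y(2)] scaling_apply[OF T_mult[OF x(2) y(2)]]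
      by (simp add: power_mult_distrib)
  qed
  moreover have "bij_betw (scaling r) (carrier A) (carrier A)" unfolding bij_betw_def
  proof
    show "inj_on (scaling r) (carrier A)"
    proof (rule inj_onI)
      fix x y assume "x \<in> carrier A" "y \<in> carrier A" and eq: "scaling r x = scaling r y"
      then obtain z m w n where x: "x = (z, m)" "z \<in> T" and y: "y = (w, n)" "w \<in> T" unfolding carrier_A by blast
      have zw: "z ^ r = w ^ r" "m = n"
        using eq unfolding x(1) y(1) scaling_apply[OF x(2)] scaling_apply[OF y(2)] by auto
      have "(z * w powi -1) ^ r = 1" using zw(1) T_nonzero[OF y(2)]
        by (simp add: power_mult_distrib power_inverse)
      then have "z * w powi -1 = 1" using T_root_unique[OF r(2) T_mult[OF x(2) T_powi[OF y(2)]]] by blast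
      then have "z = w" using T_nonzero[OF y(2)] by (simp add: field_simps)
      then show "x = y" using x y zw(2) by simp
    qed
    show "scaling r ` carrier A = carrier A"
    proof
      show "scaling r ` carrier A \<subseteq> carrier A"
      proof (rule image_subsetI)
        fix x assume "x \<in> carrier A"
        then obtain z m where x: "x = (z, m)" "z \<in> T" unfolding carrier_A by blast
        show "scaling r x \<in> carrier A" using T_power[OF x(2)] unfolding carrier_A x(1) scaling_apply[OF x(2)] by blast
      qed
      show "carrier A \<subseteq> scaling r ` carrier A"
      proof
        fix x assume "x \<in> carrier A"
        then obtain z m where x: "x = (z, m)" "z \<in> T" unfolding carrier_A by blast
        obtain w where w: "w \<in> T" "w ^ r = z" using T_divisible[OF r(1) x(2)] by blast
        have "x = scaling r (w, m)" using w x by (simp add: scaling_apply)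
        moreover have "(w, m) \<in> carrier A" using w(1) unfolding carrier_A by blast
        ultimately show "x \<in> scaling r ` carrier A" by blast
      qed
    qed
  qed
  moreover have "scaling r \<in> extensional (carrier A)" unfolding scaling_def by (rule restrict_extensional)
  ultimately show ?thesis by (simp only: auto_def Bij_def Int_iff mem_Collect_eq simp_thms)
qed

lemma finite_roots: "finite {z :: complex. z ^ (p ^ k) = 1}"
  using p_pos by (intro finite_roots_unity) auto

lemma shear_inertial:
  assumes a: "a \<in> T"
  shows "inertial A (shear a)"
proof (rule inertialI[OF comm_A shear_auto[OF a]])
  fix H assume H: "subgroup H A"
  obtain k where k: "a ^ (p ^ k) = 1" using a by blast
  let ?R = "{z :: complex. z ^ (p ^ k) = 1} \<times> {0 :: int}"
  have "\<exists>h'\<in>H. \<exists>r\<in>?R. shear a h = h' \<otimes>\<^bsub>A\<^esub> r" if h: "h \<in> H" for h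
  proof -
    obtain z n where z: "h = (z, n)" "z \<in> T" using subgroup.mem_carrier[OF H h] unfolding carrier_A by blast
    have "shear a h = h \<otimes>\<^bsub>A\<^esub> (a powi n, 0)" unfolding z(1) shear_apply[OF z(2)] mult_A by simp
    moreover have "(a powi n, 0) \<in> ?R" using powi_root[OF k] by simp
    ultimately show ?thesis using h by blast
  qed
  moreover have "finite ?R" "?R \<subseteq> carrier A" using finite_roots unfolding carrier_A by auto
  ultimately show "\<exists>R. finite R \<and> R \<subseteq> carrier A \<and> (\<forall>h\<in>H. \<exists>h'\<in>H. \<exists>r\<in>R. shear a h = h' \<otimes>\<^bsub>A\<^esub> r)" by blast
qed

text \<open>
  The second coordinates of \<open>H\<close> form a subgroup \<open>n\<int>\<close>. If \<open>(t, n) \<in> H\<close> then an element \<open>(s, j)\<close> of \<open>H\<close> can be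
  written with \<open>s = w t\<^sup>q\<close> and \<open>(w, 0) \<in> H\<close>. So scaling changes it, modulo \<open>H\<close>, by a power of \<open>t\<close>, and \<open>t\<close>
  has finite order.
\<close>

lemma scaling_inertial:
  assumes r: "r > 0" "coprime r p"
  shows "inertial A (scaling r)"
proof (rule inertialI[OF comm_A scaling_auto[OF r]])
  fix H assume H: "subgroup H A"
  interpret H: subgroup H A by fact
  interpret A: comm_group A by (rule comm_A)
  have HT: "z \<in> T" if "(z, n) \<in> H" for z n using H.mem_carrier[OF that] unfolding carrier_A by blast
  have Hm: "(z * w, m + n) \<in> H" if "(z, m) \<in> H" "(w, n) \<in> H" for z w m n
    using H.m_closed[OF that] unfolding mult_A .
  have H1: "(1, 0) \<in> H" using H.one_closed unfolding one_A .
  have Hi: "(inverse z, - n) \<in> H" if zn: "(z, n) \<in> H" for z n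
  proof -
    have z: "z \<in> T" using HT[OF zn] .
    then have "inverse z \<in> T" using T_powi[of z "-1"] by simp
    then have "inv\<^bsub>A\<^esub> (z, n) = (inverse z, - n)"
      using z T_nonzero[OF z] by (intro A.inv_equality) (simp_all add: mult_A one_A carrier_A del: mult_DirProd one_DirProd carrier_DirProd)
    then show ?thesis using H.m_inv_closed[OF zn] by (simp del: inv_DirProd)
  qed
  have Hpow: "(z powi k, k * n) \<in> H" if zn: "(z, n) \<in> H" for z n k
  proof (induction k rule: int_induct[where k = 0])
    case base
    show ?case using H1 by simp
  next
    case (step1 i)
    then show ?case using Hm[OF step1(2) zn] T_nonzero[OF HT[OF zn]] by (simp add: power_int_add algebra_simps)
  next
    case (step2 i)
    then show ?case using Hm[OF step2(2) Hi[OF zn]] T_nonzero[OF HT[OF zn]]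
      by (simp add: power_int_diff divide_inverse algebra_simps)
  qed
  have "\<exists>z. (z, k - l) \<in> H" if "\<exists>z. (z, k) \<in> H" "\<exists>z. (z, l) \<in> H" for k l
    using that Hm Hi by (metis diff_conv_add_uminus)
  then obtain n where n: "\<And>k. (\<exists>z. (z, k) \<in> H) \<longleftrightarrow> n dvd k"
    using int_subgroup_principal[of "\<lambda>k. \<exists>z. (z, k) \<in> H"] H1 by blast
  obtain t where t: "(t, n) \<in> H" using n[of n] by auto
  obtain k where k: "t ^ (p ^ k) = 1" using HT[OF t] by blast
  let ?R = "{z :: complex. z ^ (p ^ k) = 1} \<times> {0 :: int}"
  have "\<exists>h'\<in>H. \<exists>r'\<in>?R. scaling r h = h' \<otimes>\<^bsub>A\<^esub> r'" if h: "h \<in> H" for h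
  proof -
    obtain s j where s: "h = (s, j)" "s \<in> T" using H.mem_carrier[OF h] unfolding carrier_A by blast
    then have "n dvd j" using n h by blast
    then obtain q where q: "j = n * q" by (rule dvdE)
    define w where "w = s * t powi (- q)"
    have w: "(w, 0) \<in> H" using Hm[OF h[unfolded s(1)] Hpow[OF t, of "- q"]] q by (simp add: w_def mult.commute)
    have t0: "t \<noteq> 0" using T_nonzero[OF HT[OF t]] .
    have sw: "s = w * t powi q" using t0 by (simp add: w_def power_int_minus)
    have "(w powi (int r - 1), 0) \<in> H" using Hpow[OF w, of "int r - 1"] by simp
    then have h': "(s * w powi (int r - 1), j) \<in> H" using Hm[OF h[unfolded s(1)]] by fastforce
    have w0: "w \<noteq> 0" using T_nonzero[OF HT[OF w]] .
    have "s ^ r = (s * w powi (int r - 1)) * (t powi q) powi (int r - 1)"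
    proof -
      have "s ^ r = s powi (1 + (int r - 1))" by simp
      also have "\<dots> = s * s powi (int r - 1)" using T_nonzero[OF s(2)] by (simp only: power_int_add power_int_1_right simp_thms not_False_eq_True)
      also have "s powi (int r - 1) = w powi (int r - 1) * (t powi q) powi (int r - 1)"
        by (subst sw) (rule power_int_mult_distrib)
      finally show ?thesis by (simp only: mult.assoc)
    qed
    then have "scaling r h = (s * w powi (int r - 1), j) \<otimes>\<^bsub>A\<^esub> ((t powi q) powi (int r - 1), 0)"
      unfolding s(1) scaling_apply[OF s(2)] mult_A by simp
    moreover have "((t powi q) powi (int r - 1), 0) \<in> ?R" using powi_root[OF powi_root[OF k]] by simp
    ultimately show ?thesis using h' by blast
  qed
  moreover have "finite ?R" "?R \<subseteq> carrier A" using finite_roots unfolding carrier_A by auto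
  ultimately show "\<exists>R. finite R \<and> R \<subseteq> carrier A \<and> (\<forall>h\<in>H. \<exists>h'\<in>H. \<exists>r'\<in>R. scaling r h = h' \<otimes>\<^bsub>A\<^esub> r')" by blast
qed

lemma IAut_mem: "inertial A \<gamma> \<Longrightarrow> \<gamma> \<in> carrier (IA)"
  by (simp add: IAut_def generate.incl)

lemma IAut_mult:
  assumes "g \<in> auto A" "h \<in> auto A"
  shows "g \<otimes>\<^bsub>IA\<^esub> h = compose (carrier A) g h"
  using assms by (simp add: IAut_def AutoGroup_def BijGroup_def auto_def del: carrier_DirProd)

lemma scaling_mult:
  assumes r: "r > 0" "coprime r p" and s: "s > 0" "coprime s p"
  shows "scaling r \<otimes>\<^bsub>IA\<^esub> scaling s = scaling (s * r)"
  unfolding IAut_mult[OF scaling_auto[OF r] scaling_auto[OF s]]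
proof (rule extensionalityI)
  show "compose (carrier A) (scaling r) (scaling s) \<in> extensional (carrier A)" by (rule compose_extensional)
  show "scaling (s * r) \<in> extensional (carrier A)" unfolding scaling_def by (rule restrict_extensional)
  fix x assume xc: "x \<in> carrier A"
  then obtain z m where x: "x = (z, m)" "z \<in> T" unfolding carrier_A by blast
  have "compose (carrier A) (scaling r) (scaling s) x = scaling r (scaling s x)" by (rule compose_eq[OF xc])
  also have "\<dots> = scaling (s * r) x"
    unfolding x(1) scaling_apply[OF x(2)] scaling_apply[OF T_power[OF x(2)]] by (simp add: power_mult)
  finally show "compose (carrier A) (scaling r) (scaling s) x = scaling (s * r) x" .
qed

lemma scaling_one: "scaling 1 = \<one>\<^bsub>IA\<^esub>"
  by (rule ext) (auto simp: scaling_def IAut_def AutoGroup_def BijGroup_def restrict_def)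

lemma scaling_pow:
  assumes r: "r > 0" "coprime r p"
  shows "scaling r [^]\<^bsub>IA\<^esub> (m :: nat) = scaling (r ^ m)"
proof (induction m)
  case 0
  show ?case using scaling_one by (simp add: nat_pow_def)
next
  case (Suc m)
  interpret I: group "IA" by (rule group_IAut) (use comm_A in \<open>simp add: comm_group_def\<close>)
  have "scaling r [^]\<^bsub>IA\<^esub> Suc m = scaling (r ^ m) \<otimes>\<^bsub>IA\<^esub> scaling r" using Suc by simp
  also have "\<dots> = scaling (r * r ^ m)" by (rule scaling_mult) (use r in auto)
  finally show ?case by simp
qed

text \<open>
  The commutator relation is verified in the form \<open>shear a \<cdot> scaling r = shear b \<cdot> scaling r \<cdot> shear a\<close>.
\<close>

lemma shear_commutator:
  assumes r: "r > 0" "coprime r p" and a: "a \<in> T" and b: "b \<in> T" and ab: "b * a ^ r = a"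
  shows "shear a \<otimes>\<^bsub>IA\<^esub> scaling r \<otimes>\<^bsub>IA\<^esub> inv\<^bsub>IA\<^esub> (shear a) \<otimes>\<^bsub>IA\<^esub> inv\<^bsub>IA\<^esub> (scaling r) = shear b"
proof -
  interpret I: group "IA" by (rule group_IAut) (use comm_A in \<open>simp add: comm_group_def\<close>)
  have c: "shear a \<in> carrier (IA)" "shear b \<in> carrier (IA)" "scaling r \<in> carrier (IA)"
    using IAut_mem shear_inertial scaling_inertial a b r by auto
  have au: "shear a \<in> auto A" "shear b \<in> auto A" "scaling r \<in> auto A"
    using shear_auto scaling_auto a b r by auto
  have rs: "scaling r \<otimes>\<^bsub>IA\<^esub> shear a \<in> auto A" "shear a \<otimes>\<^bsub>IA\<^esub> scaling r \<in> auto A"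
  proof -
    have "subgroup (carrier (IA)) (AutoGroup A)" unfolding IAut_def
      by (simp, rule group.generate_is_subgroup[OF group.AutoGroup])
        (use comm_A in \<open>auto simp: comm_group_def AutoGroup_def inertial_def\<close>)
    then have "carrier (IA) \<subseteq> auto A" using subgroup.subset by (fastforce simp: AutoGroup_def)
    then show "scaling r \<otimes>\<^bsub>IA\<^esub> shear a \<in> auto A" "shear a \<otimes>\<^bsub>IA\<^esub> scaling r \<in> auto A"
      using I.m_closed[OF c(3,1)] I.m_closed[OF c(1,3)] by blast+
  qed
  have eq: "shear a \<otimes>\<^bsub>IA\<^esub> scaling r = shear b \<otimes>\<^bsub>IA\<^esub> (scaling r \<otimes>\<^bsub>IA\<^esub> shear a)"
    unfolding IAut_mult[OF au(1,3)] IAut_mult[OF au(2) rs(1)] unfolding IAut_mult[OF au(3,1)]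
  proof (rule extensionalityI)
    fix x assume xc: "x \<in> carrier A"
    then obtain z m where x: "x = (z, m)" "z \<in> T" unfolding carrier_A by blast
    have T: "z ^ r \<in> T" "z * a powi m \<in> T" using T_power[OF x(2)] T_mult[OF x(2) T_powi[OF a]] by blast+
    have "(z * a powi m) ^ r * b powi m = z ^ r * ((a powi m) ^ r * b powi m)" by (simp add: power_mult_distrib mult_ac)
    also have "(a powi m) ^ r * b powi m = (b * a ^ r) powi m"
      by (simp add: power_int_mult_distrib mult.commute flip: power_int_mult power_int_of_nat)
    finally have "(z * a powi m) ^ r * b powi m = z ^ r * a powi m" using ab by simp
    then have "shear a (scaling r x) = shear b (scaling r (shear a x))"
      unfolding x(1) scaling_apply[OF x(2)] shear_apply[OF T(1)]
        shear_apply[OF x(2)] scaling_apply[OF T(2)] shear_apply[OF T_power[OF T(2)]] by simp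
    then show "compose (carrier A) (shear a) (scaling r) x =
        compose (carrier A) (shear b) (compose (carrier A) (scaling r) (shear a)) x"
      by (simp only: compose_eq[OF xc])
  qed (rule compose_extensional)+
  show ?thesis unfolding eq using c by (simp add: I.m_assoc I.inv_mult_group)
qed

theorem not_nilpotent_by_locally_finite:
  "\<not> is_X_by_Y nilpotent locally_finite (IAut A)"
proof
  assume "is_X_by_Y nilpotent locally_finite (IA)"
  then obtain N where N: "N \<lhd> IA" "nilpotent ((IA)\<lparr>carrier := N\<rparr>)" "locally_finite (IA Mod N)"
    unfolding is_X_by_Y_def by blast
  interpret N: normal N "IA" by fact
  have q: "1 + p > 0" "coprime (1 + p) p" by (auto simp: coprime_commute intro: coprime_Suc_left_nat)
  have "scaling (1 + p) \<in> carrier (IA)" by (rule IAut_mem[OF scaling_inertial[OF q]])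
  from N.locally_finite_power_mem[OF N(3) this]
  obtain m :: nat where m: "m > 0" "scaling (1 + p) [^]\<^bsub>IA\<^esub> m \<in> N" by blast
  \<comment> \<open>every shear is the commutator of a shear with \<open>scaling r\<close>, an element of the normal subgroup \<open>N\<close>\<close>
  define r where "r = (1 + p) ^ m"
  have r: "r > 0" "coprime r p" using q by (auto simp: r_def)
  have rN: "scaling r \<in> N" using m(2) scaling_pow[OF q] by (simp add: r_def)
  have r1: "r - 1 > 0"
  proof -
    have "1 < (1 + p) ^ m" using m(1) p_pos by (intro one_less_power) auto
    then show ?thesis by (simp add: r_def)
  qed
  have comm: "\<exists>a\<in>T. shear a \<otimes>\<^bsub>IA\<^esub> scaling r \<otimes>\<^bsub>IA\<^esub> inv\<^bsub>IA\<^esub> (shear a) \<otimes>\<^bsub>IA\<^esub> inv\<^bsub>IA\<^esub> (scaling r) = shear b"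
    if b: "b \<in> T" for b
  proof -
    have ib: "inverse b \<in> T" using T_powi[OF b, of "-1"] by simp
    obtain a where a: "a \<in> T" "a ^ (r - 1) = inverse b" using T_divisible[OF r1 ib] by blast
    have "a ^ r = a * a ^ (r - 1)" using r1 by (simp flip: power_Suc)
    then have "b * a ^ r = a" using a(2) T_nonzero[OF b] by simp
    then show ?thesis using shear_commutator[OF r a(1) b] a(1) by blast
  qed
  have shI: "shear a \<in> carrier (IA)" if "a \<in> T" for a using IAut_mem[OF shear_inertial[OF that]] .
  have shN: "shear b \<in> N" if b: "b \<in> T" for b
  proof -
    obtain a where a: "a \<in> T" "shear a \<otimes>\<^bsub>IA\<^esub> scaling r \<otimes>\<^bsub>IA\<^esub> inv\<^bsub>IA\<^esub> (shear a) \<otimes>\<^bsub>IA\<^esub> inv\<^bsub>IA\<^esub> (scaling r) = shear b"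
      using comm[OF b] by blast
    have "shear a \<otimes>\<^bsub>IA\<^esub> scaling r \<otimes>\<^bsub>IA\<^esub> inv\<^bsub>IA\<^esub> (shear a) \<in> N" by (rule N.inv_op_closed2[OF shI[OF a(1)] rN])
    then show ?thesis using a(2) subgroup.m_closed[OF N.is_subgroup _ N.m_inv_closed[OF rN]] by metis
  qed
  let ?M = "(IA)\<lparr>carrier := N\<rparr>"
  have inv: "inv\<^bsub>?M\<^esub> g = inv\<^bsub>IA\<^esub> g" if "g \<in> N" for g by (rule N.m_inv_consistent[OF N.is_subgroup that])
  have lc: "shear b \<in> lower_central ?M n" if "b \<in> T" for b n
    using that
  proof (induction n arbitrary: b)
    case 0
    then show ?case using shN by simp
  next
    case (Suc n)
    obtain a where a: "a \<in> T" "shear a \<otimes>\<^bsub>IA\<^esub> scaling r \<otimes>\<^bsub>IA\<^esub> inv\<^bsub>IA\<^esub> (shear a) \<otimes>\<^bsub>IA\<^esub> inv\<^bsub>IA\<^esub> (scaling r) = shear b"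
      using comm[OF Suc.prems] by blast
    have "shear b = shear a \<otimes>\<^bsub>?M\<^esub> scaling r \<otimes>\<^bsub>?M\<^esub> inv\<^bsub>?M\<^esub> (shear a) \<otimes>\<^bsub>?M\<^esub> inv\<^bsub>?M\<^esub> (scaling r)"
      using a(2) inv[OF shN[OF a(1)]] inv[OF rN] by simp
    moreover have "scaling r \<in> carrier ?M" using rN by simp
    ultimately show ?case using Suc.IH[OF a(1)]
      unfolding lower_central.simps commutator_subgroup_def by (intro generate.incl) blast
  qed
  obtain n where "lower_central ?M n = {\<one>\<^bsub>?M\<^esub>}" using N(2) unfolding nilpotent_def by blast
  then have triv: "shear b = \<one>\<^bsub>IA\<^esub>" if "b \<in> T" for b using lc[OF that, of n] by simp
  have "card {z :: complex. z ^ p = 1} = p" by (rule card_roots_unity_eq[OF p_pos])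
  then have "{z :: complex. z ^ p = 1} \<noteq> {1}" using p by (metis card_1_singleton_iff One_nat_def not_prime_1)
  then obtain b :: complex where b: "b ^ p = 1" "b \<noteq> 1" by (auto)
  have bT: "b \<in> T" using b(1) by (intro CollectI exI[of _ 1]) simp
  have "shear b = shear 1" using triv[OF bT] triv[OF T_1] by simp
  then have "shear b (1, 1) = shear 1 (1, 1)" by simp
  then have "b = 1" unfolding shear_apply[OF T_1] by simp
  then show False using b(2) by simp
qed

end

theorem corollaryB:
  fixes A :: "('a, 'b) monoid_scheme" and p :: nat
  shows "(comm_group A \<longrightarrow> is_X_by_Y metabelian locally_finite (IAut A)) \<and>
    (normalization_semidom_class.prime p \<longrightarrow>
       \<not> is_X_by_Y nilpotent locally_finite (IAut (prufer_group p \<times>\<times> integer_group)))"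
  using IAut_metabelian_by_locally_finite
    prufer_times_int.not_nilpotent_by_locally_finite[OF prufer_times_int.intro] by blast

end
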